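(* Let $\mathbf Z,A,B,\mathbf U,\mathbf Z^T,T,\mathbf z^0,h$ be the data of the optimal control problem described in the context, where for every positive integer $N$ the sets $\mathbf Z_N$ and $\mathbf Z_N^T$ are closed real intervals $[\underline{z_N},\overline{z_N}]$ and $[\underline{z_N}^T,\overline{z_N}^T]$. Assume that the set $\mathcal U^T$ of admissible controls is nonempty. Then: (i) For all positive integers $N$, the infinite-dimensional linear program defining $\mathbf P_N$ is solvable, that is, the infimum is attained, and $$\mathbf P_N\le J_N(0,T,\mathbf z^0)\le J(0,T,\mathbf z^0).$$ (ii) For all positive integers $N$, there is no duality gap between the linear program defining $\mathbf P_N$ and its dual. (iii) If for every $(t,\mathbf z)\in[0,T]\times\mathbf Z$ the set $\{A\mathbf z+Bu:u\in\mathbf U\}$ is convex and the function $$v\mapsto g_{t,\mathbf z}(v):=\inf\{h(t,u):u\in\mathbf U,\ v=A\mathbf z+Bu\}$$ is convex, then for all positive integers $N$ the $N$-mode optimal control problem $\inf_{u\in\mathcal U_N^T}J(0,T,\mathbf z^0,u)$ has an optimal solution and $\mathbf P_N=J_N(0,T,\mathbf z^0)$.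
   Context: **Riesz-spectral operator.** A sequence $(\Phi_k)_{k\ge1}$ in a Hilbert space $\mathbf Z$ is a Riesz basis if its closed linear span is $\mathbf Z$ and there are $c,C>0$ with $c\sum_{k=1}^n|\alpha_k|^2\le\|\sum_{k=1}^n\alpha_k\Phi_k\|^2\le C\sum_{k=1}^n|\alpha_k|^2$ for all positive integers $n$ and all scalars $\alpha_1,\dots,\alpha_n$. A closed linear operator $A$ on $\mathbf Z$ with simple eigenvalues $(\lambda_k)_{k\ge1}$ and corresponding eigenvectors $(\Phi_k)_{k\ge1}$ forming a Riesz basis of $\mathbf Z$, such that the closure of $\{\lambda_k:k\ge1\}$ is disconnected, is called Riesz-spectral. Its domain is $D(A)$. Let $(\Psi_k)_{k\ge1}$ be the eigenvectors of $A^\star$ with $\langle\Phi_k,\Psi_j\rangle=\delta_{kj}$; then $A\mathbf z=\sum_{k\ge1}\lambda_k\langle\mathbf z,\Psi_k\rangle\Phi_k$ for $\mathbf z\in D(A)$. **Data.** $\mathbf Z$ is a Hilbert space; $A$ is a Riesz-spectral operator on $\mathbf Z$, with real eigenvalues $(\lambda_k)$, which is the infinitesimal generator of a strongly continuous semigroup on $\mathbf Z$; $m$ is a positive integer; $\mathbf U$ is a compact subset of $\mathbb R^m$; $B$ is a bounded linear operator from $\mathbf U$ to $\mathbf Z$, written $Bu=\sum_{i=1}^mB_iu_i$ with $B_i:\mathbb R\to\mathbf Z$; $\mathbf Z^T$ is a subset of $D(A)$; $T>0$; $\mathbf z^0\in D(A)$; $h:[0,\infty)\times\mathbf U\to\mathbb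 R$ is smooth. **Full problem.** $\mathcal U^T$ is the set of admissible controls on $[0,T]$: bounded measurable $u:[0,T]\to\mathbf U$ for which there exists a solution $\mathbf z(\cdot)$ of $\dot{\mathbf z}=A\mathbf z(t)+Bu(t)$, $t\in[0,T]$, with $\mathbf z(0)=\mathbf z^0$, such that $(\mathbf z(t),u(t))\in\mathbf Z\times\mathbf U$ a.e. on $[0,T]$ and $\mathbf z(T)\in\mathbf Z^T$. The cost is $J(0,T,\mathbf z^0,u)=\int_0^Th(t,u(t))\,dt$, and $J(0,T,\mathbf z^0):=\inf_{u\in\mathcal U^T}J(0,T,\mathbf z^0,u)$. **$N$-mode problem.** For each positive integer $k$ put $z_k^0:=\langle\mathbf z^0,\Psi_k\rangle$, $b_k(u):=\sum_{i=1}^m\langle B_iu_i,\Psi_k\rangle$, $f_k(t,z_k,u):=\lambda_kz_k+b_k(u)$, $\mathbf Z_k:=\{\langle\mathbf z,\Psi_k\rangle:\mathbf z\in\mathbf Z\}$ and $\mathbf Z_k^T:=\{\langle\mathbf z,\Psi_k\rangle:\mathbf z\in\mathbf Z^T\}$. For a positive integer $N$, $\mathcal U_N^T$ is the set of controls $u$ on $[0,T]$ for which there exists a trajectory $(z_1,\dots,z_N)$ solving $\dot z_k=f_k(t,z_k,u)$ on $[0,T]$, $z_k(0)=z_k^0$, $k=1,\dots,N$, with $(z_1(t),\dots,z_N(t),u(t))\in\mathbf Z_1\times\cdots\times\mathbf Z_N\times\mathbf U$ a.e. on $[0,T]$ and $(z_1(T),\dots,z_N(T))\in\mathbf Z_1^T\times\cdots\times\mathbf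 Z_N^T$. Put $J_N(0,T,\mathbf z^0):=\inf_{u\in\mathcal U_N^T}J(0,T,\mathbf z^0,u)$. **Linear program $\mathbf P_N$.** Let $\Sigma_N:=[0,T]\times\mathbf Z_1\times\cdots\times\mathbf Z_N$ and $S_N:=\Sigma_N\times\mathbf U$. For $g\in\mathcal C^1(\Sigma_N)$ define the continuous function on $S_N$ $$\mathcal L_Ng:=\frac{\partial g}{\partial t}(t,z_1,\dots,z_N)+\sum_{k=1}^Nf_k(t,z_k,u)\frac{\partial g}{\partial z_k}(t,z_1,\dots,z_N).$$ Let $\mathcal M_+(K)$ denote the nonnegative Borel measures on $K$. The program is $$\mathbf P_N:=\inf_{\mu_N,\mu_N^T}\int_{S_N}h\,d\mu_N$$ over $\mu_N\in\mathcal M_+(S_N)$ and $\mu_N^T\in\mathcal M_+(\mathbf Z_1^T\times\cdots\times\mathbf Z_N^T)$ such that for all $g\in\mathcal C^1(\Sigma_N)$ $$\int g(T,z_1,\dots,z_N)\,d\mu_N^T-g(0,z_1^0,\dots,z_N^0)=\int_{S_N}\mathcal L_Ng\,d\mu_N .$$ ($\mathbf P_N$ denotes the optimal value.) Its linear programming dual is $$\sup\big\{g(0,z_1^0,\dots,z_N^0):\ g\in\mathcal C^1(\Sigma_N),\ \mathcal L_Ng+h\ge0\text{ on }S_N,\ g(T,\cdot)\le0\text{ on }\mathbf Z_1^T\times\cdots\times\mathbf Z_N^T\big\}.$$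
   Formalization: Since ⟨cΦ_k,Ψ_k⟩=c, taking Z to be the whole Hilbert space gives Z_k=ℝ, never an interval [a,b]; so the state set Z in the constraints, in Z_k and in (iii) is read as an arbitrary subset of the Hilbert space containing Z^T, with z in (iii) also in D(A). *)

theory Defs
  imports "HOL-Analysis.Analysis"
begin

text \<open>
  Conventions. Hilbert spaces are real. An unbounded operator is a pair of a domain \<open>D\<close> and a
  function \<open>A\<close> whose values outside \<open>D\<close> are irrelevant. Sequences and modes are indexed from \<open>0\<close>,
  so that the first \<open>N\<close> modes are those with index in \<open>{..<N}\<close>. A point of the \<open>N\<close>-dimensional
  mode space is an element of \<open>\<Pi>\<^sub>E k\<in>{..<N}. UNIV\<close>, a subspace of \<open>nat \<Rightarrow> real\<close> with the
  product topology.
\<close>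

section \<open>Riesz-spectral operators and semigroups\<close>

definition riesz_basis :: "(nat \<Rightarrow> 'a::real_inner) \<Rightarrow> bool" where
  "riesz_basis \<Phi> \<longleftrightarrow>
     closure (span (range \<Phi>)) = UNIV \<and>
     (\<exists>c>0. \<exists>C>0. \<forall>n (\<alpha> :: nat \<Rightarrow> real).
        c * (\<Sum>k<n. \<bar>\<alpha> k\<bar>\<^sup>2) \<le> (norm (\<Sum>k<n. \<alpha> k *\<^sub>R \<Phi> k))\<^sup>2 \<and>
        (norm (\<Sum>k<n. \<alpha> k *\<^sub>R \<Phi> k))\<^sup>2 \<le> C * (\<Sum>k<n. \<bar>\<alpha> k\<bar>\<^sup>2))"

definition closed_linear_operator :: "'a::real_normed_vector set \<Rightarrow> ('a \<Rightarrow> 'a) \<Rightarrow> bool" where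
  "closed_linear_operator D A \<longleftrightarrow>
     subspace D \<and>
     (\<forall>x\<in>D. \<forall>y\<in>D. A (x + y) = A x + A y) \<and>
     (\<forall>x\<in>D. \<forall>r. A (r *\<^sub>R x) = r *\<^sub>R A x) \<and>
     closed ((\<lambda>x. (x, A x)) ` D)"

definition eigenvector :: "'a::real_vector set \<Rightarrow> ('a \<Rightarrow> 'a) \<Rightarrow> real \<Rightarrow> 'a \<Rightarrow> bool" where
  "eigenvector D A \<mu> x \<longleftrightarrow> x \<in> D \<and> x \<noteq> 0 \<and> A x = \<mu> *\<^sub>R x"

definition simple_eigenvalue :: "'a::real_vector set \<Rightarrow> ('a \<Rightarrow> 'a) \<Rightarrow> real \<Rightarrow> bool" where
  "simple_eigenvalue D A \<mu> \<longleftrightarrow> dim {x \<in> D. A x = \<mu> *\<^sub>R x} = 1"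

definition riesz_spectral ::
  "'a::real_inner set \<Rightarrow> ('a \<Rightarrow> 'a) \<Rightarrow> (nat \<Rightarrow> real) \<Rightarrow> (nat \<Rightarrow> 'a) \<Rightarrow> bool" where
  "riesz_spectral D A lam \<Phi> \<longleftrightarrow>
     closed_linear_operator D A \<and>
     (\<forall>k. simple_eigenvalue D A (lam k) \<and> eigenvector D A (lam k) (\<Phi> k)) \<and>
     riesz_basis \<Phi> \<and>
     \<not> connected (closure (range lam))"

definition adjoint_domain :: "'a::real_inner set \<Rightarrow> ('a \<Rightarrow> 'a) \<Rightarrow> 'a set" where
  "adjoint_domain D A = {y. \<exists>w. \<forall>x\<in>D. inner (A x) y = inner x w}"

text \<open>The description is unique when \<open>D\<close> is dense, as it is for a Riesz-spectral operator.\<close>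

definition adjoint_operator :: "'a::real_inner set \<Rightarrow> ('a \<Rightarrow> 'a) \<Rightarrow> 'a \<Rightarrow> 'a" where
  "adjoint_operator D A y = (THE w. \<forall>x\<in>D. inner (A x) y = inner x w)"

definition dual_eigenvectors ::
  "'a::real_inner set \<Rightarrow> ('a \<Rightarrow> 'a) \<Rightarrow> (nat \<Rightarrow> 'a) \<Rightarrow> (nat \<Rightarrow> 'a) \<Rightarrow> bool" where
  "dual_eigenvectors D A \<Phi> \<Psi> \<longleftrightarrow>
     (\<forall>k. \<exists>\<mu>. eigenvector (adjoint_domain D A) (adjoint_operator D A) \<mu> (\<Psi> k)) \<and>
     (\<forall>k j. inner (\<Phi> k) (\<Psi> j) = (if k = j then 1 else 0))"

definition C0_semigroup :: "(real \<Rightarrow> 'a::real_normed_vector \<Rightarrow> 'a) \<Rightarrow> bool" where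
  "C0_semigroup S \<longleftrightarrow>
     (\<forall>t\<ge>0. bounded_linear (S t)) \<and>
     (\<forall>x. S 0 x = x) \<and>
     (\<forall>s\<ge>0. \<forall>t\<ge>0. \<forall>x. S (s + t) x = S s (S t x)) \<and>
     (\<forall>x. ((\<lambda>t. S t x) \<longlongrightarrow> x) (at_right 0))"

definition infinitesimal_generator ::
  "(real \<Rightarrow> 'a::real_normed_vector \<Rightarrow> 'a) \<Rightarrow> 'a set \<Rightarrow> ('a \<Rightarrow> 'a) \<Rightarrow> bool" where
  "infinitesimal_generator S D A \<longleftrightarrow>
     D = {x. \<exists>y. ((\<lambda>t. (S t x - x) /\<^sub>R t) \<longlongrightarrow> y) (at_right 0)} \<and>
     (\<forall>x\<in>D. ((\<lambda>t. (S t x - x) /\<^sub>R t) \<longlongrightarrow> A x) (at_right 0))"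

section \<open>Smooth running cost\<close>

primrec Ck_on :: "nat \<Rightarrow> ('b::euclidean_space \<Rightarrow> real) \<Rightarrow> 'b set \<Rightarrow> bool" where
  "Ck_on 0 f W \<longleftrightarrow> continuous_on W f"
| "Ck_on (Suc k) f W \<longleftrightarrow>
     (\<forall>x\<in>W. f differentiable (at x)) \<and>
     (\<forall>v. Ck_on k (\<lambda>x. frechet_derivative f (at x) v) W)"

text \<open>On a set that need not be open, smooth means: restriction of a function which is
  infinitely differentiable on an open neighbourhood.\<close>

definition smooth_on :: "('b::euclidean_space \<Rightarrow> real) \<Rightarrow> 'b set \<Rightarrow> bool" where
  "smooth_on f X \<longleftrightarrow>
     (\<exists>W F. open W \<and> X \<subseteq> W \<and> (\<forall>k. Ck_on k F W) \<and> (\<forall>x\<in>X. F x = f x))"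

section \<open>The full problem\<close>

definition controls :: "(real^'m) set \<Rightarrow> real \<Rightarrow> (real \<Rightarrow> real^'m) set" where
  "controls U T = {u. u \<in> borel_measurable (lebesgue_on {0..T}) \<and>
                      bounded (u ` {0..T}) \<and> (\<forall>t\<in>{0..T}. u t \<in> U)}"

text \<open>For controls that are merely measurable, a solution of \<open>z' = A z + B u\<close>, \<open>z 0 = z0\<close> is a mild
  solution \<open>z t = S t z0 + \<integral>\<^sub>0\<^sup>t S (t - s) (B (u s)) ds\<close>, with \<open>S\<close> the semigroup generated by \<open>A\<close>.\<close>

definition mild_solution ::
  "(real \<Rightarrow> 'a::banach \<Rightarrow> 'a) \<Rightarrow> (real^'m \<Rightarrow> 'a) \<Rightarrow> real \<Rightarrow> 'a \<Rightarrow> (real \<Rightarrow> real^'m) \<Rightarrow>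
   (real \<Rightarrow> 'a) \<Rightarrow> bool" where
  "mild_solution S B T z0 u z \<longleftrightarrow>
     (\<forall>t\<in>{0..T}. ((\<lambda>s. S (t - s) (B (u s))) has_integral (z t - S t z0)) {0..t})"

text \<open>The ambient Hilbert space is the type; \<open>Zs\<close> is the set of states in which the trajectory is
  required to stay. It is kept separate from the Hilbert space because the images of the whole
  space under the modes are all of \<open>real\<close> and never compact intervals.\<close>

definition admissible_controls ::
  "(real \<Rightarrow> 'a::banach \<Rightarrow> 'a) \<Rightarrow> (real^'m \<Rightarrow> 'a) \<Rightarrow> (real^'m) set \<Rightarrow> 'a set \<Rightarrow> 'a set \<Rightarrow>
   real \<Rightarrow> 'a \<Rightarrow> (real \<Rightarrow> real^'m) set" where
  "admissible_controls S B U Zs ZT T z0 =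
     {u \<in> controls U T. \<exists>z. mild_solution S B T z0 u z \<and>
        (AE t in lebesgue_on {0..T}. z t \<in> Zs \<and> u t \<in> U) \<and> z T \<in> ZT}"

definition cost :: "(real \<Rightarrow> real^'m \<Rightarrow> real) \<Rightarrow> real \<Rightarrow> (real \<Rightarrow> real^'m) \<Rightarrow> real" where
  "cost h T u = (LINT t|lebesgue_on {0..T}. h t (u t))"

definition optimal_cost ::
  "(real \<Rightarrow> real^'m \<Rightarrow> real) \<Rightarrow> real \<Rightarrow> (real \<Rightarrow> real^'m) set \<Rightarrow> ereal" where
  "optimal_cost h T \<U> = (INF u\<in>\<U>. ereal (cost h T u))"

section \<open>The \<open>N\<close>-mode problem\<close>

definition mode :: "(nat \<Rightarrow> 'a::real_inner) \<Rightarrow> 'a \<Rightarrow> nat \<Rightarrow> real" where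
  "mode \<Psi> z k = inner z (\<Psi> k)"

definition mode_set :: "(nat \<Rightarrow> 'a::real_inner) \<Rightarrow> 'a set \<Rightarrow> nat \<Rightarrow> real set" where
  "mode_set \<Psi> X k = (\<lambda>z. mode \<Psi> z k) ` X"

definition component :: "(real^'m \<Rightarrow> 'a) \<Rightarrow> 'm \<Rightarrow> real \<Rightarrow> 'a" where
  "component B i r = B (axis i r)"

definition mode_input ::
  "(real^'m \<Rightarrow> 'a::real_inner) \<Rightarrow> (nat \<Rightarrow> 'a) \<Rightarrow> nat \<Rightarrow> real^'m \<Rightarrow> real" where
  "mode_input B \<Psi> k u = (\<Sum>i\<in>UNIV. inner (component B i (u $ i)) (\<Psi> k))"

definition mode_field ::
  "(nat \<Rightarrow> real) \<Rightarrow> (real^'m \<Rightarrow> 'a::real_inner) \<Rightarrow> (nat \<Rightarrow> 'a) \<Rightarrow> nat \<Rightarrow> real \<Rightarrow> real^'m \<Rightarrow> real" where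
  "mode_field lam B \<Psi> k x u = lam k * x + mode_input B \<Psi> k u"

text \<open>Trajectories are solutions in the sense of Caratheodory, written in integral form.\<close>

definition mode_trajectory ::
  "(nat \<Rightarrow> real) \<Rightarrow> (real^'m \<Rightarrow> 'a::real_inner) \<Rightarrow> (nat \<Rightarrow> 'a) \<Rightarrow> nat \<Rightarrow> real \<Rightarrow> 'a \<Rightarrow>
   (real \<Rightarrow> real^'m) \<Rightarrow> (nat \<Rightarrow> real \<Rightarrow> real) \<Rightarrow> bool" where
  "mode_trajectory lam B \<Psi> N T z0 u z \<longleftrightarrow>
     (\<forall>k<N. \<forall>t\<in>{0..T}.
        ((\<lambda>s. mode_field lam B \<Psi> k (z k s) (u s)) has_integral (z k t - mode \<Psi> z0 k)) {0..t})"

definition admissible_mode_controls ::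
  "(nat \<Rightarrow> real) \<Rightarrow> (real^'m \<Rightarrow> 'a::real_inner) \<Rightarrow> (nat \<Rightarrow> 'a) \<Rightarrow> (real^'m) set \<Rightarrow> 'a set \<Rightarrow> 'a set \<Rightarrow>
   nat \<Rightarrow> real \<Rightarrow> 'a \<Rightarrow> (real \<Rightarrow> real^'m) set" where
  "admissible_mode_controls lam B \<Psi> U Zs ZT N T z0 =
     {u \<in> controls U T. \<exists>z. mode_trajectory lam B \<Psi> N T z0 u z \<and>
        (AE t in lebesgue_on {0..T}. (\<forall>k<N. z k t \<in> mode_set \<Psi> Zs k) \<and> u t \<in> U) \<and>
        (\<forall>k<N. z k T \<in> mode_set \<Psi> ZT k)}"

section \<open>The linear program and its dual\<close>

definition mode_box :: "(nat \<Rightarrow> 'a::real_inner) \<Rightarrow> 'a set \<Rightarrow> nat \<Rightarrow> (nat \<Rightarrow> real) set" where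
  "mode_box \<Psi> X N = (\<Pi>\<^sub>E k\<in>{..<N}. mode_set \<Psi> X k)"

definition mode_point :: "(nat \<Rightarrow> 'a::real_inner) \<Rightarrow> nat \<Rightarrow> 'a \<Rightarrow> nat \<Rightarrow> real" where
  "mode_point \<Psi> N z = (\<lambda>k\<in>{..<N}. mode \<Psi> z k)"

definition Sigma_N ::
  "(nat \<Rightarrow> 'a::real_inner) \<Rightarrow> 'a set \<Rightarrow> nat \<Rightarrow> real \<Rightarrow> (real \<times> (nat \<Rightarrow> real)) set" where
  "Sigma_N \<Psi> Zs N T = {0..T} \<times> mode_box \<Psi> Zs N"

definition S_N ::
  "(nat \<Rightarrow> 'a::real_inner) \<Rightarrow> 'a set \<Rightarrow> (real^'m) set \<Rightarrow> nat \<Rightarrow> real \<Rightarrow>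
   ((real \<times> (nat \<Rightarrow> real)) \<times> (real^'m)) set" where
  "S_N \<Psi> Zs U N T = Sigma_N \<Psi> Zs N T \<times> U"

definition partial_t :: "(real \<times> (nat \<Rightarrow> real) \<Rightarrow> real) \<Rightarrow> real \<times> (nat \<Rightarrow> real) \<Rightarrow> real" where
  "partial_t g = (\<lambda>(t, z). deriv (\<lambda>s. g (s, z)) t)"

definition partial_z ::
  "nat \<Rightarrow> (real \<times> (nat \<Rightarrow> real) \<Rightarrow> real) \<Rightarrow> real \<times> (nat \<Rightarrow> real) \<Rightarrow> real" where
  "partial_z k g = (\<lambda>(t, z). deriv (\<lambda>x. g (t, z(k := x))) (z k))"

text \<open>Continuously differentiable functions of \<open>t, z\<^sub>0, \<dots>, z\<^sub>N\<^sub>-\<^sub>1\<close> on the whole space. A \<open>C\<^sup>1\<close> function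
  on the compact box \<open>Sigma_N\<close> is the restriction of such a function; working with functions on the
  whole space gives the partial derivatives a meaning at the boundary of the box, also when some
  of its sides reduce to a point.\<close>

definition C1_functions :: "nat \<Rightarrow> (real \<times> (nat \<Rightarrow> real) \<Rightarrow> real) set" where
  "C1_functions N =
     {g. let E = UNIV \<times> (\<Pi>\<^sub>E k\<in>{..<N}. UNIV) in
         continuous_on E g \<and>
         (\<forall>(t, z)\<in>E. (\<lambda>s. g (s, z)) field_differentiable (at t)) \<and>
         (\<forall>k<N. \<forall>(t, z)\<in>E. (\<lambda>x. g (t, z(k := x))) field_differentiable (at (z k))) \<and>
         continuous_on E (partial_t g) \<and>
         (\<forall>k<N. continuous_on E (partial_z k g))}"

definition liouville ::
  "(nat \<Rightarrow> real) \<Rightarrow> (real^'m \<Rightarrow> 'a::real_inner) \<Rightarrow> (nat \<Rightarrow> 'a) \<Rightarrow> nat \<Rightarrow>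
   (real \<times> (nat \<Rightarrow> real) \<Rightarrow> real) \<Rightarrow> (real \<times> (nat \<Rightarrow> real)) \<times> (real^'m) \<Rightarrow> real" where
  "liouville lam B \<Psi> N g = (\<lambda>((t, z), u).
     partial_t g (t, z) + (\<Sum>k<N. mode_field lam B \<Psi> k (z k) u * partial_z k g (t, z)))"

text \<open>All sets to which this is applied are compact, and nonnegative Borel measures on them are
  understood to be finite, as elements of the dual of the space of continuous functions.\<close>

definition borel_measures_on :: "'b::topological_space set \<Rightarrow> 'b measure set" where
  "borel_measures_on K = {\<mu>. sets \<mu> = sets (restrict_space borel K) \<and> finite_measure \<mu>}"

definition lp_feasible ::
  "(nat \<Rightarrow> real) \<Rightarrow> (real^'m \<Rightarrow> 'a::real_inner) \<Rightarrow> (nat \<Rightarrow> 'a) \<Rightarrow> (real^'m) set \<Rightarrow> 'a set \<Rightarrow> 'a set \<Rightarrow>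
   nat \<Rightarrow> real \<Rightarrow> 'a \<Rightarrow>
   (((real \<times> (nat \<Rightarrow> real)) \<times> (real^'m)) measure \<times> (nat \<Rightarrow> real) measure) set" where
  "lp_feasible lam B \<Psi> U Zs ZT N T z0 =
     {(\<mu>, \<mu>T). \<mu> \<in> borel_measures_on (S_N \<Psi> Zs U N T) \<and>
        \<mu>T \<in> borel_measures_on (mode_box \<Psi> ZT N) \<and>
        (\<forall>g\<in>C1_functions N.
           (LINT z|\<mu>T. g (T, z)) - g (0, mode_point \<Psi> N z0) = (LINT p|\<mu>. liouville lam B \<Psi> N g p))}"

definition lp_cost ::
  "(real \<Rightarrow> real^'m \<Rightarrow> real) \<Rightarrow> ((real \<times> (nat \<Rightarrow> real)) \<times> (real^'m)) measure \<Rightarrow> real" where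
  "lp_cost h \<mu> = (LINT p|\<mu>. (case p of ((t, z), u) \<Rightarrow> h t u))"

definition lp_value ::
  "(real \<Rightarrow> real^'m \<Rightarrow> real) \<Rightarrow> (nat \<Rightarrow> real) \<Rightarrow> (real^'m \<Rightarrow> 'a::real_inner) \<Rightarrow> (nat \<Rightarrow> 'a) \<Rightarrow>
   (real^'m) set \<Rightarrow> 'a set \<Rightarrow> 'a set \<Rightarrow> nat \<Rightarrow> real \<Rightarrow> 'a \<Rightarrow> ereal" where
  "lp_value h lam B \<Psi> U Zs ZT N T z0 =
     (INF (\<mu>, \<mu>T)\<in>lp_feasible lam B \<Psi> U Zs ZT N T z0. ereal (lp_cost h \<mu>))"

definition dual_feasible ::
  "(real \<Rightarrow> real^'m \<Rightarrow> real) \<Rightarrow> (nat \<Rightarrow> real) \<Rightarrow> (real^'m \<Rightarrow> 'a::real_inner) \<Rightarrow> (nat \<Rightarrow> 'a) \<Rightarrow>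
   (real^'m) set \<Rightarrow> 'a set \<Rightarrow> 'a set \<Rightarrow> nat \<Rightarrow> real \<Rightarrow> (real \<times> (nat \<Rightarrow> real) \<Rightarrow> real) set" where
  "dual_feasible h lam B \<Psi> U Zs ZT N T =
     {g \<in> C1_functions N.
        (\<forall>((t, z), u)\<in>S_N \<Psi> Zs U N T. liouville lam B \<Psi> N g ((t, z), u) + h t u \<ge> 0) \<and>
        (\<forall>z\<in>mode_box \<Psi> ZT N. g (T, z) \<le> 0)}"

definition dual_value ::
  "(real \<Rightarrow> real^'m \<Rightarrow> real) \<Rightarrow> (nat \<Rightarrow> real) \<Rightarrow> (real^'m \<Rightarrow> 'a::real_inner) \<Rightarrow> (nat \<Rightarrow> 'a) \<Rightarrow>
   (real^'m) set \<Rightarrow> 'a set \<Rightarrow> 'a set \<Rightarrow> nat \<Rightarrow> real \<Rightarrow> 'a \<Rightarrow> ereal" where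
  "dual_value h lam B \<Psi> U Zs ZT N T z0 =
     (SUP g\<in>dual_feasible h lam B \<Psi> U Zs ZT N T. ereal (g (0, mode_point \<Psi> N z0)))"

end

theory Submission
  imports Defs
begin

text \<open>
  Duality and attainment come from one compactness statement: if every function of a convex cone of
  continuous functions on a compact set takes a value \<open>\<le> 0\<close>, then some probability measure
  integrates all of them to a value \<open>\<le> 0\<close> (Hahn--Banach for a suitable sublinear functional,
  followed by the Riesz representation). Applied to the cone spanned by the cost, shifted by the dual
  value, and by the constraints, it yields a feasible pair of measures whose cost is at most the dual
  value, while weak duality gives the converse inequality.

  The inequality with the mode problem holds because occupation measures of trajectories are feasible,
  and the inequality with the full problem because \<open>\<Psi>\<^sub>k\<close> turns mild solutions into trajectories
  of the \<open>k\<close>-th mode.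

  For (iii) no superposition principle is needed, since the dynamics is affine in the state and the
  input and the state constraints are intervals. Averaging an optimal measure over each instant of time
  gives a state satisfying the mode equations with the averaged input. By convexity, the pair of averaged
  input and averaged cost dominates a pair attained by an actual value of the control, which is then
  selected measurably in time.
\<close>

text \<open>The constraints of the primal program are equalities against a linear space of test
  functions, so the cone contains with every g also -g, and nonpositive integrals over it are
  integrals equal to zero. This is why a one-sided statement suffices and why attainment appears
  together with the absence of a gap, without a separate weak-star compactness argument. Testing
  with 1 and t forces the masses 1 and T of the two measures, hence both can be coded by one
  probability measure on a compact product. The obstacle in (iii) is that an average of values in U
  need not lie in U, and that the modes see an input only through B. All comparisons are therefore
  made up to equality of B u, with the cost as an additional coordinate. The averaged state is at
  first only a measurable function of time; it is identified almost everywhere with the solution of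
  the state equation by testing with \<phi>(t) z_k, and the end point of that solution with the mean
  of the terminal measure.\<close>

lemma compact_continuous_bounded:
  fixes f :: "'b::topological_space \<Rightarrow> real"
  assumes "continuous_on K f" "compact K"
  shows "\<exists>b. \<forall>x\<in>K. \<bar>f x\<bar> \<le> b"
  using compact_imp_bounded[OF compact_continuous_image[OF assms]] by (auto simp: bounded_iff)

section \<open>Linear functionals below a sublinear one\<close>

definition function_space :: "('p \<Rightarrow> real) set \<Rightarrow> bool" where
  "function_space V \<longleftrightarrow>
     V \<noteq> {} \<and> (\<forall>f\<in>V. \<forall>g\<in>V. (\<lambda>x. f x + g x) \<in> V) \<and> (\<forall>c. \<forall>f\<in>V. (\<lambda>x. c * f x) \<in> V)"

definition sublinear_on :: "('p \<Rightarrow> real) set \<Rightarrow> (('p \<Rightarrow> real) \<Rightarrow> real) \<Rightarrow> bool" where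
  "sublinear_on V q \<longleftrightarrow>
     (\<forall>f\<in>V. \<forall>g\<in>V. q (\<lambda>x. f x + g x) \<le> q f + q g) \<and>
     (\<forall>c\<ge>0. \<forall>f\<in>V. q (\<lambda>x. c * f x) = c * q f)"

definition linear_functional_on :: "('p \<Rightarrow> real) set \<Rightarrow> (('p \<Rightarrow> real) \<Rightarrow> real) \<Rightarrow> bool" where
  "linear_functional_on V q \<longleftrightarrow>
     (\<forall>f\<in>V. \<forall>g\<in>V. q (\<lambda>x. f x + g x) = q f + q g) \<and>
     (\<forall>c. \<forall>f\<in>V. q (\<lambda>x. c * f x) = c * q f)"

lemma function_spaceD:
  assumes "function_space V"
  shows "f \<in> V \<Longrightarrow> g \<in> V \<Longrightarrow> (\<lambda>x. f x + g x) \<in> V" "f \<in> V \<Longrightarrow> (\<lambda>x. c * f x) \<in> V"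
    "f \<in> V \<Longrightarrow> (\<lambda>x. - f x) \<in> V" "(\<lambda>x. 0) \<in> V"
    "f \<in> V \<Longrightarrow> g \<in> V \<Longrightarrow> (\<lambda>x. f x - g x) \<in> V"
proof -
  have s: "(\<lambda>x. c * f x) \<in> V" if "f \<in> V" for f c
    using assms that by (auto simp: function_space_def)
  have p: "(\<lambda>x. f x + g x) \<in> V" if "f \<in> V" "g \<in> V" for f g
    using assms that by (auto simp: function_space_def)
  have m: "(\<lambda>x. - f x) \<in> V" if "f \<in> V" for f
    using s[OF that, of "-1"] by simp
  show "f \<in> V \<Longrightarrow> g \<in> V \<Longrightarrow> (\<lambda>x. f x + g x) \<in> V" by (rule p)
  show "f \<in> V \<Longrightarrow> (\<lambda>x. c * f x) \<in> V" by (rule s)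
  show "f \<in> V \<Longrightarrow> (\<lambda>x. - f x) \<in> V" by (rule m)
  show "(\<lambda>x. 0) \<in> V"
    using assms s[of _ 0] by (auto simp: function_space_def)
  show "f \<in> V \<Longrightarrow> g \<in> V \<Longrightarrow> (\<lambda>x. f x - g x) \<in> V"
    using p[OF _ m, of f g] by simp
qed

lemma sublinear_onD:
  assumes "sublinear_on V q"
  shows "f \<in> V \<Longrightarrow> g \<in> V \<Longrightarrow> q (\<lambda>x. f x + g x) \<le> q f + q g"
    "0 \<le> c \<Longrightarrow> f \<in> V \<Longrightarrow> q (\<lambda>x. c * f x) = c * q f"
  using assms by (auto simp: sublinear_on_def)

lemma sublinear_on_lower_bound:
  assumes V: "function_space V" and q: "sublinear_on V q" and f: "f \<in> V"
  shows "- q (\<lambda>x. - f x) \<le> q f"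
proof -
  have "q (\<lambda>x. 0) = 0" using sublinear_onD(2)[OF q _ f, of 0] by simp
  moreover have "q (\<lambda>x. f x + - f x) \<le> q f + q (\<lambda>x. - f x)"
    by (rule sublinear_onD(1)[OF q f function_spaceD(3)[OF V f]])
  ultimately show ?thesis by simp
qed

text \<open>Serves three infima: the lower bound of a chain, the functional that shows a minimal one
  to be linear, and the functional that encodes the cone. Indices have to match sums and positive
  multiples only up to inequality. The two conditions at 0 pin the value there, which the scaling
  condition for c > 0 leaves open.\<close>

lemma sublinear_on_INF:
  fixes Q :: "'i \<Rightarrow> ('p \<Rightarrow> real) \<Rightarrow> real"
  assumes V: "function_space V" and I: "I \<noteq> {}"
    and bdd: "\<And>f. f \<in> V \<Longrightarrow> bdd_below ((\<lambda>i. Q i f) ` I)"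
    and add: "\<And>f g i j. f \<in> V \<Longrightarrow> g \<in> V \<Longrightarrow> i \<in> I \<Longrightarrow> j \<in> I \<Longrightarrow>
      \<exists>k\<in>I. Q k (\<lambda>x. f x + g x) \<le> Q i f + Q j g"
    and scale: "\<And>c f i. c > 0 \<Longrightarrow> f \<in> V \<Longrightarrow> i \<in> I \<Longrightarrow> \<exists>k\<in>I. Q k (\<lambda>x. c * f x) \<le> c * Q i f"
    and zero: "\<And>i. i \<in> I \<Longrightarrow> 0 \<le> Q i (\<lambda>x. 0)" "\<exists>i\<in>I. Q i (\<lambda>x. 0) \<le> 0"
  shows "sublinear_on V (\<lambda>f. INF i\<in>I. Q i f)"
proof -
  define u where "u = (\<lambda>f. INF i\<in>I. Q i f)"
  note VD = function_spaceD[OF V]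
  have ule: "u f \<le> c" if "f \<in> V" "\<exists>k\<in>I. Q k f \<le> c" for f c
    using that cINF_lower2[OF bdd[OF that(1)]] unfolding u_def by blast
  have uge: "c \<le> u f" if "\<And>i. i \<in> I \<Longrightarrow> c \<le> Q i f" for f c
    unfolding u_def using that I by (intro cINF_greatest) auto
  have hom: "u (\<lambda>x. c * f x) \<le> c * u f" if c: "c > 0" and f: "f \<in> V" for c f
  proof -
    have "u (\<lambda>x. c * f x) / c \<le> u f"
    proof (rule uge)
      fix i assume "i \<in> I"
      from ule[OF VD(2)[OF f] scale[OF c f this]]
      show "u (\<lambda>x. c * f x) / c \<le> Q i f" using c by (simp add: field_simps)
    qed
    then show ?thesis using c by (simp add: field_simps)
  qed
  have "sublinear_on V u"
    unfolding sublinear_on_def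
  proof (intro conjI ballI allI impI)
    fix f g assume fg: "f \<in> V" "g \<in> V"
    have "u (\<lambda>x. f x + g x) - Q j g \<le> u f" if j: "j \<in> I" for j
    proof (rule uge)
      fix i assume "i \<in> I"
      from ule[OF VD(1)[OF fg] add[OF fg this j]]
      show "u (\<lambda>x. f x + g x) - Q j g \<le> Q i f" by simp
    qed
    then have "u (\<lambda>x. f x + g x) - u f \<le> u g"
      by (intro uge) (simp add: algebra_simps)
    then show "u (\<lambda>x. f x + g x) \<le> u f + u g" by simp
  next
    fix c :: real and f assume c: "c \<ge> 0" and f: "f \<in> V"
    show "u (\<lambda>x. c * f x) = c * u f"
    proof (cases "c = 0")
      case True
      have "u (\<lambda>x. 0) = 0" by (rule antisym[OF ule[OF VD(4) zero(2)] uge[OF zero(1)]])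
      then show ?thesis using True by simp
    next
      case False
      with c have c: "c > 0" by simp
      \<comment> \<open>The reverse inequality is \<open>hom\<close> for the scalar 1 / c, applied
        to c f.\<close>
      have "u (\<lambda>x. (1 / c) * (c * f x)) \<le> (1 / c) * u (\<lambda>x. c * f x)"
        using c by (intro hom VD(2) f) auto
      then have "c * u f \<le> u (\<lambda>x. c * f x)" using c by (simp add: field_simps)
      then show ?thesis using hom[OF c f] by linarith
    qed
  qed
  then show ?thesis by (simp add: u_def)
qed

lemma minimal_sublinear_exists:
  assumes V: "function_space V" and q0: "sublinear_on V q0"
  shows "\<exists>m. sublinear_on V m \<and> (\<forall>f\<in>V. m f \<le> q0 f) \<and>
           (\<forall>q. sublinear_on V q \<and> (\<forall>f\<in>V. q f \<le> m f) \<longrightarrow> (\<forall>f\<in>V. q f = m f))"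
proof -
  \<comment> \<open>Extensionality makes agreement on V the same as equality, without which the
    order would not be antisymmetric. \<open>P\<close> is the reversed pointwise order, so that the
    maximal element found by Zorn's lemma is a minimal functional.\<close>
  define A where "A = {q \<in> extensional V. sublinear_on V q \<and> (\<forall>f\<in>V. q f \<le> q0 f)}"
  define P where "P = (\<lambda>q r :: ('a \<Rightarrow> real) \<Rightarrow> real. \<forall>f\<in>V. r f \<le> q f)"
  have restr: "sublinear_on V (restrict q V)" if "sublinear_on V q" for q
    using that function_spaceD[OF V] by (auto simp: sublinear_on_def)
  have "partial_order_on A (relation_of P A)"
  proof (rule partial_order_on_relation_ofI)
    show "P a a" for a by (simp add: P_def)
    show "P a b \<Longrightarrow> P b c \<Longrightarrow> P a c" for a b c by (force simp: P_def)
    fix a b assume "a \<in> A" "b \<in> A" "P a b" "P b a"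
    then have "a f = b f" if "f \<in> V" for f
      using that by (force simp: P_def intro: antisym)
    then show "a = b" using \<open>a \<in> A\<close> \<open>b \<in> A\<close>
      by (auto simp: A_def intro: extensionalityI[of _ V])
  qed
  moreover have "\<exists>u\<in>A. \<forall>a\<in>C. P a u" if C: "C \<in> Chains (relation_of P A)" for C
  proof (cases "C = {}")
    case True
    then show ?thesis
      using restr[OF q0] by (intro bexI[of _ "restrict q0 V"]) (auto simp: A_def)
  next
    case False
    have CA: "C \<subseteq> A" and tot: "\<And>q r. q \<in> C \<Longrightarrow> r \<in> C \<Longrightarrow> P q r \<or> P r q"
      using C by (auto simp: Chains_def relation_of_def)
    have CD: "sublinear_on V q" "f \<in> V \<Longrightarrow> q f \<le> q0 f" if "q \<in> C" for q f
      using that CA by (auto simp: A_def)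
    define u where "u = restrict (\<lambda>f. INF q\<in>C. q f) V"
    \<comment> \<open>A chain cannot descend to minus infinity: every member is bounded below at f
      through its value at -f, which is at most that of q0.\<close>
    have bdd: "bdd_below ((\<lambda>q. q f) ` C)" if f: "f \<in> V" for f
    proof (rule bdd_belowI2)
      fix q assume "q \<in> C"
      then show "- q0 (\<lambda>x. - f x) \<le> q f"
        using sublinear_on_lower_bound[OF V CD(1) f] CD(2)[OF _ function_spaceD(3)[OF V f]] by force
    qed
    have ule: "u f \<le> q f" if "f \<in> V" "q \<in> C" for f q
      using that bdd by (auto simp: u_def intro!: cINF_lower)
    have "sublinear_on V u"
      unfolding u_def
    proof (intro restr sublinear_on_INF V False bdd)
      fix f g q r assume fg: "f \<in> V" "g \<in> V" and qr: "q \<in> C" "r \<in> C"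
      \<comment> \<open>Of two members of a chain the smaller one can replace both.\<close>
      obtain p where p: "p \<in> C" "p f \<le> q f" "p g \<le> r g"
        using tot[OF qr] qr fg unfolding P_def by (metis order_refl)
      have "p (\<lambda>x. f x + g x) \<le> p f + p g" by (rule sublinear_onD(1)[OF CD(1)[OF p(1)] fg])
      then show "\<exists>p\<in>C. p (\<lambda>x. f x + g x) \<le> q f + r g" using p by (intro bexI[OF _ p(1)]) linarith
    next
      fix c :: real and f q assume "0 < c" "f \<in> V" "q \<in> C"
      then show "\<exists>p\<in>C. p (\<lambda>x. c * f x) \<le> c * q f"
        using sublinear_onD(2)[OF CD(1), of q c f] by (intro bexI[of _ q]) auto
    next
      have zero: "q (\<lambda>x. 0) = 0" if "q \<in> C" for q
        using sublinear_onD(2)[OF CD(1)[OF that] _ function_spaceD(4)[OF V], of 0] by simp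
      show "0 \<le> q (\<lambda>x. 0)" if "q \<in> C" for q using zero[OF that] by simp
      show "\<exists>q\<in>C. q (\<lambda>x. 0) \<le> 0" using False zero by force
    qed
    moreover have "u f \<le> q0 f" if f: "f \<in> V" for f
    proof -
      from False obtain q where "q \<in> C" by blast
      moreover from this have "q f \<le> q0 f" using CA f unfolding A_def by blast
      ultimately show ?thesis using ule[OF f] by fastforce
    qed
    ultimately have "u \<in> A" by (simp add: A_def u_def)
    moreover have "\<forall>a\<in>C. P a u" using ule by (simp add: P_def)
    ultimately show ?thesis by blast
  qed
  ultimately have "\<exists>m\<in>A. \<forall>a\<in>A. P m a \<longrightarrow> a = m"
    by (rule predicate_Zorn)
  then obtain m where m: "m \<in> A" "\<forall>a\<in>A. P m a \<longrightarrow> a = m"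
    by (elim bexE)
  have min: "\<forall>q. sublinear_on V q \<and> (\<forall>f\<in>V. q f \<le> m f) \<longrightarrow> (\<forall>f\<in>V. q f = m f)"
  proof (intro allI impI)
    fix q assume q: "sublinear_on V q \<and> (\<forall>f\<in>V. q f \<le> m f)"
    have "q f \<le> q0 f" if "f \<in> V" for f
      using q m(1) that order_trans unfolding A_def by blast
    then have "restrict q V \<in> A" "P m (restrict q V)"
      using restr q by (simp_all add: A_def P_def)
    then have "m = restrict q V" using m(2) by metis
    then show "\<forall>f\<in>V. q f = m f" by simp
  qed
  have "sublinear_on V m" "\<forall>f\<in>V. m f \<le> q0 f"
    using m(1) by (simp_all add: A_def)
  then show ?thesis using min by (intro exI[of _ m] conjI)
qed

text \<open>A minimal sublinear functional \<open>m\<close> is linear: for fixed \<open>g\<close> the functional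
  \<open>f \<mapsto> inf\<^bsub>t \<ge> 0\<^esub> (m (f + t g) - t m g)\<close> is sublinear and below \<open>m\<close>, hence equal to \<open>m\<close>.\<close>

theorem sublinear_dominates_linear:
  assumes V: "function_space V" and q0: "sublinear_on V q0"
  shows "\<exists>L. linear_functional_on V L \<and> (\<forall>f\<in>V. L f \<le> q0 f)"
proof -
  obtain m where m': "sublinear_on V m \<and> (\<forall>f\<in>V. m f \<le> q0 f) \<and>
      (\<forall>q. sublinear_on V q \<and> (\<forall>f\<in>V. q f \<le> m f) \<longrightarrow> (\<forall>f\<in>V. q f = m f))"
    using minimal_sublinear_exists[OF V q0] by (elim exE)
  have m: "sublinear_on V m" "\<And>f. f \<in> V \<Longrightarrow> m f \<le> q0 f"
    using m' by simp_all
  have min: "\<forall>f\<in>V. q f = m f" if "sublinear_on V q" "\<forall>f\<in>V. q f \<le> m f" for q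
    using m'[THEN conjunct2, THEN conjunct2, rule_format, OF conjI[OF that]] by blast
  note VD = function_spaceD[OF V]
  have sub: "m (\<lambda>x. f x + g x) \<le> m f + m g" if "f \<in> V" "g \<in> V" for f g
    using m(1) that by (auto simp: sublinear_on_def)
  have hom: "m (\<lambda>x. c * f x) = c * m f" if "f \<in> V" "c \<ge> 0" for f c
    using m(1) that by (auto simp: sublinear_on_def)
  have m0: "m (\<lambda>x. 0) = 0" using hom[OF VD(4), of 0] by simp
  have add: "m (\<lambda>x. f x + g x) = m f + m g" if f: "f \<in> V" and g: "g \<in> V" for f g
  proof -
    define r where "r = (\<lambda>f. INF t\<in>{0..}. m (\<lambda>x. f x + t * g x) - t * m g)"
    have bdd: "bdd_below ((\<lambda>t. m (\<lambda>x. f x + t * g x) - t * m g) ` {0..})" if f: "f \<in> V" for f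
    proof (rule bdd_belowI2)
      fix t :: real assume t: "t \<in> {0..}"
      have "m (\<lambda>x. (f x + t * g x) + (-1) * f x) \<le> m (\<lambda>x. f x + t * g x) + m (\<lambda>x. (-1) * f x)"
        by (intro sub VD f g)
      then show "- m (\<lambda>x. - f x) \<le> m (\<lambda>x. f x + t * g x) - t * m g"
        using hom[OF g, of t] t by simp
    qed
    have rle: "r f \<le> m (\<lambda>x. f x + t * g x) - t * m g" if "f \<in> V" "t \<ge> 0" for f t
      unfolding r_def using that bdd by (intro cINF_lower) auto
    have "sublinear_on V r"
      unfolding r_def
    proof (rule sublinear_on_INF[OF V _ bdd])
      fix f k and t s :: real assume fk: "f \<in> V" "k \<in> V" and ts: "t \<in> {0..}" "s \<in> {0..}"
      have "m (\<lambda>x. (f x + t * g x) + (k x + s * g x)) \<le> m (\<lambda>x. f x + t * g x) + m (\<lambda>x. k x + s * g x)"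
        by (intro sub VD fk g)
      then show "\<exists>t'\<in>{0..}. m (\<lambda>x. f x + k x + t' * g x) - t' * m g \<le>
          (m (\<lambda>x. f x + t * g x) - t * m g) + (m (\<lambda>x. k x + s * g x) - s * m g)"
        using ts by (intro bexI[of _ "t + s"]) (simp_all add: algebra_simps)
    next
      fix c t :: real and f assume c: "0 < c" and f: "f \<in> V" and t: "t \<in> {0..}"
      have "m (\<lambda>x. c * (f x + t * g x)) = c * m (\<lambda>x. f x + t * g x)"
        using c by (intro hom VD f g) simp
      then show "\<exists>t'\<in>{0..}. m (\<lambda>x. c * f x + t' * g x) - t' * m g \<le> c * (m (\<lambda>x. f x + t * g x) - t * m g)"
        using c t by (intro bexI[of _ "c * t"]) (simp_all add: algebra_simps)
    qed (use hom[OF g] in \<open>auto intro!: bexI[of _ 0]\<close>)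
    moreover have "r f \<le> m f" if "f \<in> V" for f using rle[OF that, of 0] by simp
    ultimately have "\<forall>f\<in>V. r f = m f" by (intro min) auto
    then have "r f = m f" using f by blast
    \<comment> \<open>The parameter t = 1 in the infimum is superadditivity of m.\<close>
    then have "m f \<le> m (\<lambda>x. f x + g x) - m g" using rle[OF f, of 1] by simp
    then show ?thesis using sub[OF f g] by linarith
  qed
  have "m (\<lambda>x. c * f x) = c * m f" if f: "f \<in> V" for c f
  proof (cases "c \<ge> 0")
    case True then show ?thesis using hom f by blast
  next
    case False
    then have "m (\<lambda>x. (-c) * f x) = (-c) * m f" using hom[OF f, of "-c"] by simp
    moreover have "m (\<lambda>x. c * f x + (-c) * f x) = m (\<lambda>x. c * f x) + m (\<lambda>x. (-c) * f x)"
      by (intro add VD f)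
    ultimately show ?thesis using m0 by simp
  qed
  then have "linear_functional_on V m" using add by (auto simp: linear_functional_on_def)
  then show ?thesis using m(2) by (intro exI[of _ m] conjI ballI)
qed

section \<open>Positive normalised functionals and measures\<close>

text \<open>The single inequality \<open>L_le\<close> contains both positivity and normalisation:
  with c = 0 it makes L f nonpositive for nonpositive f, and used for the constants c and -c it
  gives L c = c.\<close>

locale mean_functional =
  fixes X :: "'p::metric_space set" and L :: "('p \<Rightarrow> real) \<Rightarrow> real"
  assumes compact_X: "compact X"
    and linear_L: "linear_functional_on {f. continuous_on X f} L"
    and L_le: "\<And>f c. continuous_on X f \<Longrightarrow> (\<And>x. x \<in> X \<Longrightarrow> f x \<le> c) \<Longrightarrow> L f \<le> c"
begin

lemma L_add: "continuous_on X f \<Longrightarrow> continuous_on X g \<Longrightarrow> L (\<lambda>x. f x + g x) = L f + L g"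
  and L_cmult: "continuous_on X f \<Longrightarrow> L (\<lambda>x. c * f x) = c * L f"
  using linear_L by (auto simp: linear_functional_on_def)

lemma L_diff:
  assumes "continuous_on X f" "continuous_on X g"
  shows "L (\<lambda>x. f x - g x) = L f - L g"
  using L_add[OF assms(1), of "\<lambda>x. (-1) * g x"] L_cmult[OF assms(2), of "-1"] assms
  by (auto intro!: continuous_intros)

lemma L_mono:
  assumes "continuous_on X f" "continuous_on X g" "\<And>x. x \<in> X \<Longrightarrow> f x \<le> g x"
  shows "L f \<le> L g"
  using L_le[of "\<lambda>x. f x - g x" 0] assms by (auto simp: L_diff intro!: continuous_intros)

lemma L_const: "L (\<lambda>x. c) = c"
proof -
  have "L (\<lambda>x. c) \<le> c" for c by (rule L_le) auto
  from this[of c] this[of "-c"] L_cmult[of "\<lambda>x. c" "-1"] show ?thesis by auto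
qed

lemma L_sum: "finite I \<Longrightarrow> (\<And>i. i \<in> I \<Longrightarrow> continuous_on X (f i)) \<Longrightarrow>
    L (\<lambda>x. \<Sum>i\<in>I. f i x) = (\<Sum>i\<in>I. L (f i))"
proof (induction I rule: finite_induct)
  case (insert i I)
  then show ?case by (auto simp: L_add continuous_on_sum)
qed (simp add: L_const)

text \<open>The competitors for the measure of an open set G in the Riesz construction. Vanishing on
  X - G takes the place of compact support in G; the proofs below make up for the difference with
  small thresholds e.\<close>

definition below :: "'p set \<Rightarrow> ('p \<Rightarrow> real) set" where
  "below G = {f. continuous_on X f \<and> (\<forall>x\<in>X. 0 \<le> f x \<and> f x \<le> 1) \<and> (\<forall>x\<in>X - G. f x = 0)}"

definition \<rho> :: "'p set \<Rightarrow> real" where "\<rho> G = (SUP f\<in>below G. L f)"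

definition outer :: "'p set \<Rightarrow> real" where "outer E = (INF G\<in>{G. open G \<and> E \<subseteq> G}. \<rho> G)"

lemma below_L_bounds: "f \<in> below G \<Longrightarrow> 0 \<le> L f \<and> L f \<le> 1"
  using L_mono[of "\<lambda>x. 0" f] L_le[of f 1] by (auto simp: below_def L_const)

lemma zero_below: "(\<lambda>x. 0) \<in> below G" by (auto simp: below_def)

lemma \<rho>_upper: "f \<in> below G \<Longrightarrow> L f \<le> \<rho> G"
  unfolding \<rho>_def by (rule cSUP_upper) (use below_L_bounds in \<open>auto intro!: bdd_aboveI2\<close>)

lemma \<rho>_least: "(\<And>f. f \<in> below G \<Longrightarrow> L f \<le> c) \<Longrightarrow> \<rho> G \<le> c"
  unfolding \<rho>_def using zero_below by (intro cSUP_least) auto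

lemma \<rho>_nonneg: "0 \<le> \<rho> G"
  using \<rho>_upper[OF zero_below] by (simp add: L_const)

lemma \<rho>_le_1: "\<rho> G \<le> 1"
  using below_L_bounds by (intro \<rho>_least) auto

lemma \<rho>_mono: "G \<subseteq> H \<Longrightarrow> \<rho> G \<le> \<rho> H"
  by (intro \<rho>_least \<rho>_upper) (auto simp: below_def)

lemma \<rho>_superset: "X \<subseteq> G \<Longrightarrow> \<rho> G = 1"
  using \<rho>_upper[of "\<lambda>x. 1" G] \<rho>_le_1[of G] by (auto simp: below_def L_const)

lemma \<rho>_disjoint: "X \<inter> G = {} \<Longrightarrow> \<rho> G = 0"
proof (rule antisym[OF \<rho>_least \<rho>_nonneg])
  fix f assume "X \<inter> G = {}" "f \<in> below G"
  then show "L f \<le> 0" by (intro L_le) (fastforce simp: below_def)+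
qed

text \<open>Continuous functions that increase with n to the indicator of an open G. The whole space
  is treated apart because \<open>infdist\<close> to the empty set is 0.\<close>

definition bump :: "'p set \<Rightarrow> nat \<Rightarrow> 'p \<Rightarrow> real" where
  "bump G n x = (if G = UNIV then 1 else min 1 (real n * infdist x (- G)))"

lemma continuous_on_bump: "continuous_on S (bump G n)"
  unfolding bump_def by (cases "G = UNIV") (auto intro!: continuous_intros)

lemma bump_bounds: "0 \<le> bump G n x" "bump G n x \<le> 1"
  by (auto simp: bump_def infdist_nonneg)

lemma bump_mono: "m \<le> n \<Longrightarrow> bump G m x \<le> bump G n x"
  unfolding bump_def by (auto simp: infdist_nonneg intro!: min.mono mult_right_mono simp del: min.bounded_iff)

lemma bump_outside: "x \<notin> G \<Longrightarrow> bump G n x = 0"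
  by (auto simp: bump_def)

lemma bump_below: "bump G n \<in> below G"
  by (auto simp: below_def continuous_on_bump bump_bounds bump_outside)

lemma bump_eventually_1:
  assumes "open G" "x \<in> G"
  shows "\<exists>n. bump G n x = 1"
proof (cases "G = UNIV")
  case False
  then have "infdist x (- G) > 0"
    using assms infdist_pos_not_in_closed[of "- G" x] by auto
  then obtain n where "1 < real n * infdist x (- G)"
    using reals_Archimedean3 by blast
  then show ?thesis by (intro exI[of _ n]) (auto simp: bump_def)
qed (simp add: bump_def)

text \<open>The continuous functions \<open>f - (\<Sum>i<n. bump (G i) n)\<close> decrease in \<open>n\<close> and are eventually
  nonpositive at each point, so by compactness they become uniformly small.\<close>

lemma \<rho>_UN_le:
  assumes G: "\<And>i. open (G i)" and c: "\<And>n. (\<Sum>i<n. \<rho> (G i)) \<le> c"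
  shows "\<rho> (\<Union>i::nat. G i) \<le> c"
proof (rule \<rho>_least)
  fix f assume f: "f \<in> below (\<Union>i. G i)"
  then have fc: "continuous_on X f" by (simp add: below_def)
  define s where "s = (\<lambda>n x. \<Sum>i<n. bump (G i) n x)"
  have s_cont: "continuous_on X (s n)" for n
    unfolding s_def by (intro continuous_intros continuous_on_bump)
  have s_mono: "s m x \<le> s n x" if "m \<le> n" for m n x
  proof -
    have "s m x \<le> (\<Sum>i<m. bump (G i) n x)"
      unfolding s_def by (intro sum_mono bump_mono that)
    also have "\<dots> \<le> s n x"
      unfolding s_def using that bump_bounds by (intro sum_mono2) auto
    finally show ?thesis .
  qed
  show "L f \<le> c"
  proof (rule field_le_epsilon)
    fix e :: real assume e: "e > 0"
    have "\<forall>n. \<exists>A. open A \<and> A \<inter> X = (\<lambda>x. f x - s n x) -` {..<e} \<inter> X"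
      using fc s_cont by (auto simp: continuous_on_open_invariant[symmetric] intro!: continuous_intros
          continuous_on_open_invariant[THEN iffD1, rule_format])
    then obtain A where A: "\<And>n. open (A n)" "\<And>n. A n \<inter> X = (\<lambda>x. f x - s n x) -` {..<e} \<inter> X"
      by metis
    have "X \<subseteq> (\<Union>n\<in>UNIV. A n)"
    proof
      fix x assume x: "x \<in> X"
      have "\<exists>n. f x - s n x < e"
      proof (cases "x \<in> (\<Union>i. G i)")
        case False
        then show ?thesis using f x e by (auto simp: below_def s_def intro!: exI[of _ 0])
      next
        case True
        then obtain i where "x \<in> G i" by auto
        then obtain n where n: "bump (G i) n x = 1" using bump_eventually_1 G by blast
        \<comment> \<open>N has to exceed i, so that the bump of \<open>G i\<close> occurs in the
          sum, and to reach n, so that this bump equals 1 at x.\<close>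
        define N where "N = max (Suc i) n"
        have "1 \<le> bump (G i) N x" using bump_mono[of n N "G i" x] n by (simp add: N_def)
        also have "\<dots> \<le> s N x"
          unfolding s_def by (rule member_le_sum) (auto simp: N_def bump_bounds)
        finally have "f x - s N x \<le> 0" using f x by (fastforce simp: below_def)
        then show ?thesis using e by (intro exI[of _ N]) linarith
      qed
      then show "x \<in> (\<Union>n\<in>UNIV. A n)" using A(2) x by fastforce
    qed
    then obtain D where D: "finite D" "X \<subseteq> (\<Union>n\<in>D. A n)"
      using compactE_image[OF compact_X, of UNIV A] A(1) by metis
    define n where "n = Max (insert 0 D)"
    have "f x - s n x \<le> e" if x: "x \<in> X" for x
    proof -
      obtain m where m: "m \<in> D" "x \<in> A m" using D x by auto
      then have "f x - s m x < e" using A(2)[of m] x by blast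
      moreover have "s m x \<le> s n x" using m D by (intro s_mono) (auto simp: n_def)
      ultimately show ?thesis by linarith
    qed
    then have "L (\<lambda>x. f x - s n x) \<le> e"
      by (intro L_le) (auto intro!: continuous_intros fc s_cont)
    then have "L f \<le> L (s n) + e" using L_diff[OF fc s_cont, of n] by simp
    also have "L (s n) = (\<Sum>i<n. L (bump (G i) n))"
      unfolding s_def by (rule L_sum) (auto intro: continuous_on_bump)
    also have "\<dots> \<le> (\<Sum>i<n. \<rho> (G i))" by (intro sum_mono \<rho>_upper bump_below)
    also have "\<dots> \<le> c" by (rule c)
    finally show "L f \<le> c + e" by simp
  qed
qed

lemma outer_le: "open G \<Longrightarrow> E \<subseteq> G \<Longrightarrow> outer E \<le> \<rho> G"
  unfolding outer_def by (rule cINF_lower) (auto intro!: bdd_belowI2[of _ 0] \<rho>_nonneg)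

lemma outer_ge: "(\<And>G. open G \<Longrightarrow> E \<subseteq> G \<Longrightarrow> c \<le> \<rho> G) \<Longrightarrow> c \<le> outer E"
  unfolding outer_def by (rule cINF_greatest) auto

lemma outer_nonneg: "0 \<le> outer E" by (rule outer_ge) (rule \<rho>_nonneg)

lemma outer_open: "open G \<Longrightarrow> outer G = \<rho> G"
  by (intro antisym outer_le outer_ge \<rho>_mono) auto

lemma outer_mono: "E \<subseteq> F \<Longrightarrow> outer E \<le> outer F"
  by (intro outer_ge outer_le) auto

lemma outer_close: "e > 0 \<Longrightarrow> \<exists>G. open G \<and> E \<subseteq> G \<and> \<rho> G < outer E + e"
  using outer_ge[of E "outer E + e"] by force

text \<open>Each A i is covered by an open set up to an error e / 2^(i+1), and
  \<open>\<rho>_UN_le\<close> handles the open sets. A bound on the partial sums replaces the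
  infinite sum, so that the real-valued \<open>outer\<close> requires no summability.\<close>

lemma outer_UN_le:
  assumes c: "\<And>n. (\<Sum>i<n. outer (A i)) \<le> c"
  shows "outer (\<Union>i::nat. A i) \<le> c"
proof (rule field_le_epsilon)
  fix e :: real assume e: "e > 0"
  have "\<forall>i. \<exists>G. open G \<and> A i \<subseteq> G \<and> \<rho> G < outer (A i) + e * (1/2) ^ Suc i"
    using e by (intro allI outer_close) auto
  then obtain G where G: "\<And>i. open (G i)" "\<And>i. A i \<subseteq> G i"
    "\<And>i. \<rho> (G i) < outer (A i) + e * (1/2) ^ Suc i"
    by metis
  have "outer (\<Union>i. A i) \<le> \<rho> (\<Union>i. G i)" using G by (intro outer_le) auto
  also have "\<dots> \<le> c + e"
  proof (rule \<rho>_UN_le[OF G(1)])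
    fix n
    have geo: "(\<Sum>i<n. (1/2::real) ^ Suc i) = 1 - (1/2) ^ n" by (induction n) auto
    have "(\<Sum>i<n. \<rho> (G i)) \<le> (\<Sum>i<n. outer (A i) + e * (1/2) ^ Suc i)"
      using G(3) by (intro sum_mono less_imp_le)
    also have "\<dots> = (\<Sum>i<n. outer (A i)) + e * (\<Sum>i<n. (1/2) ^ Suc i)"
      by (simp only: sum.distrib sum_distrib_left)
    also have "\<dots> \<le> c + e * 1"
      unfolding geo using c[of n] e by (intro add_mono mult_left_mono) auto
    finally show "(\<Sum>i<n. \<rho> (G i)) \<le> c + e" by simp
  qed
  finally show "outer (\<Union>i. A i) \<le> c + e" .
qed

lemma outer_Un_le: "outer (E \<union> F) \<le> outer E + outer F"
proof -
  define A where "A = (\<lambda>i::nat. if i = 0 then E else if i = 1 then F else {})"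
  have "(\<Sum>i<n. outer (A i)) \<le> outer E + outer F" for n
  proof -
    \<comment> \<open>With n + 2 terms the indices 0 and 1 are present for every n.\<close>
    have "(\<Sum>i<n. outer (A i)) \<le> (\<Sum>i<n+2. outer (A i))"
      by (intro sum_mono2) (auto simp: outer_nonneg)
    also have "\<dots> = (\<Sum>i\<in>{0,1}. outer (A i))"
      by (intro sum.mono_neutral_right) (auto simp: A_def outer_open \<rho>_disjoint)
    finally show ?thesis by (simp add: A_def)
  qed
  then have "outer (\<Union>i. A i) \<le> outer E + outer F" by (rule outer_UN_le)
  moreover have "(\<Union>i. A i) = E \<union> F" by (auto simp: A_def split: if_splits)
  ultimately show ?thesis by simp
qed

lemma outer_measure_space_outer: "outer_measure_space UNIV (\<lambda>E. ennreal (outer E))"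
  unfolding outer_measure_space_def
proof (intro conjI)
  show "positive UNIV (\<lambda>E. ennreal (outer E))"
    by (simp add: positive_def outer_open \<rho>_disjoint)
  show "increasing UNIV (\<lambda>E. ennreal (outer E))"
    by (auto simp: increasing_def intro!: ennreal_leI outer_mono)
  show "countably_subadditive UNIV (\<lambda>E. ennreal (outer E))"
    unfolding countably_subadditive_def
  proof (intro allI impI)
    fix A :: "nat \<Rightarrow> 'p set"
    show "ennreal (outer (\<Union>i. A i)) \<le> (\<Sum>i. ennreal (outer (A i)))"
    proof (cases "(\<Sum>i. ennreal (outer (A i)))")
      case (real c)
      have "outer (\<Union>i. A i) \<le> c"
      proof (rule outer_UN_le)
        fix n
        have "ennreal (\<Sum>i<n. outer (A i)) = (\<Sum>i<n. ennreal (outer (A i)))"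
          by (simp add: sum_ennreal outer_nonneg)
        also have "\<dots> \<le> (\<Sum>i. ennreal (outer (A i)))" by (rule sum_le_suminf) auto
        finally show "(\<Sum>i<n. outer (A i)) \<le> c" using real by simp
      qed
      then show ?thesis using real by (simp add: ennreal_leI)
    qed simp
  qed
qed

text \<open>This is Caratheodory's criterion for G, tested on open H. For a competitor f of H
  \<inter> G, the excess of f over e lives on the closed set F = {f \<ge> e}, which lies in G. A
  competitor of H - F vanishes on F, so both can be added without exceeding 1, and H - F still
  covers H - G.\<close>

lemma \<rho>_split:
  assumes G: "open G" and H: "open H"
  shows "\<rho> (H \<inter> G) + outer (H - G) \<le> \<rho> H"
proof -
  have "\<rho> (H \<inter> G) \<le> \<rho> H - outer (H - G)"
  proof (rule \<rho>_least)
    fix f assume f: "f \<in> below (H \<inter> G)"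
    then have fc: "continuous_on X f" by (simp add: below_def)
    show "L f \<le> \<rho> H - outer (H - G)"
    proof (rule field_le_epsilon)
      fix e :: real assume e: "e > 0"
      define F where "F = X \<inter> f -` {e..}"
      have "closed F" unfolding F_def
        using fc compact_X by (intro continuous_closed_preimage) (auto intro: compact_imp_closed)
      then have HF: "open (H - F)" using H by (rule open_Diff[rotated])
      have FG: "F \<subseteq> G" using f e by (force simp: F_def below_def)
      define k where "k = (\<lambda>x. max 0 (f x - e))"
      have kc: "continuous_on X k" unfolding k_def by (intro continuous_intros fc)
      have "\<rho> (H - F) \<le> \<rho> H - L k"
      proof (rule \<rho>_least)
        fix g assume g: "g \<in> below (H - F)"
        then have gc: "continuous_on X g" by (simp add: below_def)
        have "(\<lambda>x. k x + g x) \<in> below H"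
          unfolding below_def
        proof (safe)
          show "continuous_on X (\<lambda>x. k x + g x)" by (intro continuous_intros kc gc)
          fix x assume x: "x \<in> X"
          show "0 \<le> k x + g x" using g x by (auto simp: k_def below_def)
          show "k x + g x \<le> 1"
          proof (cases "x \<in> F")
            case True
            then show ?thesis using f g x e by (force simp: k_def below_def)
          next
            case False
            then show ?thesis using g x by (auto simp: k_def below_def F_def)
          qed
          assume "x \<notin> H"
          then show "k x + g x = 0" using f g x e by (auto simp: k_def below_def)
        qed
        then have "L (\<lambda>x. k x + g x) \<le> \<rho> H" by (rule \<rho>_upper)
        then show "L g \<le> \<rho> H - L k" using L_add[OF kc gc] by simp
      qed
      moreover have "outer (H - G) \<le> \<rho> (H - F)" using HF FG by (intro outer_le) auto
      moreover have "L f - e \<le> L k"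
      proof -
        have "L (\<lambda>x. f x - e) \<le> L k"
          by (rule L_mono) (auto intro!: continuous_intros fc kc simp: k_def)
        then show ?thesis using L_diff[OF fc, of "\<lambda>x. e"] by (simp add: L_const)
      qed
      ultimately show "L f \<le> \<rho> H - outer (H - G) + e" by linarith
    qed
  qed
  then show ?thesis by simp
qed

lemma open_in_lambda_system:
  assumes G: "open G"
  shows "G \<in> lambda_system UNIV UNIV (\<lambda>E. ennreal (outer E))"
proof -
  interpret sigma_algebra UNIV "UNIV :: 'p set set"
    using sigma_algebra_Pow[of UNIV] by simp
  have "outer (E \<inter> G) + outer (E - G) = outer E" for E
  proof (rule antisym)
    show "outer (E \<inter> G) + outer (E - G) \<le> outer E"
    proof (rule outer_ge)
      fix H assume H: "open H" "E \<subseteq> H"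
      have "outer (E \<inter> G) \<le> \<rho> (H \<inter> G)" "outer (E - G) \<le> outer (H - G)"
        using H G by (auto intro!: outer_le outer_mono)
      then show "outer (E \<inter> G) + outer (E - G) \<le> \<rho> H"
        using \<rho>_split[OF G H(1)] by linarith
    qed
    show "outer E \<le> outer (E \<inter> G) + outer (E - G)"
      using outer_Un_le[of "E \<inter> G" "E - G"] by (simp add: Int_Diff_Un)
  qed
  then show ?thesis
    unfolding lambda_system_eq
    by (auto simp: outer_nonneg simp flip: ennreal_plus)
qed

text \<open>Lives on the whole type, where the outer measure is defined on all sets; it gives the
  complement of X mass 0, and \<open>rep\<close> is its trace on X.\<close>

definition rep_measure :: "'p measure" where
  "rep_measure = measure_of UNIV (sets borel) (\<lambda>E. ennreal (outer E))"

lemma sets_rep_measure [simp, measurable_cong]: "sets rep_measure = sets borel"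
  using sets.sigma_sets_eq[of "borel :: 'p measure"] by (simp add: rep_measure_def)

lemma space_rep_measure [simp]: "space rep_measure = UNIV"
  by (simp add: rep_measure_def)

lemma emeasure_rep_measure: "A \<in> sets borel \<Longrightarrow> emeasure rep_measure A = ennreal (outer A)"
proof -
  interpret sigma_algebra UNIV "UNIV :: 'p set set"
    using sigma_algebra_Pow[of UNIV] by simp
  let ?L = "lambda_system UNIV UNIV (\<lambda>E. ennreal (outer E))"
  have ms: "measure_space UNIV ?L (\<lambda>E. ennreal (outer E))"
    by (rule caratheodory_lemma[OF outer_measure_space_outer])
  then have "sigma_algebra UNIV ?L" by (simp add: measure_space_def)
  then have "sigma_sets UNIV {S. open S} \<subseteq> ?L"
    using open_in_lambda_system by (intro sigma_algebra.sigma_sets_subset) auto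
  then have sub: "sets borel \<subseteq> ?L" by (simp add: borel_def)
  have "measure_space UNIV (sets (borel :: 'p measure)) (\<lambda>E. ennreal (outer E))"
    using measure_down[OF ms _ sub] sets.sigma_algebra_axioms[of "borel :: 'p measure"] by simp
  then show "A \<in> sets borel \<Longrightarrow> emeasure rep_measure A = ennreal (outer A)"
    unfolding rep_measure_def
    by (intro emeasure_measure_of_sigma) (auto simp: measure_space_def sets.sigma_algebra_axioms[of "borel :: 'p measure", simplified])
qed

lemma X_sets: "X \<in> sets borel" using compact_X by (simp add: compact_imp_closed)

lemma finite_rep_measure: "finite_measure rep_measure"
  by (intro finite_measureI) (simp add: emeasure_rep_measure)

lemma measure_rep_measure: "A \<in> sets borel \<Longrightarrow> measure rep_measure A = outer A"
  by (simp add: measure_def emeasure_rep_measure outer_nonneg)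

lemma measure_rep_measure_X: "measure rep_measure X = 1" "measure rep_measure (- X) = 0"
proof -
  show "measure rep_measure (- X) = 0"
    using compact_X by (simp add: measure_rep_measure outer_open \<rho>_disjoint compact_imp_closed open_Compl)
  then have "measure rep_measure UNIV = measure rep_measure X"
    using finite_measure.finite_measure_compl[OF finite_rep_measure, of X] X_sets
    by (simp add: Compl_eq_Diff_UNIV)
  then show "measure rep_measure X = 1"
    using X_sets by (simp add: measure_rep_measure[of UNIV] outer_open \<rho>_superset)
qed

definition rep :: "'p measure" where "rep = restrict_space rep_measure X"

lemma sets_rep [measurable_cong]: "sets rep = sets (restrict_space borel X)"
  unfolding rep_def by (rule sets_restrict_space_cong) simp

lemma space_rep: "space rep = X" by (simp add: rep_def space_restrict_space)

lemma finite_rep: "finite_measure rep"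
  unfolding rep_def using finite_rep_measure by (rule finite_measure_restrict_space) (simp add: X_sets)

lemma measure_rep: "measure rep X = 1"
  unfolding rep_def using X_sets by (simp add: measure_restrict_space measure_rep_measure_X)

lemma integrable_rep:
  fixes f :: "'p \<Rightarrow> real"
  assumes "continuous_on X f"
  shows "integrable rep f"
proof -
  obtain B where "\<forall>x\<in>X. \<bar>f x\<bar> \<le> B"
    using compact_continuous_bounded[OF assms compact_X] by blast
  moreover have "f \<in> borel_measurable rep"
    using borel_measurable_continuous_on_restrict[OF assms] measurable_cong_sets[OF sets_rep refl] by blast
  ultimately show ?thesis
    by (intro finite_measure.integrable_const_bound[OF finite_rep, of f B] AE_I2) (auto simp: space_rep)
qed

text \<open>A layer-cake argument: f is the sum of n slices of height 1/n. Each slice times n is a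
  competitor for the open set {f > i/n}, so L of the slice is at most 1/n times the measure of that
  set, and the sum of these multiples of indicators exceeds f by at most 1/n.\<close>

lemma L_le_integral_unit:
  assumes fc: "continuous_on X f" and f: "\<And>x. x \<in> X \<Longrightarrow> 0 \<le> f x \<and> f x \<le> 1"
  shows "L f \<le> (LINT x|rep. f x)"
proof (rule LIMSEQ_le_const)
  interpret finite_measure rep by (rule finite_rep)
  show "(\<lambda>n. (LINT x|rep. f x) + 1 / real (Suc n)) \<longlonglongrightarrow> (LINT x|rep. f x)"
    using tendsto_add[OF tendsto_const LIMSEQ_Suc[OF lim_1_over_n]] by simp
  have "L f \<le> (LINT x|rep. f x) + 1 / real (Suc k)" for k
  proof -
    define n where "n = Suc k"
    have n: "real n > 0" by (simp add: n_def)
    define a where "a = (\<lambda>i::nat. \<lambda>y::real. min (max (y - i / n) 0) (1 / n))"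
    have sum_a: "(\<Sum>i<m. a i y) = min y (m / n)" if "y \<ge> 0" for m y
    proof (induction m)
      case (Suc m)
      have n1: "0 < 1 / n" using n by auto
      have "min y (m / n) + a m y = min y (Suc m / n)"
      proof (cases "y \<le> m / n")
        case True
        then have "y \<le> Suc m / n" by (rule order_trans) (simp add: divide_right_mono)
        then show ?thesis using True n1 by (simp add: a_def)
      next
        case False
        then show ?thesis using n1 by (simp add: a_def add_divide_distrib min_def)
      qed
      with Suc show ?case by simp
    qed (use that in \<open>simp add: a_def\<close>)
    have count: "(\<Sum>i<m. (1 / n) * indicator {i / n<..} y) \<le> min (y + 1 / n) (m / n)" if "y \<ge> 0" for m :: nat and y
    proof (induction m)
      case (Suc m)
      then show ?case
        using n by (auto simp: indicator_def add_divide_distrib)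
    qed (use that in auto)
    have ac: "continuous_on X (\<lambda>x. a i (f x))" for i
      unfolding a_def by (intro continuous_intros fc)
    have slice: "L (\<lambda>x. a i (f x)) \<le> (LINT x|rep. (1 / n) * indicator {i / n<..} (f x))" for i
    proof -
      obtain A where A: "open A" "A \<inter> X = f -` {i / n<..} \<inter> X"
        using fc open_greaterThan unfolding continuous_on_open_invariant by blast
      have "(\<lambda>x. n * a i (f x)) \<in> below A"
        unfolding below_def
      proof safe
        show "continuous_on X (\<lambda>x. n * a i (f x))" by (intro continuous_intros ac)
        fix x assume x: "x \<in> X"
        have "0 \<le> a i (f x)" "a i (f x) \<le> 1 / n" by (auto simp: a_def)
        then show "0 \<le> n * a i (f x)" "n * a i (f x) \<le> 1"
          using n mult_left_mono[of "a i (f x)" "1 / n" n] by auto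
        assume "x \<notin> A"
        then have "f x \<le> i / n" using A(2) x by force
        then show "n * a i (f x) = 0" by (simp add: a_def)
      qed
      then have "L (\<lambda>x. n * a i (f x)) \<le> measure rep_measure A"
        using \<rho>_upper A(1) by (simp add: measure_rep_measure outer_open)
      \<comment> \<open>The open set A is only determined by its trace on X; what it has outside X
        is null.\<close>
      also have "measure rep_measure A = measure rep_measure (A \<inter> X)"
      proof -
        have "outer A \<le> outer ((A \<inter> X) \<union> - X)" by (rule outer_mono) auto
        also have "\<dots> \<le> outer (A \<inter> X) + outer (- X)" by (rule outer_Un_le)
        finally have "outer A \<le> outer (A \<inter> X) + outer (- X)" .
        moreover have "outer (- X) = 0" using measure_rep_measure_X(2) X_sets
          by (simp add: measure_rep_measure)
        moreover have "outer (A \<inter> X) \<le> outer A" by (rule outer_mono) auto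
        ultimately show ?thesis using A(1) X_sets by (simp add: measure_rep_measure)
      qed
      also have "\<dots> = measure rep (A \<inter> X)"
        unfolding rep_def using X_sets by (simp add: measure_restrict_space)
      also have "\<dots> = (LINT x|rep. indicator (A \<inter> X) x)" by (simp add: space_rep Int_ac)
      also have "\<dots> = (LINT x|rep. indicator {i / n<..} (f x))"
        using A(2) by (intro Bochner_Integration.integral_cong refl)
          (auto simp: space_rep indicator_def split: if_splits)
      finally show ?thesis using n L_cmult[OF ac, of n i] by (simp add: field_simps)
    qed
    have int: "integrable rep (\<lambda>x. (1 / n) * indicator {i / n<..} (f x))" for i
    proof -
      have [measurable]: "f \<in> borel_measurable rep" using integrable_rep[OF fc] by simp
      show ?thesis by (rule integrable_const_bound[of _ "1 / n"]) (auto simp: indicator_def)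
    qed
    have "L f = L (\<lambda>x. \<Sum>i<n. a i (f x))"
    proof (rule antisym; rule L_mono)
      show "f x \<le> (\<Sum>i<n. a i (f x))" "(\<Sum>i<n. a i (f x)) \<le> f x" if "x \<in> X" for x
        using sum_a[of "f x" n] f[OF that] n by auto
    qed (auto intro!: continuous_intros fc ac)
    also have "\<dots> = (\<Sum>i<n. L (\<lambda>x. a i (f x)))" by (rule L_sum) (auto intro: ac)
    also have "\<dots> \<le> (\<Sum>i<n. (LINT x|rep. (1 / n) * indicator {i / n<..} (f x)))"
      by (intro sum_mono slice)
    also have "\<dots> = (LINT x|rep. (\<Sum>i<n. (1 / n) * indicator {i / n<..} (f x)))"
      by (rule Bochner_Integration.integral_sum[symmetric]) (rule int)
    also have "\<dots> \<le> (LINT x|rep. f x + 1 / n)"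
    proof (rule integral_mono)
      show "integrable rep (\<lambda>x. \<Sum>i<n. (1 / n) * indicator {i / n<..} (f x))"
        by (rule Bochner_Integration.integrable_sum) (rule int)
      show "integrable rep (\<lambda>x. f x + 1 / n)" using integrable_rep[OF fc] by simp
      show "(\<Sum>i<n. (1 / n) * indicator {i / n<..} (f x)) \<le> f x + 1 / n" if "x \<in> space rep" for x
        using count[of "f x" n] f that by (force simp: space_rep)
    qed
    also have "\<dots> = (LINT x|rep. f x) + 1 / n"
      using integrable_rep[OF fc] measure_rep by (simp add: space_rep)
    finally show ?thesis by (simp add: n_def)
  qed
  then show "\<exists>N. \<forall>n\<ge>N. L f \<le> (LINT x|rep. f x) + 1 / real (Suc n)" by blast
qed

text \<open>The one-sided estimate, applied to f and to 1 - f, gives equality for values in [0, 1].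
  The affine map f / (2B) + 1/2 brings a function bounded by B > 0 into that range.\<close>

theorem integral_rep:
  assumes fc: "continuous_on X f"
  shows "(LINT x|rep. f x) = L f"
proof -
  interpret finite_measure rep by (rule finite_rep)
  have unit: "(LINT x|rep. f x) = L f"
    if fc: "continuous_on X f" and f: "\<And>x. x \<in> X \<Longrightarrow> 0 \<le> f x \<and> f x \<le> 1" for f
  proof -
    have "L (\<lambda>x. 1 - f x) \<le> (LINT x|rep. 1 - f x)"
      using f by (intro L_le_integral_unit continuous_intros fc) auto
    then show ?thesis
      using L_le_integral_unit[OF fc f] integrable_rep[OF fc] measure_rep L_diff[of "\<lambda>x. 1" f] fc
      by (simp add: space_rep L_const)
  qed
  obtain B0 where B0: "\<forall>x\<in>X. \<bar>f x\<bar> \<le> B0"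
    using compact_continuous_bounded[OF fc compact_X] by blast
  define B where "B = max B0 1"
  have B: "B > 0" "\<And>x. x \<in> X \<Longrightarrow> \<bar>f x\<bar> \<le> B" using B0 by (fastforce simp: B_def)+
  define g where "g = (\<lambda>x. (1 / (2 * B)) * f x + 1 / 2)"
  have "(LINT x|rep. g x) = L g"
  proof (rule unit)
    show "continuous_on X g" unfolding g_def by (intro continuous_intros fc)
    show "0 \<le> g x \<and> g x \<le> 1" if "x \<in> X" for x
      using B(1) B(2)[OF that] by (auto simp: g_def field_simps abs_le_iff)
  qed
  moreover have "L g = (1 / (2 * B)) * L f + 1 / 2"
  proof -
    have "L g = L (\<lambda>x. (1 / (2 * B)) * f x) + L (\<lambda>x. 1 / 2)"
      unfolding g_def by (rule L_add) (intro continuous_on_mult continuous_on_const fc)+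
    then show ?thesis using L_cmult[OF fc, of "1 / (2 * B)"] by (simp only: L_const)
  qed
  moreover have "(LINT x|rep. g x) = (1 / (2 * B)) * (LINT x|rep. f x) + 1 / 2"
    unfolding g_def using integrable_rep[OF fc] measure_rep by (simp add: space_rep)
  ultimately show ?thesis using B(1) by simp
qed

end

text \<open>The sublinear functional \<open>f \<mapsto> inf\<^bsub>g \<in> F\<^esub> max (f - g)\<close> dominates a linear one, and
  being dominated by it makes a linear functional positive, normalised and nonpositive on \<open>F\<close>.\<close>

theorem probability_nonpositive_on_cone:
  fixes X :: "'p::metric_space set" and F :: "('p \<Rightarrow> real) set"
  assumes X: "compact X" "X \<noteq> {}"
    and F: "F \<noteq> {}" "\<And>f. f \<in> F \<Longrightarrow> continuous_on X f"
      "\<And>f g. f \<in> F \<Longrightarrow> g \<in> F \<Longrightarrow> (\<lambda>x. f x + g x) \<in> F"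
      "\<And>c f. c \<ge> 0 \<Longrightarrow> f \<in> F \<Longrightarrow> (\<lambda>x. c * f x) \<in> F"
    and nonpos: "\<And>f. f \<in> F \<Longrightarrow> \<exists>x\<in>X. f x \<le> 0"
  shows "\<exists>M. sets M = sets (restrict_space borel X) \<and> finite_measure M \<and> measure M X = 1 \<and>
           (\<forall>f\<in>F. (LINT x|M. f x) \<le> 0)"
proof -
  define V where "V = {f :: 'p \<Rightarrow> real. continuous_on X f}"
  have V: "function_space V"
    unfolding function_space_def V_def by (auto intro: continuous_intros)
  note VD = function_spaceD[OF V]
  have FV: "f \<in> V" if "f \<in> F" for f using F(2) that by (simp add: V_def)
  have F0: "(\<lambda>x. 0) \<in> F" using F(1) F(4)[of 0] by auto
  define m where "m = (\<lambda>f::'p \<Rightarrow> real. SUP x\<in>X. f x)"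
  have bdd: "bdd_above (f ` X)" if "f \<in> V" for f
    using that X(1) compact_continuous_image[of X f]
    by (auto simp: V_def intro!: bounded_imp_bdd_above compact_imp_bounded)
  have m_upper: "f x \<le> m f" if "f \<in> V" "x \<in> X" for f x
    unfolding m_def by (rule cSUP_upper[OF that(2) bdd[OF that(1)]])
  have m_least: "m f \<le> c" if "\<And>x. x \<in> X \<Longrightarrow> f x \<le> c" for f c
    unfolding m_def using X(2) that by (intro cSUP_least) auto
  define q where "q = (\<lambda>f. INF g\<in>F. m (\<lambda>x. f x - g x))"
  \<comment> \<open>Here the hypothesis on the cone enters: at a point with g x \<le> 0 the
    difference f - g is at least f, which keeps the infimum over F finite.\<close>
  have lower: "- m (\<lambda>x. - f x) \<le> m (\<lambda>x. f x - g x)" if f: "f \<in> V" and g: "g \<in> F" for f g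
  proof -
    obtain x where x: "x \<in> X" "g x \<le> 0" using nonpos g by blast
    have "- f x \<le> m (\<lambda>x. - f x)" by (rule m_upper[OF VD(3)[OF f] x(1)])
    moreover have "f x - g x \<le> m (\<lambda>x. f x - g x)" by (rule m_upper[OF VD(5)[OF f FV[OF g]] x(1)])
    ultimately show ?thesis using x(2) by linarith
  qed
  have q_le: "q f \<le> m (\<lambda>x. f x - g x)" if "f \<in> V" "g \<in> F" for f g
    unfolding q_def using that lower[OF that(1)] by (intro cINF_lower) (auto intro!: bdd_belowI2)
  have m_hom: "m (\<lambda>x. d * k x) \<le> d * m k" if "d > 0" "k \<in> V" for d k
    using m_upper[OF that(2)] that(1) by (intro m_least) auto
  have "sublinear_on V q"
    unfolding q_def
  proof (rule sublinear_on_INF[OF V F(1)])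
    show "bdd_below ((\<lambda>g. m (\<lambda>x. f x - g x)) ` F)" if "f \<in> V" for f
      using lower[OF that] by (auto intro!: bdd_belowI2)
  next
    fix f k g h assume fk: "f \<in> V" "k \<in> V" and gh: "g \<in> F" "h \<in> F"
    have "m (\<lambda>x. f x + k x - (g x + h x)) \<le> m (\<lambda>x. f x - g x) + m (\<lambda>x. k x - h x)"
    proof (rule m_least)
      fix x assume x: "x \<in> X"
      show "f x + k x - (g x + h x) \<le> m (\<lambda>x. f x - g x) + m (\<lambda>x. k x - h x)"
        using m_upper[OF VD(5)[OF fk(1) FV[OF gh(1)]] x] m_upper[OF VD(5)[OF fk(2) FV[OF gh(2)]] x]
        by linarith
    qed
    then show "\<exists>l\<in>F. m (\<lambda>x. f x + k x - l x) \<le> m (\<lambda>x. f x - g x) + m (\<lambda>x. k x - h x)"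
      by (intro bexI[OF _ F(3)[OF gh]])
  next
    fix c :: real and f g assume c: "0 < c" and f: "f \<in> V" and g: "g \<in> F"
    have "(\<lambda>x. c * g x) \<in> F" using c by (intro F(4) g) simp
    moreover have "m (\<lambda>x. c * f x - c * g x) \<le> c * m (\<lambda>x. f x - g x)"
      using m_hom[OF c VD(5)[OF f FV[OF g]]] by (simp add: algebra_simps)
    ultimately show "\<exists>l\<in>F. m (\<lambda>x. c * f x - l x) \<le> c * m (\<lambda>x. f x - g x)"
      by (intro bexI[of _ "\<lambda>x. c * g x"])
  next
    show "0 \<le> m (\<lambda>x. 0 - g x)" if "g \<in> F" for g
      using lower[OF VD(4) that] m_least[of "\<lambda>x. 0" 0] by simp
    show "\<exists>g\<in>F. m (\<lambda>x. 0 - g x) \<le> 0"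
      using m_least[of "\<lambda>x. 0" 0] by (intro bexI[OF _ F0]) simp
  qed
  from sublinear_dominates_linear[OF V this] obtain L where
    L: "linear_functional_on V L" and Lq: "\<And>f. f \<in> V \<Longrightarrow> L f \<le> q f" by auto
  interpret mean_functional X L
  proof
    fix f :: "'p \<Rightarrow> real" and c assume f: "continuous_on X f" "\<And>x. x \<in> X \<Longrightarrow> f x \<le> c"
    have "L f \<le> q f" using f(1) by (intro Lq) (simp add: V_def)
    also have "\<dots> \<le> m (\<lambda>x. f x - 0)" using f(1) by (intro q_le F0) (simp add: V_def)
    also have "\<dots> \<le> c" using f(2) by (intro m_least) simp
    finally show "L f \<le> c" .
  qed (use X L in \<open>auto simp: V_def\<close>)
  have "(LINT x|rep. f x) \<le> 0" if f: "f \<in> F" for f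
  proof -
    have "(LINT x|rep. f x) = L f" using F(2)[OF f] by (rule integral_rep)
    also have "\<dots> \<le> q f" by (intro Lq FV f)
    also have "\<dots> \<le> m (\<lambda>x. f x - f x)" by (intro q_le FV f)
    also have "\<dots> \<le> 0" by (intro m_least) simp
    finally show ?thesis .
  qed
  then show ?thesis using sets_rep finite_rep measure_rep by (intro exI[of _ rep]) auto
qed

section \<open>Continuously differentiable functions along trajectories\<close>

abbreviation mode_space :: "nat \<Rightarrow> (nat \<Rightarrow> real) set" where
  "mode_space N \<equiv> (\<Pi>\<^sub>E k\<in>{..<N}. UNIV)"

lemma mode_space_upd: "z \<in> mode_space N \<Longrightarrow> k < N \<Longrightarrow> z(k := x) \<in> mode_space N"
  by (auto simp: PiE_iff extensional_def)

lemma C1_functionsI: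
  assumes "continuous_on (UNIV \<times> mode_space N) g"
    and "\<And>t z. z \<in> mode_space N \<Longrightarrow> ((\<lambda>s. g (s, z)) has_real_derivative gt (t, z)) (at t)"
    and "\<And>k t z. k < N \<Longrightarrow> z \<in> mode_space N \<Longrightarrow>
      ((\<lambda>x. g (t, z(k := x))) has_real_derivative gz k (t, z)) (at (z k))"
    and "continuous_on (UNIV \<times> mode_space N) gt"
    and "\<And>k. k < N \<Longrightarrow> continuous_on (UNIV \<times> mode_space N) (gz k)"
  shows "g \<in> C1_functions N"
    and "\<And>t z. z \<in> mode_space N \<Longrightarrow> partial_t g (t, z) = gt (t, z)"
    and "\<And>k t z. k < N \<Longrightarrow> z \<in> mode_space N \<Longrightarrow> partial_z k g (t, z) = gz k (t, z)"
proof -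
  show t: "partial_t g (t, z) = gt (t, z)" if "z \<in> mode_space N" for t z
    unfolding partial_t_def using DERIV_imp_deriv[OF assms(2)[OF that, of t]] by (simp only: prod.case)
  show z: "partial_z k g (t, z) = gz k (t, z)" if "k < N" "z \<in> mode_space N" for k t z
    unfolding partial_z_def using DERIV_imp_deriv[OF assms(3)[OF that, of t]] by (simp only: prod.case)
  have "continuous_on (UNIV \<times> mode_space N) (partial_t g)"
    using assms(4) by (rule continuous_on_eq) (elim SigmaE, simp only: t)
  moreover have "continuous_on (UNIV \<times> mode_space N) (partial_z k g)" if "k < N" for k
    using assms(5)[OF that] by (rule continuous_on_eq) (elim SigmaE, simp only: z that)
  ultimately show "g \<in> C1_functions N"
    unfolding C1_functions_def Let_def mem_Collect_eq field_differentiable_def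
    using assms(1) by (intro conjI ballI allI impI; clarify?) (blast intro: assms(2,3))+
qed

lemma C1_functionsD:
  assumes "g \<in> C1_functions N"
  shows "continuous_on (UNIV \<times> mode_space N) g"
    and "z \<in> mode_space N \<Longrightarrow> ((\<lambda>s. g (s, z)) has_real_derivative partial_t g (t, z)) (at t)"
    and "k < N \<Longrightarrow> z \<in> mode_space N \<Longrightarrow>
      ((\<lambda>x. g (t, z(k := x))) has_real_derivative partial_z k g (t, z)) (at (z k))"
    and "continuous_on (UNIV \<times> mode_space N) (partial_t g)"
    and "k < N \<Longrightarrow> continuous_on (UNIV \<times> mode_space N) (partial_z k g)"
proof -
  note g = assms[unfolded C1_functions_def Let_def, simplified]
  show "continuous_on (UNIV \<times> mode_space N) g" using g by blast
  show "continuous_on (UNIV \<times> mode_space N) (partial_t g)" using g by blast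
  show "k < N \<Longrightarrow> continuous_on (UNIV \<times> mode_space N) (partial_z k g)" using g by blast
  show "((\<lambda>s. g (s, z)) has_real_derivative partial_t g (t, z)) (at t)" if "z \<in> mode_space N"
  proof -
    have "(\<lambda>s. g (s, z)) field_differentiable at t" using g that by blast
    then show ?thesis unfolding partial_t_def by (simp add: field_differentiable_derivI)
  qed
  show "((\<lambda>x. g (t, z(k := x))) has_real_derivative partial_z k g (t, z)) (at (z k))"
    if "k < N" "z \<in> mode_space N"
  proof -
    have "(\<lambda>x. g (t, z(k := x))) field_differentiable at (z k)" using g that by blast
    then show ?thesis unfolding partial_z_def by (simp add: field_differentiable_derivI)
  qed
qed

text \<open>In the definition the derivative is taken at the coordinate of the base point; moving
  the base point along the line yields it at every y.\<close>

lemma C1_functions_derivative_line: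
  assumes "g \<in> C1_functions N" "k < N" "z \<in> mode_space N"
  shows "((\<lambda>x. g (t, z(k := x))) has_real_derivative partial_z k g (t, z(k := y))) (at y)"
  using C1_functionsD(3)[OF assms(1,2) mode_space_upd[OF assms(3,2), of y]] by simp

lemma
  assumes f: "f \<in> C1_functions N" and g: "g \<in> C1_functions N"
  shows C1_functions_lincomb: "(\<lambda>p. a * f p + b * g p) \<in> C1_functions N"
    and liouville_lincomb: "z \<in> mode_space N \<Longrightarrow> liouville lam B \<Psi> N (\<lambda>p. a * f p + b * g p) ((t, z), u) =
      a * liouville lam B \<Psi> N f ((t, z), u) + b * liouville lam B \<Psi> N g ((t, z), u)"
proof -
  note C = C1_functionsI[of N "\<lambda>p. a * f p + b * g p" "\<lambda>p. a * partial_t f p + b * partial_t g p"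
      "\<lambda>k p. a * partial_z k f p + b * partial_z k g p"]
  have 1: "continuous_on (UNIV \<times> mode_space N) (\<lambda>p. a * f p + b * g p)"
    by (intro continuous_intros C1_functionsD f g)
  have 2: "((\<lambda>s. a * f (s, z) + b * g (s, z)) has_real_derivative
      a * partial_t f (t, z) + b * partial_t g (t, z)) (at t)" if "z \<in> mode_space N" for t z
    using C1_functionsD(2)[OF f that] C1_functionsD(2)[OF g that]
    by (auto intro!: derivative_eq_intros)
  have 3: "((\<lambda>x. a * f (t, z(k := x)) + b * g (t, z(k := x))) has_real_derivative
      a * partial_z k f (t, z) + b * partial_z k g (t, z)) (at (z k))"
    if "k < N" "z \<in> mode_space N" for k t z
    using C1_functionsD(3)[OF f that] C1_functionsD(3)[OF g that]
    by (auto intro!: derivative_eq_intros)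
  have 4: "continuous_on (UNIV \<times> mode_space N) (\<lambda>p. a * partial_t f p + b * partial_t g p)"
    by (intro continuous_intros C1_functionsD f g)
  have 5: "continuous_on (UNIV \<times> mode_space N) (\<lambda>p. a * partial_z k f p + b * partial_z k g p)"
    if "k < N" for k
    by (intro continuous_intros C1_functionsD f g that)
  show "(\<lambda>p. a * f p + b * g p) \<in> C1_functions N" by (rule C(1)[OF 1 2 3 4 5])
  show "liouville lam B \<Psi> N (\<lambda>p. a * f p + b * g p) ((t, z), u) =
      a * liouville lam B \<Psi> N f ((t, z), u) + b * liouville lam B \<Psi> N g ((t, z), u)"
    if z: "z \<in> mode_space N"
    using C(2)[OF 1 2 3 4 5 z] C(3)[OF 1 2 3 4 5 _ z]
    by (simp add: liouville_def algebra_simps sum.distrib sum_distrib_left)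
qed

text \<open>The two families of test functions used later: functions of time alone determine the
  masses and the time marginal of a feasible measure, while \<phi>(t) z_k expresses the equation of
  the k-th mode in weak form.\<close>

lemma
  assumes \<phi>: "\<And>t. (\<phi> has_real_derivative \<phi>' t) (at t)" and \<phi>': "continuous_on UNIV \<phi>'"
  shows C1_functions_time: "(\<lambda>(t, z). \<phi> t) \<in> C1_functions N"
    and liouville_time: "z \<in> mode_space N \<Longrightarrow> liouville lam B \<Psi> N (\<lambda>(t, z). \<phi> t) ((t, z), u) = \<phi>' t"
    and C1_functions_time_coord: "k < N \<Longrightarrow> (\<lambda>(t, z). \<phi> t * z k) \<in> C1_functions N"
    and partial_t_time_coord: "z \<in> mode_space N \<Longrightarrow> k < N \<Longrightarrow>
      partial_t (\<lambda>(t, z). \<phi> t * z k) (t, z) = \<phi>' t * z k"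
    and partial_z_time_coord: "z \<in> mode_space N \<Longrightarrow> j < N \<Longrightarrow>
      partial_z j (\<lambda>(t, z). \<phi> t * z k) (t, z) = (if j = k then \<phi> t else 0)"
    and liouville_time_coord: "z \<in> mode_space N \<Longrightarrow> k < N \<Longrightarrow>
      liouville lam B \<Psi> N (\<lambda>(t, z). \<phi> t * z k) ((t, z), u) =
        \<phi>' t * z k + \<phi> t * mode_field lam B \<Psi> k (z k) u"
proof -
  have \<phi>c: "continuous_on UNIV \<phi>"
    using \<phi> DERIV_continuous_on[of UNIV \<phi> \<phi>'] by simp
  have comp: "continuous_on S (\<lambda>p. f (fst p))" if "continuous_on UNIV f"
    for f :: "real \<Rightarrow> real" and S :: "(real \<times> (nat \<Rightarrow> real)) set"
    by (rule continuous_on_compose2[OF that]) (auto intro: continuous_intros)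
  have coord: "continuous_on S (\<lambda>p. snd p k)" for S :: "(real \<times> (nat \<Rightarrow> real)) set" and k
    by (rule continuous_on_product_then_coordinatewise) (intro continuous_intros)
  note C = C1_functionsI[of N "\<lambda>(t, z). \<phi> t" "\<lambda>(t, z). \<phi>' t" "\<lambda>k p. 0"]
  have 1: "continuous_on (UNIV \<times> mode_space N) (\<lambda>(t, z). \<phi> t)"
    "continuous_on (UNIV \<times> mode_space N) (\<lambda>(t, z). \<phi>' t)"
    using comp[OF \<phi>c] comp[OF \<phi>'] by (simp_all add: split_def)
  have 2: "((\<lambda>s. case (s, z) of (t, z) \<Rightarrow> \<phi> t) has_real_derivative (case (t, z) of (t, z) \<Rightarrow> \<phi>' t)) (at t)"
    for t and z :: "nat \<Rightarrow> real" using \<phi> by simp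
  note C' = C[OF 1(1) 2 _ 1(2)]
  show "(\<lambda>(t, z). \<phi> t) \<in> C1_functions N" by (rule C'(1)) auto
  have "partial_t (\<lambda>(t, z). \<phi> t) (t, z) = \<phi>' t" if "z \<in> mode_space N" for z t
    using C'(2)[OF _ _ that] by auto
  moreover have "partial_z k (\<lambda>(t, z). \<phi> t) (t, z) = 0" if "z \<in> mode_space N" "k < N" for z t k
    using C'(3)[OF _ _ that(2,1)] by auto
  ultimately show "liouville lam B \<Psi> N (\<lambda>(t, z). \<phi> t) ((t, z), u) = \<phi>' t" if "z \<in> mode_space N"
    using that by (simp add: liouville_def)
  define gz where "gz = (\<lambda>j (t::real, z::nat \<Rightarrow> real). if j = k then \<phi> t else 0)"
  note K = C1_functionsI[of N "\<lambda>(t, z). \<phi> t * z k" "\<lambda>(t, z). \<phi>' t * z k" gz]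
  have k1: "continuous_on (UNIV \<times> mode_space N) (\<lambda>(t, z). \<phi> t * z k)"
    "continuous_on (UNIV \<times> mode_space N) (\<lambda>(t, z). \<phi>' t * z k)"
    using continuous_on_mult[OF comp[OF \<phi>c] coord] continuous_on_mult[OF comp[OF \<phi>'] coord]
    by (simp_all add: split_def)
  have k2: "((\<lambda>s. case (s, z) of (t, z) \<Rightarrow> \<phi> t * z k) has_real_derivative
      (case (t, z) of (t, z) \<Rightarrow> \<phi>' t * z k)) (at t)"
    for t and z :: "nat \<Rightarrow> real" using \<phi> by (auto intro!: derivative_eq_intros)
  have k3: "((\<lambda>x. case (t, z(j := x)) of (t, z) \<Rightarrow> \<phi> t * z k) has_real_derivative gz j (t, z)) (at (z j))"
    for t j and z :: "nat \<Rightarrow> real"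
    by (cases "j = k") (auto simp: gz_def intro!: derivative_eq_intros)
  have k5: "continuous_on (UNIV \<times> mode_space N) (gz j)" for j
    unfolding gz_def using 1 by (cases "j = k") (simp_all add: split_def)
  note K' = K[OF k1(1) k2 k3 k1(2) k5]
  show "(\<lambda>(t, z). \<phi> t * z k) \<in> C1_functions N" by (rule K'(1))
  show pt: "partial_t (\<lambda>(t, z). \<phi> t * z k) (t, z) = \<phi>' t * z k" if "z \<in> mode_space N" for z t
    using K'(2)[OF that] by auto
  show pz: "partial_z j (\<lambda>(t, z). \<phi> t * z k) (t, z) = (if j = k then \<phi> t else 0)"
    if "z \<in> mode_space N" "j < N" for z t j
    using K'(3)[OF that(2,1)] by (auto simp: gz_def)
  show "liouville lam B \<Psi> N (\<lambda>(t, z). \<phi> t * z k) ((t, z), u) =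
      \<phi>' t * z k + \<phi> t * mode_field lam B \<Psi> k (z k) u" if "z \<in> mode_space N" "k < N"
    using that by (simp add: liouville_def pt pz if_distrib[of "\<lambda>x. _ * x"] cong: if_cong)
qed

lemma mode_input_eq:
  fixes B :: "real^'m \<Rightarrow> 'a::real_inner"
  assumes "bounded_linear B"
  shows "mode_input B \<Psi> k u = inner (B u) (\<Psi> k)"
proof -
  interpret B: bounded_linear B by fact
  have "u = (\<Sum>i\<in>UNIV. axis i (u $ i))"
    by (simp add: vec_eq_iff axis_def)
  then have "B u = (\<Sum>i\<in>UNIV. B (axis i (u $ i)))" by (metis B.sum)
  then show ?thesis by (simp add: mode_input_def component_def inner_sum_left)
qed

lemma continuous_on_mode_input:
  fixes B :: "real^'m \<Rightarrow> 'a::real_inner"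
  assumes "bounded_linear B"
  shows "continuous_on S (mode_input B \<Psi> k)"
  unfolding mode_input_eq[OF assms, abs_def]
  by (intro continuous_intros linear_continuous_on assms)

lemma continuous_on_liouville:
  fixes B :: "real^'m \<Rightarrow> 'a::real_inner"
  assumes B: "bounded_linear B" and g: "g \<in> C1_functions N"
  shows "continuous_on ((UNIV \<times> mode_space N) \<times> UNIV) (liouville lam B \<Psi> N g)"
proof -
  let ?S = "(UNIV \<times> mode_space N) \<times> (UNIV :: (real^'m) set)"
  have comp: "continuous_on ?S (\<lambda>p. f (fst p))" if "continuous_on (UNIV \<times> mode_space N) f"
    for f :: "real \<times> (nat \<Rightarrow> real) \<Rightarrow> real"
    by (rule continuous_on_compose2[OF that]) (auto intro: continuous_intros)
  have coord: "continuous_on ?S (\<lambda>p. snd (fst p) k)" for k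
    by (rule continuous_on_product_then_coordinatewise) (intro continuous_intros)
  have inp: "continuous_on ?S (\<lambda>p. mode_input B \<Psi> k (snd p))" for k
    by (rule continuous_on_compose2[OF continuous_on_mode_input[OF B, of UNIV]])
      (auto intro: continuous_intros)
  show ?thesis
    unfolding liouville_def mode_field_def split_def
    using comp[OF C1_functionsD(4)[OF g]] comp[OF C1_functionsD(5)[OF g]]
    by (auto intro!: continuous_intros coord inp)
qed

section \<open>Chain rule and integration along curves in mode space\<close>

lemma tendsto_fun:
  assumes "\<And>i. ((\<lambda>x. f x i) \<longlongrightarrow> l i) F"
  shows "(f \<longlongrightarrow> l) F"
proof -
  have "limitin (product_topology (\<lambda>i. euclidean) UNIV) f l F"
    using assms by (simp add: limitin_componentwise)
  then show ?thesis by (simp add: euclidean_product_topology)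
qed

text \<open>b may lie on either side of a or equal it. Only the distance of \<xi> from a matters
  later, since it makes the intermediate points converge.\<close>

lemma mean_value_between:
  fixes f :: "real \<Rightarrow> real"
  assumes "\<And>x. (f has_real_derivative f' x) (at x)"
  shows "\<exists>\<xi>. \<bar>\<xi> - a\<bar> \<le> \<bar>b - a\<bar> \<and> f b - f a = (b - a) * f' \<xi>"
proof (cases a b rule: linorder_cases)
  case less
  then show ?thesis using MVT2[OF less assms] by force
next
  case greater
  then obtain \<xi> where "b < \<xi>" "\<xi> < a" "f a - f b = (a - b) * f' \<xi>"
    using MVT2[OF greater assms] by blast
  then show ?thesis by (intro exI[of _ \<xi>]) (auto simp: algebra_simps)
qed simp

text \<open>The coordinates are moved one at a time; on each step the mean value theorem applies in one
  variable, and the intermediate points converge because the partial derivative is jointly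
  continuous.\<close>

lemma C1_functions_chain_rule:
  assumes g: "g \<in> C1_functions N"
    and z: "\<And>k. k < N \<Longrightarrow> (z k has_real_derivative z' k) (at t)"
  shows "((\<lambda>s. g (s, \<lambda>k\<in>{..<N}. z k s)) has_real_derivative
      partial_t g (t, \<lambda>k\<in>{..<N}. z k t) +
      (\<Sum>k<N. z' k * partial_z k g (t, \<lambda>k\<in>{..<N}. z k t))) (at t)"
proof -
  define H where "H = (\<lambda>j s. \<lambda>k\<in>{..<N}. if k < j then z k s else z k t)"
  have HE: "H j s \<in> mode_space N" for j s by (simp add: H_def)
  have H0: "H 0 s = (\<lambda>k\<in>{..<N}. z k t)" for s by (auto simp: H_def restrict_def)
  have HN: "H N s = (\<lambda>k\<in>{..<N}. z k s)" for s by (auto simp: H_def restrict_def)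
  have HS: "H (Suc j) s = (H j s)(j := z j s)" "H j s j = z j t" if "j < N" for j s
    using that by (auto simp: H_def fun_eq_iff restrict_def)
  have step: "((\<lambda>s. g (s, H (Suc j) s) - g (s, H j s)) has_real_derivative
      z' j * partial_z j g (t, H 0 t)) (at t)" if j: "j < N" for j
  proof -
    have "\<forall>s. \<exists>\<xi>. \<bar>\<xi> - z j t\<bar> \<le> \<bar>z j s - z j t\<bar> \<and>
        g (s, (H j s)(j := z j s)) - g (s, (H j s)(j := z j t)) =
        (z j s - z j t) * partial_z j g (s, (H j s)(j := \<xi>))"
      by (intro allI mean_value_between C1_functions_derivative_line[OF g j HE])
    then obtain \<xi> where \<xi>: "\<And>s. \<bar>\<xi> s - z j t\<bar> \<le> \<bar>z j s - z j t\<bar>"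
      "\<And>s. g (s, (H j s)(j := z j s)) - g (s, (H j s)(j := z j t)) =
        (z j s - z j t) * partial_z j g (s, (H j s)(j := \<xi> s))"
      by metis
    have diff: "g (s, H (Suc j) s) - g (s, H j s) = (z j s - z j t) * partial_z j g (s, (H j s)(j := \<xi> s))" for s
      using \<xi>(2)[of s] HS[OF j] by (metis fun_upd_triv)
    have zlim: "(z k \<longlongrightarrow> z k t) (at t)" if "k < N" for k
      using DERIV_isCont[OF z[OF that]] by (simp add: isCont_def)
    have \<xi>lim: "(\<xi> \<longlongrightarrow> z j t) (at t)"
    proof (rule Lim_transform_bound[of "\<lambda>s. \<xi> s - z j t" "\<lambda>s. z j s - z j t", THEN Lim_null[THEN iffD2]])
      show "\<forall>\<^sub>F s in at t. norm (\<xi> s - z j t) \<le> norm (z j s - z j t)" using \<xi>(1) by simp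
      show "((\<lambda>s. z j s - z j t) \<longlongrightarrow> 0) (at t)" using Lim_null zlim[OF j] by blast
    qed
    have pt: "((\<lambda>s. (s, (H j s)(j := \<xi> s))) \<longlongrightarrow> (t, H 0 t)) (at t)"
    proof (intro tendsto_Pair tendsto_ident_at)
      have "((\<lambda>s. ((H j s)(j := \<xi> s)) k) \<longlongrightarrow> H 0 t k) (at t)" for k
        using j zlim[of k] \<xi>lim by (cases "k = j"; cases "k < N"; cases "k < j") (auto simp: H_def restrict_def)
      then show "((\<lambda>s. (H j s)(j := \<xi> s)) \<longlongrightarrow> H 0 t) (at t)"
        by (rule tendsto_fun)
    qed
    have plim: "((\<lambda>s. partial_z j g (s, (H j s)(j := \<xi> s))) \<longlongrightarrow> partial_z j g (t, H 0 t)) (at t)"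
    proof (rule continuous_on_tendsto_compose[OF C1_functionsD(5)[OF g j] pt])
      show "(t, H 0 t) \<in> UNIV \<times> mode_space N" using HE by blast
      show "\<forall>\<^sub>F s in at t. (s, (H j s)(j := \<xi> s)) \<in> UNIV \<times> mode_space N"
        using mode_space_upd[OF HE j] by simp
    qed
    have "((\<lambda>s. (z j s - z j t) / (s - t)) \<longlongrightarrow> z' j) (at t)"
      using z[OF j] by (simp add: has_field_derivative_iff)
    note lim = tendsto_mult[OF this plim]
    have "(g (s, H (Suc j) s) - g (s, H j s) - (g (t, H (Suc j) t) - g (t, H j t))) / (s - t) =
        (z j s - z j t) / (s - t) * partial_z j g (s, (H j s)(j := \<xi> s))" for s
      by (simp add: diff)
    then show ?thesis
      unfolding has_field_derivative_iff by (rule ssubst[OF ext]) (rule lim)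
  qed
  \<comment> \<open>Telescoping leaves g (s, H 0 t), the explicit dependence on time with frozen
    state, which contributes the \<open>partial_t\<close> term.\<close>
  have sum: "g (s, H N s) = g (s, H 0 t) + (\<Sum>j<N. g (s, H (Suc j) s) - g (s, H j s))" for s
    using sum_lessThan_telescope[of "\<lambda>j. g (s, H j s)" N] by (simp add: H0)
  have "((\<lambda>s. g (s, H 0 t) + (\<Sum>j<N. g (s, H (Suc j) s) - g (s, H j s))) has_real_derivative
      partial_t g (t, H 0 t) + (\<Sum>j<N. z' j * partial_z j g (t, H 0 t))) (at t)"
    by (intro DERIV_add DERIV_sum step C1_functionsD(2)[OF g HE]) simp
  then show ?thesis unfolding sum[symmetric] unfolding HN H0 .
qed

text \<open>An extensional function is \<open>undefined\<close> beyond N; with singletons as the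
  remaining factors the set is a product over all indices and Tychonoff's theorem applies.\<close>

lemma compact_PiE_lessThan:
  fixes S :: "nat \<Rightarrow> 'b::topological_space set"
  assumes "\<And>k. k < N \<Longrightarrow> compact (S k)"
  shows "compact (\<Pi>\<^sub>E k\<in>{..<N}. S k)"
proof -
  have eq: "(\<Pi>\<^sub>E k\<in>{..<N}. S k) = (\<Pi>\<^sub>E k\<in>UNIV. if k < N then S k else {undefined})"
    unfolding PiE_def extensional_def Pi_def by (intro set_eqI) (simp, metis singletonD singletonI)
  have "compactin (product_topology (\<lambda>k. euclidean) UNIV) (\<Pi>\<^sub>E k\<in>UNIV. if k < N then S k else {undefined})"
    using assms by (auto simp: compactin_PiE)
  then show ?thesis by (simp add: eq euclidean_product_topology)
qed

lemma continuous_on_restrict_lessThan: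
  fixes z :: "nat \<Rightarrow> 'x::topological_space \<Rightarrow> real"
  assumes "\<And>k. k < N \<Longrightarrow> continuous_on S (z k)"
  shows "continuous_on S (\<lambda>s. \<lambda>k\<in>{..<N}. z k s)"
proof (rule continuous_on_coordinatewise_then_product)
  show "continuous_on S (\<lambda>s. (\<lambda>k\<in>{..<N}. z k s) k)" for k
    using assms by (cases "k < N") auto
qed

text \<open>The notion \<open>measurable_on\<close> supplies continuous functions that converge off
  a negligible set. Truncation at the level C does not change the limit, as w is bounded by C, and
  gives the uniform bound required by dominated convergence.\<close>

lemma bounded_measurable_approx:
  fixes w :: "real \<Rightarrow> real"
  assumes w: "w \<in> borel_measurable (lebesgue_on {0..T})" and C: "\<And>t. t \<in> {0..T} \<Longrightarrow> \<bar>w t\<bar> \<le> C"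
    and T: "T \<ge> 0"
  shows "\<exists>v. (\<forall>n. continuous_on UNIV (v n)) \<and> (\<forall>n t. \<bar>v n t\<bar> \<le> C) \<and>
           (AE t in lebesgue_on {0..T}. (\<lambda>n. v n t) \<longlonglongrightarrow> w t)"
proof -
  have C0: "C \<ge> 0" using C[of 0] T by force
  define u where "u = (\<lambda>t. if t \<in> {0..T} then w t else 0)"
  have "u \<in> borel_measurable lebesgue"
    unfolding u_def by (rule borel_measurable_if_I[OF w]) simp
  then have "u measurable_on UNIV" by (intro lebesgue_measurable_imp_measurable_on_real) auto
  then obtain A g where A: "negligible A" and g: "\<And>n. continuous_on UNIV (g n)"
    and lim: "\<And>x. x \<notin> A \<Longrightarrow> (\<lambda>n. g n x) \<longlonglongrightarrow> u x"
    unfolding measurable_on_def by auto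
  define v where "v = (\<lambda>n t. max (-C) (min C (g n t)))"
  have "AE t in lebesgue_on {0..T}. (\<lambda>n. v n t) \<longlonglongrightarrow> w t"
  proof (rule AE_I')
    have "negligible (A \<inter> {0..T})" using A by (rule negligible_subset) auto
    then show "A \<inter> {0..T} \<in> null_sets (lebesgue_on {0..T})"
      by (simp add: null_sets_restrict_space negligible_iff_null_sets)
    show "{t \<in> space (lebesgue_on {0..T}). \<not> (\<lambda>n. v n t) \<longlonglongrightarrow> w t} \<subseteq> A \<inter> {0..T}"
    proof safe
      fix t assume t: "t \<in> space (lebesgue_on {0..T})" "\<not> (\<lambda>n. v n t) \<longlonglongrightarrow> w t"
      then show "t \<in> {0..T}" by simp
      show "t \<in> A"
      proof (rule ccontr)
        assume "t \<notin> A"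
        then have "(\<lambda>n. v n t) \<longlonglongrightarrow> max (-C) (min C (u t))"
          unfolding v_def by (intro tendsto_intros lim)
        moreover have "max (-C) (min C (u t)) = w t"
          using C[of t] t(1) by (auto simp: u_def max_def min_def abs_le_iff)
        ultimately show False using t(2) by simp
      qed
    qed
  qed
  moreover have "continuous_on UNIV (v n)" for n unfolding v_def by (intro continuous_intros g)
  moreover have "\<bar>v n t\<bar> \<le> C" for n t using C0 by (auto simp: v_def)
  ultimately show ?thesis by blast
qed

lemma finite_measure_lebesgue_on_interval: "finite_measure (lebesgue_on {a..b::real})"
  by (rule finite_measure_lebesgue_on) auto

lemma bounded_measurable_integrable:
  fixes f :: "real \<Rightarrow> real"
  assumes "f \<in> borel_measurable (lebesgue_on {a..b})" "\<And>t. t \<in> {a..b} \<Longrightarrow> \<bar>f t\<bar> \<le> C"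
  shows "integrable (lebesgue_on {a..b}) f" "f integrable_on {a..b}"
proof -
  interpret finite_measure "lebesgue_on {a..b}" by (rule finite_measure_lebesgue_on_interval)
  show "integrable (lebesgue_on {a..b}) f"
    by (rule integrable_const_bound[of _ C]) (use assms in \<open>auto intro!: AE_I2\<close>)
  then show "f integrable_on {a..b}" by (rule integrable_on_lebesgue_on) simp
qed

lemma borel_measurable_lebesgue_on_subinterval:
  fixes f :: "real \<Rightarrow> real"
  assumes "f \<in> borel_measurable (lebesgue_on {0..T})" "t \<le> T"
  shows "f \<in> borel_measurable (lebesgue_on {0..t})"
  by (rule measurable_restrict_mono[OF assms(1)]) (use assms(2) in auto)

lemma integral_tendsto_of_AE:
  fixes v :: "nat \<Rightarrow> real \<Rightarrow> real"
  assumes v: "\<And>n. v n \<in> borel_measurable (lebesgue_on {0..T})" "w \<in> borel_measurable (lebesgue_on {0..T})"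
    and C: "\<And>n t. t \<in> {0..T} \<Longrightarrow> \<bar>v n t\<bar> \<le> C" "\<And>t. t \<in> {0..T} \<Longrightarrow> \<bar>w t\<bar> \<le> C"
    and lim: "AE t in lebesgue_on {0..T}. (\<lambda>n. v n t) \<longlonglongrightarrow> w t"
    and t: "t \<le> T"
  shows "(\<lambda>n. integral {0..t} (v n)) \<longlonglongrightarrow> integral {0..t} w"
proof -
  interpret finite_measure "lebesgue_on {0..t}" by (rule finite_measure_lebesgue_on_interval)
  have m: "\<And>n. v n \<in> borel_measurable (lebesgue_on {0..t})" "w \<in> borel_measurable (lebesgue_on {0..t})"
    using v t by (auto intro: borel_measurable_lebesgue_on_subinterval)
  have C': "\<And>n s. s \<in> {0..t} \<Longrightarrow> \<bar>v n s\<bar> \<le> C" "\<And>s. s \<in> {0..t} \<Longrightarrow> \<bar>w s\<bar> \<le> C"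
    using C t by auto
  have "AE s in lebesgue_on {0..t}. (\<lambda>n. v n s) \<longlonglongrightarrow> w s"
    using lim t by (auto simp: AE_restrict_space_iff elim!: eventually_mono)
  then have "(\<lambda>n. integral\<^sup>L (lebesgue_on {0..t}) (v n)) \<longlonglongrightarrow> integral\<^sup>L (lebesgue_on {0..t}) w"
    by (intro integral_dominated_convergence[where w = "\<lambda>_. C"] m) (use C' in \<open>auto intro!: AE_I2\<close>)
  then show ?thesis
    using bounded_measurable_integrable(1)[OF m(1) C'(1)] bounded_measurable_integrable(1)[OF m(2) C'(2)]
    by (simp add: lebesgue_integral_eq_integral)
qed

text \<open>For continuous \<open>w\<close> this is the chain rule and the fundamental theorem of calculus; bounded
  measurable \<open>w\<close> are limits of such functions.\<close>

theorem C1_functions_integral_along_curve: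
  assumes g: "g \<in> C1_functions N" and T: "T > 0"
    and w: "\<And>k. k < N \<Longrightarrow> w k \<in> borel_measurable (lebesgue_on {0..T})"
    and C: "\<And>k t. k < N \<Longrightarrow> t \<in> {0..T} \<Longrightarrow> \<bar>w k t\<bar> \<le> C"
    and z: "\<And>k t. k < N \<Longrightarrow> t \<in> {0..T} \<Longrightarrow> z k t = c k + integral {0..t} (w k)"
  shows "(LINT t|lebesgue_on {0..T}. partial_t g (t, \<lambda>k\<in>{..<N}. z k t) +
            (\<Sum>k<N. w k t * partial_z k g (t, \<lambda>k\<in>{..<N}. z k t))) =
         g (T, \<lambda>k\<in>{..<N}. z k T) - g (0, \<lambda>k\<in>{..<N}. z k 0)"
proof -
  interpret finite_measure "lebesgue_on {0..T}" by (rule finite_measure_lebesgue_on_interval)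
  have "\<exists>v. (\<forall>n. continuous_on UNIV (v n)) \<and> (\<forall>n t. \<bar>v n t\<bar> \<le> C) \<and>
           (AE t in lebesgue_on {0..T}. (\<lambda>n. v n t) \<longlonglongrightarrow> w k t)" if "k < N" for k
    using bounded_measurable_approx[OF w[OF that] C[OF that]] T by auto
  then obtain v where vc: "\<And>k n. k < N \<Longrightarrow> continuous_on UNIV (v k n)"
    and vC: "\<And>k n t. k < N \<Longrightarrow> \<bar>v k n t\<bar> \<le> C"
    and vlim: "\<And>k. k < N \<Longrightarrow> AE t in lebesgue_on {0..T}. (\<lambda>n. v k n t) \<longlonglongrightarrow> w k t"
    by metis
  have vm: "v k n \<in> borel_measurable (lebesgue_on {0..T})" if "k < N" for k n
    using continuous_on_subset[OF vc[OF that]]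
    by (intro continuous_imp_measurable_on_sets_lebesgue) auto
  define y where "y = (\<lambda>n k t. c k + integral {0..t} (v k n))"
  have ylim: "(\<lambda>n. y n k t) \<longlonglongrightarrow> z k t" if "k < N" "t \<in> {0..T}" for k t
    unfolding y_def z[OF that]
    using integral_tendsto_of_AE[OF vm[OF that(1)] w[OF that(1)] vC[OF that(1)] C[OF that(1)] vlim[OF that(1)]] that
    by (intro tendsto_intros) auto
  have vint: "v k n integrable_on {0..t}" if "k < N" "t \<le> T" for k n t
    using borel_measurable_lebesgue_on_subinterval[OF vm[OF that(1)] that(2)] vC[OF that(1)]
    by (rule bounded_measurable_integrable(2))
  have wint: "w k integrable_on {0..T}" if "k < N" for k
    using w[OF that] C[OF that] by (rule bounded_measurable_integrable(2))
  have yc: "continuous_on {0..T} (y n k)" if "k < N" for k n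
    unfolding y_def by (intro continuous_intros indefinite_integral_continuous_1 vint that) simp
  have zc: "continuous_on {0..T} (z k)" if "k < N" for k
  proof (rule continuous_on_eq)
    show "continuous_on {0..T} (\<lambda>t. c k + integral {0..t} (w k))"
      by (intro continuous_intros indefinite_integral_continuous_1 wint that)
  qed (use z that in auto)
  have yd: "(y n k has_real_derivative v k n t) (at t)" if "k < N" "t \<in> {0<..<T}" for n k t
  proof -
    have "((\<lambda>u. integral {0..u} (v k n)) has_vector_derivative v k n t) (at t within {0..T})"
      using that by (intro integral_has_vector_derivative continuous_on_subset[OF vc]) auto
    then have "((\<lambda>u. integral {0..u} (v k n)) has_real_derivative v k n t) (at t)"
      using that by (simp add: has_real_derivative_iff_has_vector_derivative at_within_Icc_at)
    then show ?thesis unfolding y_def by (auto intro!: derivative_eq_intros)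
  qed
  \<comment> \<open>\<open>R k\<close> bounds the k-th coordinate of all approximating curves at
    once. They therefore stay in one compact box K, and bounds of the partial derivatives on K
    dominate all the integrands \<open>D n\<close>.\<close>
  define R where "R = (\<lambda>k. \<bar>c k\<bar> + C * T)"
  have yR: "\<bar>y n k t\<bar> \<le> R k" if "k < N" "t \<in> {0..T}" for n k t
  proof -
    have "norm (integral {0..t} (v k n)) \<le> C * (t - 0)"
      using that vC[OF that(1)] by (intro integral_bound continuous_on_subset[OF vc]) auto
    also have "\<dots> \<le> C * T" using that vC[OF that(1), of 0 0] by (intro mult_left_mono) auto
    finally show ?thesis unfolding y_def R_def by simp
  qed
  define K where "K = {0..T} \<times> (\<Pi>\<^sub>E k\<in>{..<N}. {-R k..R k})"
  have K: "compact K" unfolding K_def by (intro compact_Times compact_PiE_lessThan) auto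
  have KE: "K \<subseteq> UNIV \<times> mode_space N" by (auto simp: K_def)
  have bounded_K: "\<exists>b. \<forall>p\<in>K. \<bar>f p\<bar> \<le> b" if "continuous_on (UNIV \<times> mode_space N) f"
    for f :: "real \<times> (nat \<Rightarrow> real) \<Rightarrow> real"
    using continuous_on_subset[OF that KE] K by (rule compact_continuous_bounded)
  define Y where "Y = (\<lambda>n t. \<lambda>k\<in>{..<N}. y n k t)"
  define Z where "Z = (\<lambda>t. \<lambda>k\<in>{..<N}. z k t)"
  have YK: "(t, Y n t) \<in> K" if "t \<in> {0..T}" for n t
    using yR that by (auto simp: K_def Y_def abs_le_iff minus_le_iff)
  have Ylim: "(\<lambda>n. (t, Y n t)) \<longlonglongrightarrow> (t, Z t)" if "t \<in> {0..T}" for t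
  proof (intro tendsto_intros tendsto_fun)
    show "(\<lambda>n. Y n t i) \<longlonglongrightarrow> Z t i" for i
      using ylim[OF _ that, of i] by (cases "i < N") (auto simp: Y_def Z_def)
  qed
  have ZE: "(t, Z t) \<in> UNIV \<times> mode_space N" "(t, Y n t) \<in> UNIV \<times> mode_space N" for t n
    by (auto simp: Z_def Y_def)
  have Yc: "continuous_on {0..T} (\<lambda>t. (t, Y n t))" for n
    unfolding Y_def by (intro continuous_intros continuous_on_restrict_lessThan yc)
  have Zc: "continuous_on {0..T} (\<lambda>t. (t, Z t))"
    unfolding Z_def by (intro continuous_intros continuous_on_restrict_lessThan zc)
  have compY: "continuous_on {0..T} (\<lambda>t. f (t, Y n t))" "continuous_on {0..T} (\<lambda>t. f (t, Z t))"
    and comp_lim: "t \<in> {0..T} \<Longrightarrow> (\<lambda>n. f (t, Y n t)) \<longlonglongrightarrow> f (t, Z t)"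
    if "continuous_on (UNIV \<times> mode_space N) f" for f :: "real \<times> (nat \<Rightarrow> real) \<Rightarrow> real" and n t
  proof -
    show "continuous_on {0..T} (\<lambda>t. f (t, Y n t))" "continuous_on {0..T} (\<lambda>t. f (t, Z t))"
      using ZE by (blast intro: continuous_on_compose2[OF that Yc] continuous_on_compose2[OF that Zc])+
    show "t \<in> {0..T} \<Longrightarrow> (\<lambda>n. f (t, Y n t)) \<longlonglongrightarrow> f (t, Z t)"
      using continuous_on_tendsto_compose[OF that Ylim ZE(1)] ZE(2) by simp
  qed
  define D where "D = (\<lambda>n t. partial_t g (t, Y n t) + (\<Sum>k<N. v k n t * partial_z k g (t, Y n t)))"
  define E where "E = (\<lambda>t. partial_t g (t, Z t) + (\<Sum>k<N. w k t * partial_z k g (t, Z t)))"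
  note Dt = C1_functionsD(4)[OF g] and Dz = C1_functionsD(5)[OF g]
  have Dc: "continuous_on {0..T} (D n)" for n
    unfolding D_def by (intro continuous_intros compY Dt Dz continuous_on_subset[OF vc]) auto
  have FTC: "integral {0..T} (D n) = g (T, Y n T) - g (0, Y n 0)" for n
  proof (rule integral_unique, rule fundamental_theorem_of_calculus_interior)
    show "continuous_on {0..T} (\<lambda>t. g (t, Y n t))" by (rule compY[OF C1_functionsD(1)[OF g]])
    fix t assume t: "t \<in> {0<..<T}"
    show "((\<lambda>t. g (t, Y n t)) has_vector_derivative D n t) (at t)"
      unfolding D_def Y_def has_real_derivative_iff_has_vector_derivative[symmetric]
      by (rule C1_functions_chain_rule[OF g yd]) (use t in auto)
  qed (use T in auto)
  obtain b0 where b0: "\<forall>p\<in>K. \<bar>partial_t g p\<bar> \<le> b0" using bounded_K[OF Dt] by blast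
  have "\<forall>k. \<exists>b. k < N \<longrightarrow> (\<forall>p\<in>K. \<bar>partial_z k g p\<bar> \<le> b)" using bounded_K[OF Dz] by blast
  then obtain b where b: "\<And>k. k < N \<Longrightarrow> \<forall>p\<in>K. \<bar>partial_z k g p\<bar> \<le> b k" by metis
  have DB: "\<bar>D n t\<bar> \<le> b0 + (\<Sum>k<N. C * b k)" if "t \<in> {0..T}" for n t
  proof -
    have "\<bar>v k n t * partial_z k g (t, Y n t)\<bar> \<le> C * b k" if "k < N" for k
      unfolding abs_mult using b[OF that] YK[OF \<open>t \<in> {0..T}\<close>] vC[OF that, of n t]
      by (intro mult_mono) (auto intro: order_trans[OF abs_ge_zero])
    then have "\<bar>\<Sum>k<N. v k n t * partial_z k g (t, Y n t)\<bar> \<le> (\<Sum>k<N. C * b k)"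
      by (intro order_trans[OF sum_abs] sum_mono) auto
    moreover have "\<bar>partial_t g (t, Y n t)\<bar> \<le> b0" using b0 YK[OF that] by blast
    ultimately show ?thesis unfolding D_def by linarith
  qed
  have Em: "E \<in> borel_measurable (lebesgue_on {0..T})"
  proof -
    have "(\<lambda>t. partial_t g (t, Z t)) \<in> borel_measurable (lebesgue_on {0..T})"
      by (intro continuous_imp_measurable_on_sets_lebesgue compY Dt) auto
    moreover have "(\<lambda>t. partial_z k g (t, Z t)) \<in> borel_measurable (lebesgue_on {0..T})" if "k < N" for k
      by (intro continuous_imp_measurable_on_sets_lebesgue compY Dz that) auto
    ultimately show ?thesis
      unfolding E_def using w by (intro borel_measurable_add borel_measurable_sum borel_measurable_times) auto
  qed
  have Dm: "D n \<in> borel_measurable (lebesgue_on {0..T})" for n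
    by (intro continuous_imp_measurable_on_sets_lebesgue Dc) auto
  have "AE t in lebesgue_on {0..T}. \<forall>k\<in>{..<N}. (\<lambda>n. v k n t) \<longlonglongrightarrow> w k t"
    by (intro AE_finite_allI) (auto intro: vlim)
  then have AElim: "AE t in lebesgue_on {0..T}. (\<lambda>n. D n t) \<longlonglongrightarrow> E t"
  proof (rule AE_mp, intro AE_I2 impI)
    fix t assume t: "t \<in> space (lebesgue_on {0..T})" and *: "\<forall>k\<in>{..<N}. (\<lambda>n. v k n t) \<longlonglongrightarrow> w k t"
    then show "(\<lambda>n. D n t) \<longlonglongrightarrow> E t"
      unfolding D_def E_def using comp_lim[OF Dt] comp_lim[OF Dz]
      by (intro tendsto_intros) auto
  qed
  have "(\<lambda>n. integral\<^sup>L (lebesgue_on {0..T}) (D n)) \<longlonglongrightarrow> integral\<^sup>L (lebesgue_on {0..T}) E"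
    by (rule integral_dominated_convergence[where w = "\<lambda>_. b0 + (\<Sum>k<N. C * b k)"])
      (use Em Dm AElim DB in \<open>auto intro!: AE_I2\<close>)
  moreover have "integral\<^sup>L (lebesgue_on {0..T}) (D n) = g (T, Y n T) - g (0, Y n 0)" for n
    using bounded_measurable_integrable(1)[OF Dm DB] by (simp add: lebesgue_integral_eq_integral FTC)
  moreover have "(\<lambda>n. g (T, Y n T) - g (0, Y n 0)) \<longlonglongrightarrow> g (T, Z T) - g (0, Z 0)"
    using T by (intro tendsto_intros comp_lim C1_functionsD(1)[OF g]) auto
  ultimately have "integral\<^sup>L (lebesgue_on {0..T}) E = g (T, Z T) - g (0, Z 0)"
    using LIMSEQ_unique by force
  then show ?thesis by (simp add: E_def Z_def)
qed

section \<open>Occupation measures\<close>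

text \<open>The closed set of good times has full measure in the open interval, so it contains that
  interval and then its closure. This upgrades state constraints from almost all times to all
  times.\<close>

lemma continuous_AE_mem_closed:
  fixes f :: "real \<Rightarrow> 'b::topological_space"
  assumes f: "continuous_on {a..b} f" and S: "closed S" and "a < b"
    and AE: "AE t in lebesgue_on {a..b}. f t \<in> S" and t: "t \<in> {a..b}"
  shows "f t \<in> S"
proof -
  define F where "F = {a..b} \<inter> f -` S"
  have F: "closed F" unfolding F_def using f S by (intro continuous_closed_preimage) auto
  have "AE x in lebesgue. x \<in> {a<..<b} \<longrightarrow> x \<in> F"
    using AE by (auto simp: AE_restrict_space_iff F_def elim!: eventually_mono)
  then have "{a<..<b} \<subseteq> F"
    by (intro subsetI mem_closed_if_AE_lebesgue_open[of "{a<..<b}" F] F) auto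
  then have "closure {a<..<b} \<subseteq> F" using F by (rule closure_minimal)
  then show ?thesis using t \<open>a < b\<close> by (auto simp: F_def)
qed

text \<open>Isolates the finite-dimensional side; the semigroup enters through
  \<open>admissible_imp_mode_admissible\<close>. Compactness of U and of the intervals makes every
  set on which measures live compact, and the cost is used through its continuity on {0..T} \<times>
  U.\<close>

locale mode_problem =
  fixes lam :: "nat \<Rightarrow> real" and B :: "real^'m \<Rightarrow> 'a::real_inner" and \<Psi> :: "nat \<Rightarrow> 'a"
    and U :: "(real^'m) set" and Zs ZT :: "'a set" and T :: real and z0 :: 'a
    and h :: "real \<Rightarrow> real^'m \<Rightarrow> real"
  assumes B: "bounded_linear B" and U: "compact U" and T: "T > 0"
    and h: "continuous_on ({0..T} \<times> U) (\<lambda>(t, u). h t u)"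
    and Zs: "\<And>k. \<exists>a b. mode_set \<Psi> Zs k = {a..b}"
    and ZT: "\<And>k. \<exists>a b. mode_set \<Psi> ZT k = {a..b}"
begin

abbreviation "domain N \<equiv> S_N \<Psi> Zs U N T"
abbreviation "target N \<equiv> mode_box \<Psi> ZT N"
abbreviation "\<L> N \<equiv> liouville lam B \<Psi> N"
abbreviation "mode_controls N \<equiv> admissible_mode_controls lam B \<Psi> U Zs ZT N T z0"
abbreviation "primal N \<equiv> lp_feasible lam B \<Psi> U Zs ZT N T z0"
abbreviation "dual N \<equiv> dual_feasible h lam B \<Psi> U Zs ZT N T"
abbreviation "primal_value N \<equiv> lp_value h lam B \<Psi> U Zs ZT N T z0"
abbreviation "dual_optimum N \<equiv> dual_value h lam B \<Psi> U Zs ZT N T z0"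

lemma compact_mode_set: "compact (mode_set \<Psi> Zs k)" "compact (mode_set \<Psi> ZT k)"
  using Zs[of k] ZT[of k] by (metis compact_Icc)+

lemma compact_mode_box: "compact (mode_box \<Psi> Zs N)" "compact (target N)"
  unfolding mode_box_def by (intro compact_PiE_lessThan compact_mode_set)+

lemma compact_S_N: "compact (domain N)"
  unfolding S_N_def Sigma_N_def by (intro compact_Times compact_mode_box U) auto

lemma mode_box_subset: "mode_box \<Psi> X N \<subseteq> mode_space N"
  by (auto simp: mode_box_def)

lemma S_N_subset: "domain N \<subseteq> (UNIV \<times> mode_space N) \<times> UNIV"
  using mode_box_subset by (auto simp: S_N_def Sigma_N_def)

lemma continuous_on_cost_integrand:
  "continuous_on (domain N) (\<lambda>p. case p of ((t, z), u) \<Rightarrow> h t u)"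
proof -
  have "continuous_on (domain N) (\<lambda>p. case (fst (fst p), snd p) of (t, u) \<Rightarrow> h t u)"
    by (rule continuous_on_compose2[OF h]) (auto simp: S_N_def Sigma_N_def intro!: continuous_intros)
  then show ?thesis by (simp add: split_def)
qed

lemma continuous_on_liouville_S_N:
  "g \<in> C1_functions N \<Longrightarrow> continuous_on (domain N) (\<L> N g)"
  using continuous_on_liouville[OF B] S_N_subset by (rule continuous_on_subset)

lemma continuous_on_terminal:
  "g \<in> C1_functions N \<Longrightarrow> continuous_on (target N) (\<lambda>z. g (T, z))"
  by (rule continuous_on_compose2[OF C1_functionsD(1)])
    (use mode_box_subset in \<open>auto intro!: continuous_intros\<close>)

lemma borel_measure_integrable:
  fixes f :: "'b::metric_space \<Rightarrow> real"
  assumes "\<mu> \<in> borel_measures_on K" "compact K" "continuous_on K f"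
  shows "integrable \<mu> f"
proof -
  have s: "sets \<mu> = sets (restrict_space borel K)" and "finite_measure \<mu>"
    using assms(1) by (auto simp: borel_measures_on_def)
  then interpret finite_measure \<mu> by simp
  have sp: "space \<mu> = K" using sets_eq_imp_space_eq[OF s] by (simp add: space_restrict_space)
  obtain b where "\<forall>x\<in>K. \<bar>f x\<bar> \<le> b" using compact_continuous_bounded[OF assms(3,2)] by blast
  moreover have "f \<in> borel_measurable \<mu>"
    using borel_measurable_continuous_on_restrict[OF assms(3)] measurable_cong_sets[OF s refl] by blast
  ultimately show ?thesis
    by (intro integrable_const_bound[of _ b]) (auto simp: sp intro!: AE_I2)
qed

lemma space_borel_measures_on: "\<mu> \<in> borel_measures_on K \<Longrightarrow> space \<mu> = K"
  using sets_eq_imp_space_eq[of \<mu> "restrict_space borel K"]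
  by (auto simp: borel_measures_on_def space_restrict_space)

lemma mode_field_bounded: "\<exists>c. \<forall>x u. \<bar>x\<bar> \<le> r \<longrightarrow> u \<in> U \<longrightarrow> \<bar>mode_field lam B \<Psi> k x u\<bar> \<le> c"
proof -
  obtain b where b: "\<forall>u\<in>U. \<bar>mode_input B \<Psi> k u\<bar> \<le> b"
    using compact_continuous_bounded[OF continuous_on_mode_input[OF B] U] by blast
  have "\<bar>mode_field lam B \<Psi> k x u\<bar> \<le> \<bar>lam k\<bar> * r + b" if "\<bar>x\<bar> \<le> r" "u \<in> U" for x u
  proof -
    have "\<bar>lam k * x\<bar> \<le> \<bar>lam k\<bar> * r" unfolding abs_mult using that by (intro mult_left_mono) auto
    then show ?thesis using bspec[OF b that(2)] unfolding mode_field_def by linarith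
  qed
  then show ?thesis by blast
qed

text \<open>Brings the implicit integral equation into the form required by
  \<open>C1_functions_integral_along_curve\<close>: each coordinate is a primitive of a bounded
  measurable function. Continuity of the coordinates comes from the integral form and then yields
  the bound on the field.\<close>

lemma mode_trajectory_facts:
  assumes u: "u \<in> controls U T" and z: "mode_trajectory lam B \<Psi> N T z0 u z"
  shows "k < N \<Longrightarrow> continuous_on {0..T} (z k)"
    and "k < N \<Longrightarrow> (\<lambda>t. mode_field lam B \<Psi> k (z k t) (u t)) \<in> borel_measurable (lebesgue_on {0..T})"
    and "\<exists>C. \<forall>k<N. \<forall>t\<in>{0..T}. \<bar>mode_field lam B \<Psi> k (z k t) (u t)\<bar> \<le> C"
    and "k < N \<Longrightarrow> t \<in> {0..T} \<Longrightarrow>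
      z k t = mode \<Psi> z0 k + integral {0..t} (\<lambda>t. mode_field lam B \<Psi> k (z k t) (u t))"
proof -
  define w where "w = (\<lambda>k t. mode_field lam B \<Psi> k (z k t) (u t))"
  have int: "(w k has_integral (z k t - mode \<Psi> z0 k)) {0..t}" if "k < N" "t \<in> {0..T}" for k t
    using z that by (auto simp: mode_trajectory_def w_def)
  show eq: "z k t = mode \<Psi> z0 k + integral {0..t} (\<lambda>t. mode_field lam B \<Psi> k (z k t) (u t))"
    if "k < N" "t \<in> {0..T}" for k t
    using integral_unique[OF int[OF that]] by (simp add: w_def)
  show cont: "continuous_on {0..T} (z k)" if "k < N" for k
  proof (rule continuous_on_eq)
    have "w k integrable_on {0..T}" using int[OF that, of T] T by (auto simp: integrable_on_def)
    then show "continuous_on {0..T} (\<lambda>t. mode \<Psi> z0 k + integral {0..t} (w k))"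
      by (intro continuous_intros indefinite_integral_continuous_1)
  qed (use eq[OF that] in \<open>simp add: w_def\<close>)
  have um: "u \<in> borel_measurable (lebesgue_on {0..T})" and uU: "\<And>t. t \<in> {0..T} \<Longrightarrow> u t \<in> U"
    using u by (auto simp: controls_def)
  have inp: "(\<lambda>t. mode_input B \<Psi> k (u t)) \<in> borel_measurable (lebesgue_on {0..T})" for k
    using um continuous_on_mode_input[OF B] by (rule borel_measurable_continuous_on[rotated])
  show "(\<lambda>t. mode_field lam B \<Psi> k (z k t) (u t)) \<in> borel_measurable (lebesgue_on {0..T})"
    if "k < N" for k
  proof -
    have "z k \<in> borel_measurable (lebesgue_on {0..T})"
      by (rule continuous_imp_measurable_on_sets_lebesgue[OF cont[OF that]]) simp
    then show ?thesis unfolding mode_field_def using inp by (intro borel_measurable_add borel_measurable_times) auto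
  qed
  have "\<exists>C. \<forall>t\<in>{0..T}. \<bar>mode_field lam B \<Psi> k (z k t) (u t)\<bar> \<le> C" if k: "k < N" for k
  proof -
    obtain r where "\<forall>t\<in>{0..T}. \<bar>z k t\<bar> \<le> r"
      using compact_continuous_bounded[OF cont[OF k]] by auto
    then show ?thesis using mode_field_bounded[of r k] uU by meson
  qed
  then obtain C where C: "\<And>k t. k < N \<Longrightarrow> t \<in> {0..T} \<Longrightarrow> \<bar>mode_field lam B \<Psi> k (z k t) (u t)\<bar> \<le> C k"
    by metis
  have "\<bar>mode_field lam B \<Psi> k (z k t) (u t)\<bar> \<le> (\<Sum>k<N. \<bar>C k\<bar>)" if "k < N" "t \<in> {0..T}" for k t
  proof -
    have "\<bar>C k\<bar> \<le> (\<Sum>k<N. \<bar>C k\<bar>)" using that by (intro member_le_sum) auto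
    then show ?thesis using C[OF that] by linarith
  qed
  then show "\<exists>C. \<forall>k<N. \<forall>t\<in>{0..T}. \<bar>mode_field lam B \<Psi> k (z k t) (u t)\<bar> \<le> C" by blast
qed

theorem occupation_measure_feasible:
  assumes "u \<in> mode_controls N"
  shows "\<exists>(\<mu>, \<mu>T)\<in>primal N. lp_cost h \<mu> = cost h T u"
proof -
  obtain z where u: "u \<in> controls U T" and z: "mode_trajectory lam B \<Psi> N T z0 u z"
    and AE: "AE t in lebesgue_on {0..T}. (\<forall>k<N. z k t \<in> mode_set \<Psi> Zs k) \<and> u t \<in> U"
    and zT: "\<And>k. k < N \<Longrightarrow> z k T \<in> mode_set \<Psi> ZT k"
    using assms by (auto simp: admissible_mode_controls_def)
  note tr = mode_trajectory_facts[OF u z]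
  have um: "u \<in> borel_measurable (lebesgue_on {0..T})" and uU: "\<And>t. t \<in> {0..T} \<Longrightarrow> u t \<in> U"
    using u by (auto simp: controls_def)
  \<comment> \<open>Admissibility imposes the state constraint almost everywhere, but the curve has
    to map every time into the domain for its image measure to live there.\<close>
  have zZ: "z k t \<in> mode_set \<Psi> Zs k" if "k < N" "t \<in> {0..T}" for k t
  proof (rule continuous_AE_mem_closed[OF tr(1)[OF that(1)] _ T _ that(2)])
    show "closed (mode_set \<Psi> Zs k)" using compact_mode_set(1) by (rule compact_imp_closed)
    show "AE t in lebesgue_on {0..T}. z k t \<in> mode_set \<Psi> Zs k"
      using AE by eventually_elim (use that in auto)
  qed
  define Z where "Z = (\<lambda>t. \<lambda>k\<in>{..<N}. z k t)"
  have Zc: "continuous_on {0..T} (\<lambda>t. (t, Z t))"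
    unfolding Z_def by (intro continuous_intros continuous_on_restrict_lessThan tr(1))
  define P where "P = (\<lambda>t. ((t, Z t), u t))"
  have PS: "P t \<in> domain N" if "t \<in> {0..T}" for t
    using zZ uU that by (auto simp: P_def Z_def S_N_def Sigma_N_def mode_box_def)
  have Pm: "P \<in> lebesgue_on {0..T} \<rightarrow>\<^sub>M restrict_space borel (domain N)"
  proof (rule measurable_restrict_space2)
    show "P \<in> space (lebesgue_on {0..T}) \<rightarrow> domain N" using PS by auto
    show "P \<in> borel_measurable (lebesgue_on {0..T})"
      unfolding P_def
      by (rule borel_measurable_Pair[OF continuous_imp_measurable_on_sets_lebesgue[OF Zc] um]) simp
  qed
  interpret finite_measure "lebesgue_on {0..T}" by (rule finite_measure_lebesgue_on_interval)
  define \<mu> where "\<mu> = distr (lebesgue_on {0..T}) (restrict_space borel (domain N)) P"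
  have \<mu>: "\<mu> \<in> borel_measures_on (domain N)"
    unfolding borel_measures_on_def \<mu>_def using finite_measure_distr[OF Pm] by simp
  have \<mu>_int: "(LINT p|\<mu>. f p) = (LINT t|lebesgue_on {0..T}. f (P t))"
    if "continuous_on (domain N) f" for f :: "_ \<Rightarrow> real"
    unfolding \<mu>_def by (rule integral_distr[OF Pm borel_measurable_continuous_on_restrict[OF that]])
  have ZTb: "Z T \<in> target N" using zT by (auto simp: Z_def mode_box_def)
  \<comment> \<open>The Dirac measure at the terminal state, written as an image of a one-point
    space.\<close>
  define \<mu>T where "\<mu>T = distr (count_space {()}) (restrict_space borel (target N)) (\<lambda>_. Z T)"
  have cm: "(\<lambda>_. Z T) \<in> count_space {()} \<rightarrow>\<^sub>M restrict_space borel (target N)"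
    using ZTb by (simp add: space_restrict_space)
  have \<mu>T: "\<mu>T \<in> borel_measures_on (target N)"
    unfolding borel_measures_on_def \<mu>T_def
    using finite_measure.finite_measure_distr[OF _ cm] by (simp add: finite_measure_count_space)
  have \<mu>T_int: "(LINT p|\<mu>T. f p) = f (Z T)" if "continuous_on (target N) f" for f :: "_ \<Rightarrow> real"
    unfolding \<mu>T_def
    by (subst integral_distr[OF cm borel_measurable_continuous_on_restrict[OF that]])
      (simp add: lebesgue_integral_count_space_finite)
  have "(\<mu>, \<mu>T) \<in> primal N"
    unfolding lp_feasible_def
  proof (clarsimp simp: \<mu> \<mu>T)
    fix g assume g: "g \<in> C1_functions N"
    obtain C where C: "\<forall>k<N. \<forall>t\<in>{0..T}. \<bar>mode_field lam B \<Psi> k (z k t) (u t)\<bar> \<le> C"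
      using tr(3) by blast
    have Z0: "Z 0 = mode_point \<Psi> N z0"
      using tr(4)[of _ 0] T by (auto simp: Z_def mode_point_def)
    have "(LINT p|\<mu>. \<L> N g p) =
        (LINT t|lebesgue_on {0..T}. \<L> N g (P t))"
      by (rule \<mu>_int[OF continuous_on_liouville_S_N[OF g]])
    also have "\<dots> = (LINT t|lebesgue_on {0..T}. partial_t g (t, Z t) +
        (\<Sum>k<N. mode_field lam B \<Psi> k (z k t) (u t) * partial_z k g (t, Z t)))"
      by (intro Bochner_Integration.integral_cong refl) (simp add: liouville_def P_def Z_def)
    also have "\<dots> = g (T, Z T) - g (0, Z 0)"
      unfolding Z_def by (rule C1_functions_integral_along_curve[OF g T tr(2) _ tr(4), where C = C]) (use C in auto)
    finally show "(LINT z|\<mu>T. g (T, z)) - g (0, mode_point \<Psi> N z0) = (LINT p|\<mu>. \<L> N g p)"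
      using \<mu>T_int[OF continuous_on_terminal[OF g]] by (simp add: Z0)
  qed
  moreover have "lp_cost h \<mu> = cost h T u"
    unfolding lp_cost_def cost_def \<mu>_int[OF continuous_on_cost_integrand] by (simp add: P_def)
  ultimately show ?thesis by blast
qed

lemma lp_value_le_optimal_cost:
  "primal_value N \<le> optimal_cost h T (mode_controls N)"
  unfolding optimal_cost_def
proof (rule INF_greatest)
  fix u assume "u \<in> mode_controls N"
  then obtain \<mu> \<mu>T where *: "(\<mu>, \<mu>T) \<in> primal N" "lp_cost h \<mu> = cost h T u"
    using occupation_measure_feasible by blast
  show "primal_value N \<le> ereal (cost h T u)"
    unfolding lp_value_def *(2)[symmetric] by (rule INF_lower2[OF *(1)]) simp
qed

end

section \<open>Modes of the semigroup\<close>

text \<open>The case of one coordinate and the test function \<phi>(t) z_0 in the theorem on curves.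
  It is needed both to pass from mild solutions to mode trajectories and to compare averaged states
  with solutions.\<close>

lemma integral_by_parts_indefinite:
  assumes \<phi>: "\<And>t. (\<phi> has_real_derivative \<phi>' t) (at t)" and \<phi>': "continuous_on UNIV \<phi>'"
    and T: "T > 0" and w: "w \<in> borel_measurable (lebesgue_on {0..T})"
    and C: "\<And>t. t \<in> {0..T} \<Longrightarrow> \<bar>w t\<bar> \<le> C"
    and y: "\<And>t. t \<in> {0..T} \<Longrightarrow> y t = c + integral {0..t} w"
  shows "integrable (lebesgue_on {0..T}) (\<lambda>t. \<phi>' t * y t + \<phi> t * w t)"
    and "(LINT t|lebesgue_on {0..T}. \<phi>' t * y t + \<phi> t * w t) = \<phi> T * y T - \<phi> 0 * c"
proof -
  define Z where "Z = (\<lambda>t. \<lambda>k\<in>{..<1::nat}. y t)"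
  have Z: "Z t \<in> mode_space 1" for t by (simp add: Z_def)
  note time = partial_t_time_coord[OF \<phi> \<phi>' Z, of 0] partial_z_time_coord[OF \<phi> \<phi>' Z, of 0]
  have "(LINT t|lebesgue_on {0..T}. partial_t (\<lambda>(t, z). \<phi> t * z 0) (t, Z t) +
      (\<Sum>k<1. w t * partial_z k (\<lambda>(t, z). \<phi> t * z 0) (t, Z t))) =
      (case (T, Z T) of (t, z) \<Rightarrow> \<phi> t * z 0) - (case (0, Z 0) of (t, z) \<Rightarrow> \<phi> t * z 0)"
    unfolding Z_def
    by (rule C1_functions_integral_along_curve[OF C1_functions_time_coord[OF \<phi> \<phi>'] T w C y]) auto
  then show "(LINT t|lebesgue_on {0..T}. \<phi>' t * y t + \<phi> t * w t) = \<phi> T * y T - \<phi> 0 * c"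
    using y[of 0] T by (simp add: time) (simp add: Z_def algebra_simps)
  have \<phi>c: "continuous_on {0..T} \<phi>"
    using \<phi> DERIV_continuous_on[of "{0..T}" \<phi> \<phi>'] has_field_derivative_at_within by blast
  have wint: "integrable (lebesgue_on {0..T}) w" "w integrable_on {0..T}"
    using bounded_measurable_integrable[OF w C] by auto
  have yc: "continuous_on {0..T} y"
  proof (rule continuous_on_eq)
    show "continuous_on {0..T} (\<lambda>t. c + integral {0..t} w)"
      by (intro continuous_intros indefinite_integral_continuous_1 wint)
  qed (use y in simp)
  have m: "(\<lambda>t. \<phi>' t * y t) \<in> borel_measurable (lebesgue_on {0..T})"
    "\<phi> \<in> borel_measurable (lebesgue_on {0..T})"
    by (intro continuous_imp_measurable_on_sets_lebesgue continuous_intros yc \<phi>c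
        continuous_on_subset[OF \<phi>']; simp)+
  have "continuous_on {0..T} (\<lambda>t. \<phi>' t * y t)"
    by (intro continuous_intros yc continuous_on_subset[OF \<phi>']) auto
  then obtain b1 where b1: "\<forall>t\<in>{0..T}. \<bar>\<phi>' t * y t\<bar> \<le> b1"
    using compact_continuous_bounded by blast
  obtain b2 where b2: "\<forall>t\<in>{0..T}. \<bar>\<phi> t\<bar> \<le> b2"
    using compact_continuous_bounded[OF \<phi>c] by blast
  show "integrable (lebesgue_on {0..T}) (\<lambda>t. \<phi>' t * y t + \<phi> t * w t)"
  proof (rule bounded_measurable_integrable(1))
    show "(\<lambda>t. \<phi>' t * y t + \<phi> t * w t) \<in> borel_measurable (lebesgue_on {0..T})"
      by (intro borel_measurable_add borel_measurable_times m w)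
    fix t assume t: "t \<in> {0..T}"
    have "\<bar>\<phi> t * w t\<bar> \<le> b2 * C"
      unfolding abs_mult using bspec[OF b2 t] C[OF t] by (intro mult_mono) auto
    then show "\<bar>\<phi>' t * y t + \<phi> t * w t\<bar> \<le> b1 + b2 * C" using bspec[OF b1 t] by linarith
  qed
qed

lemma one_dimensional_eq_span:
  fixes E :: "'a::real_vector set"
  assumes "dim E = 1" "x \<in> E" "x \<noteq> 0" "y \<in> E"
  shows "\<exists>c. y = c *\<^sub>R x"
proof -
  obtain b where b: "E \<subseteq> span {b}"
    using basis_exists[of E] assms(1) by (metis card_1_singletonE)
  then have "x \<in> range (\<lambda>k. k *\<^sub>R b)" "y \<in> range (\<lambda>k. k *\<^sub>R b)"
    using assms(2,4) by (auto simp: span_singleton)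
  then obtain p q where p: "x = p *\<^sub>R b" and q: "y = q *\<^sub>R b" by blast
  then have "p \<noteq> 0" using assms(3) by auto
  then show ?thesis using p q by (intro exI[of _ "q / p"]) simp
qed

text \<open>Used with n a tending to 0, where the bound tends to 0 as well.\<close>

lemma abs_power_minus_one_le:
  fixes a :: real
  shows "\<bar>(1 + a) ^ n - 1\<bar> \<le> exp (real n * \<bar>a\<bar>) - 1"
proof -
  have "\<bar>(1 + a) ^ n - 1\<bar> \<le> (1 + \<bar>a\<bar>) ^ n - 1"
  proof (induction n)
    case (Suc n)
    have "\<bar>(1 + a) ^ Suc n - 1\<bar> = \<bar>(1 + a) * ((1 + a) ^ n - 1) + a\<bar>" by (simp add: algebra_simps)
    also have "\<dots> \<le> \<bar>1 + a\<bar> * \<bar>(1 + a) ^ n - 1\<bar> + \<bar>a\<bar>" by (metis abs_mult abs_triangle_ineq)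
    also have "\<dots> \<le> (1 + \<bar>a\<bar>) * ((1 + \<bar>a\<bar>) ^ n - 1) + \<bar>a\<bar>"
      using Suc by (intro add_mono mult_mono) auto
    finally show ?case by (simp add: algebra_simps)
  qed simp
  also have "(1 + \<bar>a\<bar>) ^ n \<le> exp \<bar>a\<bar> ^ n" by (intro power_mono) auto
  also have "\<dots> = exp (real n * \<bar>a\<bar>)" by (simp add: exp_of_nat_mult)
  finally show ?thesis by simp
qed

text \<open>Division by exp (\<mu> t) leaves a multiplicative function d whose right derivative at 0
  vanishes. Then d t = d (t/n)^n is the n-th power of 1 + o(1/n), hence equals 1. Only values at the
  small times t/n and the limit from the right enter.\<close>

lemma multiplicative_right_derivative_exp:
  fixes c :: "real \<Rightarrow> real"
  assumes mult: "\<And>s t. s \<ge> 0 \<Longrightarrow> t \<ge> 0 \<Longrightarrow> c (s + t) = c s * c t"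
    and c0: "c 0 = 1"
    and der: "((\<lambda>s. (c s - 1) / s) \<longlongrightarrow> \<mu>) (at_right 0)"
    and t: "t \<ge> 0"
  shows "c t = exp (\<mu> * t)"
proof (cases "t = 0")
  case False
  with t have t: "t > 0" by simp
  define d where "d = (\<lambda>s. exp (- \<mu> * s) * c s)"
  have dmult: "d (s + r) = d s * d r" if "s \<ge> 0" "r \<ge> 0" for s r
    using mult[OF that] by (simp add: d_def exp_add[symmetric] algebra_simps)
  have d0: "((\<lambda>s. (d s - 1) / s) \<longlongrightarrow> 0) (at_right 0)"
  proof -
    have "((\<lambda>s. exp (- \<mu> * s)) has_real_derivative - \<mu>) (at 0)"
      by (auto intro!: derivative_eq_intros)
    then have e: "((\<lambda>s. (exp (- \<mu> * s) - 1) / s) \<longlongrightarrow> - \<mu>) (at_right 0)"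
      by (auto simp: has_field_derivative_iff intro: filterlim_mono[OF _ order_refl] at_le)
    have "((\<lambda>s. exp (- \<mu> * s) * ((c s - 1) / s) + (exp (- \<mu> * s) - 1) / s)
        \<longlongrightarrow> exp (- \<mu> * 0) * \<mu> + - \<mu>) (at_right 0)"
      by (intro tendsto_intros der e)
    moreover have "exp (- \<mu> * s) * ((c s - 1) / s) + (exp (- \<mu> * s) - 1) / s = (d s - 1) / s" for s
      by (simp add: d_def field_simps diff_divide_distrib add_divide_distrib[symmetric])
    ultimately show ?thesis by simp
  qed
  have dpow: "d (real n * r) = d r ^ n" if "r \<ge> 0" for n r
  proof (induction n)
    case (Suc n)
    then show ?case using dmult[of r "real n * r"] that by (simp add: algebra_simps)
  qed (simp add: d_def c0)
  define a where "a = (\<lambda>n. d (t / real (Suc n)) - 1)"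
  have lim: "(\<lambda>n. real (Suc n) * a n) \<longlonglongrightarrow> 0"
  proof -
    have "filterlim (\<lambda>n. t / real (Suc n)) (at_right 0) sequentially"
      unfolding filterlim_at
    proof
      show "\<forall>\<^sub>F n in sequentially. t / real (Suc n) \<in> {0<..} \<and> t / real (Suc n) \<noteq> 0"
        using t by simp
      show "(\<lambda>n. t / real (Suc n)) \<longlonglongrightarrow> 0"
        using tendsto_mult[OF tendsto_const[of t] LIMSEQ_Suc[OF lim_1_over_n]] by simp
    qed
    then have "(\<lambda>n. (d (t / real (Suc n)) - 1) / (t / real (Suc n))) \<longlonglongrightarrow> 0"
      by (rule filterlim_compose[OF d0])
    then have "(\<lambda>n. t * ((d (t / real (Suc n)) - 1) / (t / real (Suc n)))) \<longlonglongrightarrow> t * 0"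
      by (intro tendsto_intros)
    then show ?thesis using t by (simp add: a_def mult.commute)
  qed
  have "\<bar>d t - 1\<bar> \<le> exp (\<bar>real (Suc n) * a n\<bar>) - 1" for n
  proof -
    have "d t = (1 + a n) ^ Suc n"
      using dpow[of "t / real (Suc n)" "Suc n"] t by (simp add: a_def del: power_Suc)
    then show ?thesis using abs_power_minus_one_le[of "a n" "Suc n"] by (simp add: abs_mult del: power_Suc)
  qed
  moreover have "(\<lambda>n. exp (\<bar>real (Suc n) * a n\<bar>) - 1) \<longlonglongrightarrow> exp \<bar>0\<bar> - 1"
    by (intro tendsto_intros lim)
  ultimately have "\<bar>d t - 1\<bar> \<le> exp \<bar>0\<bar> - 1"
    by (intro LIMSEQ_le_const) auto
  then have "exp (- \<mu> * t) * c t = 1" by (simp add: d_def)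
  then have "exp (\<mu> * t) * (exp (- \<mu> * t) * c t) = exp (\<mu> * t)" by simp
  then show ?thesis by (simp add: mult.assoc[symmetric] exp_add[symmetric])
qed (simp add: c0)

text \<open>Since the eigenspace is one-dimensional and invariant, the semigroup acts on it by a
  multiplicative scalar function with right derivative \<open>\<mu>\<close> at \<open>0\<close>. This avoids the uniform
  boundedness principle, which continuity of the orbits from the left would require.\<close>

lemma semigroup_eigenvector:
  fixes x :: "'a::real_inner"
  assumes S: "C0_semigroup S" and gen: "infinitesimal_generator S D A"
    and simple: "simple_eigenvalue D A \<mu>" and eig: "eigenvector D A \<mu> x" and t: "t \<ge> 0"
  shows "S t x = exp (\<mu> * t) *\<^sub>R x"
proof -
  have bl: "bounded_linear (S t)" if "t \<ge> 0" for t using S that by (auto simp: C0_semigroup_def)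
  have S0: "S 0 y = y" for y using S by (simp add: C0_semigroup_def)
  have Sadd: "S (s + t) y = S s (S t y)" if "s \<ge> 0" "t \<ge> 0" for s t y
    using S that by (simp add: C0_semigroup_def)
  have D: "D = {x. \<exists>y. ((\<lambda>t. (S t x - x) /\<^sub>R t) \<longlongrightarrow> y) (at_right 0)}"
    and lim: "\<And>y. y \<in> D \<Longrightarrow> ((\<lambda>t. (S t y - y) /\<^sub>R t) \<longlongrightarrow> A y) (at_right 0)"
    using gen by (auto simp: infinitesimal_generator_def)
  have x: "x \<in> D" "x \<noteq> 0" "A x = \<mu> *\<^sub>R x" using eig by (auto simp: eigenvector_def)
  \<comment> \<open>S t is continuous and commutes with the difference quotients at 0, so it keeps x
    in D and in the same eigenspace.\<close>
  have inv: "S t x \<in> D" "A (S t x) = \<mu> *\<^sub>R S t x" if t: "t \<ge> 0" for t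
  proof -
    interpret St: bounded_linear "S t" by (rule bl[OF t])
    have "((\<lambda>s. S t ((S s x - x) /\<^sub>R s)) \<longlongrightarrow> S t (A x)) (at_right 0)"
      by (intro St.tendsto lim x)
    moreover have "\<forall>\<^sub>F s in at_right 0. S t ((S s x - x) /\<^sub>R s) = (S s (S t x) - S t x) /\<^sub>R s"
    proof (rule eventually_at_right_less[THEN eventually_mono])
      fix s :: real assume "0 < s"
      then show "S t ((S s x - x) /\<^sub>R s) = (S s (S t x) - S t x) /\<^sub>R s"
        using Sadd[of s t x] Sadd[of t s x] t
        by (simp add: St.scaleR St.diff add.commute)
    qed
    ultimately have *: "((\<lambda>s. (S s (S t x) - S t x) /\<^sub>R s) \<longlongrightarrow> S t (A x)) (at_right 0)"
      by (rule Lim_transform_eventually)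
    then show "S t x \<in> D" by (auto simp: D)
    from tendsto_unique[OF _ lim[OF this] *] show "A (S t x) = \<mu> *\<^sub>R S t x"
      by (simp add: x St.scaleR trivial_limit_at_right_real)
  qed
  have "\<exists>c. S t x = c *\<^sub>R x" if "t \<ge> 0" for t
    using one_dimensional_eq_span[of "{y \<in> D. A y = \<mu> *\<^sub>R y}" x "S t x"] simple x inv[OF that]
    by (auto simp: simple_eigenvalue_def)
  then obtain c where c: "\<And>t. t \<ge> 0 \<Longrightarrow> S t x = c t *\<^sub>R x" by metis
  have "c t = exp (\<mu> * t)"
  proof (rule multiplicative_right_derivative_exp[OF _ _ _ t])
    have "c 0 *\<^sub>R x = 1 *\<^sub>R x" using c[of 0] S0[of x] by simp
    then show "c 0 = 1" using x(2) unfolding scaleR_cancel_right by blast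
    show "c (s + t) = c s * c t" if "s \<ge> 0" "t \<ge> 0" for s t
    proof -
      interpret Ss: bounded_linear "S s" by (rule bl[OF that(1)])
      have "c (s + t) *\<^sub>R x = (c s * c t) *\<^sub>R x"
        using Sadd[OF that, of x] c that by (simp add: Ss.scaleR mult.commute)
      then show ?thesis using x(2) by simp
    qed
    \<comment> \<open>Taking the inner product with x, normalised by its square norm, turns the
      vector limit into the right derivative of the scalar c.\<close>
    have "((\<lambda>s. inner ((S s x - x) /\<^sub>R s) x / inner x x) \<longlongrightarrow> inner (\<mu> *\<^sub>R x) x / inner x x) (at_right 0)"
      using tendsto_divide[OF tendsto_inner[OF lim[OF x(1)] tendsto_const[of x]] tendsto_const[of "inner x x"]] x
      by simp
    moreover have "\<forall>\<^sub>F s in at_right 0. inner ((S s x - x) /\<^sub>R s) x / inner x x = (c s - 1) / s"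
    proof (rule eventually_at_right_less[THEN eventually_mono])
      fix s :: real assume s: "0 < s"
      have "S s x - x = (c s - 1) *\<^sub>R x" using c[of s] s by (simp add: algebra_simps)
      then show "inner ((S s x - x) /\<^sub>R s) x / inner x x = (c s - 1) / s"
        using x(2) by (simp only: inner_scaleR_left) (simp add: divide_inverse)
    qed
    ultimately have "((\<lambda>s. (c s - 1) / s) \<longlongrightarrow> inner (\<mu> *\<^sub>R x) x / inner x x) (at_right 0)"
      by (rule Lim_transform_eventually)
    then show "((\<lambda>s. (c s - 1) / s) \<longlongrightarrow> \<mu>) (at_right 0)" using x(2) by simp
  qed
  then show ?thesis using c[OF t] by simp
qed

text \<open>Both sides are continuous and linear in x and, by biorthogonality, agree on every \<Phi>
  j; the span of these is dense. In this way the action on modes is found without an adjoint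
  semigroup.\<close>

lemma semigroup_mode:
  fixes \<Phi> \<Psi> :: "nat \<Rightarrow> 'a::{real_inner, banach}"
  assumes A: "riesz_spectral D A lam \<Phi>" and Psi: "dual_eigenvectors D A \<Phi> \<Psi>"
    and S: "C0_semigroup S" "infinitesimal_generator S D A" and t: "t \<ge> 0"
  shows "inner (S t x) (\<Psi> k) = exp (lam k * t) * inner x (\<Psi> k)"
proof -
  interpret St: bounded_linear "S t" using S(1) t by (auto simp: C0_semigroup_def)
  define W where "W = {x. inner (S t x) (\<Psi> k) = exp (lam k * t) * inner x (\<Psi> k)}"
  have "S t (\<Phi> j) = exp (lam j * t) *\<^sub>R \<Phi> j" for j
    using A t by (intro semigroup_eigenvector[OF S]) (auto simp: riesz_spectral_def)
  then have "range \<Phi> \<subseteq> W" using Psi by (auto simp: W_def dual_eigenvectors_def)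
  moreover have "subspace W"
    by (auto simp: subspace_def W_def St.zero St.add St.scaleR inner_add_left algebra_simps)
  ultimately have "span (range \<Phi>) \<subseteq> W" by (rule span_minimal)
  moreover have "closed W"
    unfolding W_def by (intro closed_Collect_eq continuous_intros St.continuous_on)
  ultimately have "closure (span (range \<Phi>)) \<subseteq> W" by (rule closure_minimal)
  moreover have "closure (span (range \<Phi>)) = UNIV"
    using A by (auto simp: riesz_spectral_def riesz_basis_def)
  ultimately show ?thesis by (auto simp: W_def)
qed

text \<open>In the k-th mode the mild formula is a convolution with exp (lam k (t - s)), whose
  kernel depends on the end point t. Multiplication by exp (- lam k t) removes this dependence, so y
  is an indefinite integral of w; integration by parts against exp (lam k t) then returns the state
  equation in integral form.\<close>

lemma admissible_imp_mode_admissible: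
  fixes \<Phi> \<Psi> :: "nat \<Rightarrow> 'a::{real_inner, banach}" and B :: "real^'m \<Rightarrow> 'a"
  assumes A: "riesz_spectral D A lam \<Phi>" and Psi: "dual_eigenvectors D A \<Phi> \<Psi>"
    and S: "C0_semigroup S" "infinitesimal_generator S D A"
    and B: "bounded_linear B" and U: "compact U" and T: "T > 0"
    and u: "u \<in> admissible_controls S B U Zs ZT T z0"
  shows "u \<in> admissible_mode_controls lam B \<Psi> U Zs ZT N T z0"
proof -
  obtain z where uc: "u \<in> controls U T" and z: "mild_solution S B T z0 u z"
    and AE: "AE t in lebesgue_on {0..T}. z t \<in> Zs \<and> u t \<in> U" and zT: "z T \<in> ZT"
    using u by (auto simp: admissible_controls_def)
  have um: "u \<in> borel_measurable (lebesgue_on {0..T})" and uU: "\<And>t. t \<in> {0..T} \<Longrightarrow> u t \<in> U"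
    using uc by (auto simp: controls_def)
  define b where "b = (\<lambda>k t. mode_input B \<Psi> k (u t))"
  define y where "y = (\<lambda>k t. exp (- lam k * t) * mode \<Psi> (z t) k)"
  define w where "w = (\<lambda>k t. exp (- lam k * t) * b k t)"
  have bm: "b k \<in> borel_measurable (lebesgue_on {0..T})" for k
    unfolding b_def using um continuous_on_mode_input[OF B] by (rule borel_measurable_continuous_on[rotated])
  have wm: "w k \<in> borel_measurable (lebesgue_on {0..T})" for k
    unfolding w_def
    by (intro borel_measurable_times bm continuous_imp_measurable_on_sets_lebesgue continuous_intros) auto
  have "\<exists>C. \<forall>t\<in>{0..T}. \<bar>w k t\<bar> \<le> C" for k
  proof -
    obtain b2 where b2: "\<forall>v\<in>U. \<bar>mode_input B \<Psi> k v\<bar> \<le> b2"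
      using compact_continuous_bounded[OF continuous_on_mode_input[OF B] U] by blast
    have "continuous_on {0..T} (\<lambda>t. exp (- lam k * t))" by (intro continuous_intros)
    then obtain b1 where b1: "\<forall>t\<in>{0..T}. \<bar>exp (- lam k * t)\<bar> \<le> b1"
      using compact_continuous_bounded by blast
    have "\<bar>w k t\<bar> \<le> b1 * b2" if "t \<in> {0..T}" for t
    proof -
      have le: "\<bar>exp (- lam k * t)\<bar> \<le> b1" "\<bar>b k t\<bar> \<le> b2" using b1 b2 uU that by (auto simp: b_def)
      then have "0 \<le> b1" by linarith
      then show ?thesis unfolding w_def abs_mult using le by (intro mult_mono) auto
    qed
    then show ?thesis by blast
  qed
  then obtain C where C: "\<And>k t. t \<in> {0..T} \<Longrightarrow> \<bar>w k t\<bar> \<le> C k" by metis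
  have y: "y k t = mode \<Psi> z0 k + integral {0..t} (w k)" if t: "t \<in> {0..T}" for k t
  proof -
    have "((\<lambda>s. S (t - s) (B (u s))) has_integral (z t - S t z0)) {0..t}"
      using z t by (auto simp: mild_solution_def)
    from has_integral_linear[OF this bounded_linear_inner_left[of "\<Psi> k"]]
    have "((\<lambda>s. inner (S (t - s) (B (u s))) (\<Psi> k)) has_integral
        (inner (z t) (\<Psi> k) - exp (lam k * t) * inner z0 (\<Psi> k))) {0..t}"
      using semigroup_mode[OF A Psi S, of t z0 k] t by (simp add: o_def inner_diff_left)
    then have "((\<lambda>s. exp (lam k * (t - s)) * b k s) has_integral
        (inner (z t) (\<Psi> k) - exp (lam k * t) * inner z0 (\<Psi> k))) {0..t}"
    proof (rule has_integral_eq[rotated])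
      fix s assume "s \<in> {0..t}"
      then show "inner (S (t - s) (B (u s))) (\<Psi> k) = exp (lam k * (t - s)) * b k s"
        using semigroup_mode[OF A Psi S, of "t - s" "B (u s)" k] by (simp add: b_def mode_input_eq[OF B])
    qed
    from has_integral_mult_right[OF this, of "exp (- lam k * t)"]
    have "((\<lambda>s. exp (- lam k * t) * (exp (lam k * (t - s)) * b k s)) has_integral
        (exp (- lam k * t) * (inner (z t) (\<Psi> k) - exp (lam k * t) * inner z0 (\<Psi> k)))) {0..t}" .
    moreover have "exp (- lam k * t) * (exp (lam k * (t - s)) * b k s) = w k s" for s
      by (simp add: w_def mult.assoc[symmetric] exp_add[symmetric] algebra_simps)
    moreover have "exp (- lam k * t) * (inner (z t) (\<Psi> k) - exp (lam k * t) * inner z0 (\<Psi> k)) =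
        y k t - mode \<Psi> z0 k"
      by (simp add: y_def mode_def right_diff_distrib mult.assoc[symmetric] exp_add[symmetric])
    ultimately have "(w k has_integral (y k t - mode \<Psi> z0 k)) {0..t}" by (simp only:)
    from integral_unique[OF this] show ?thesis by simp
  qed
  have "mode_trajectory lam B \<Psi> N T z0 u (\<lambda>k t. mode \<Psi> (z t) k)"
    unfolding mode_trajectory_def
  proof (intro allI impI ballI)
    fix k t assume t: "t \<in> {0..T}"
    show "((\<lambda>s. mode_field lam B \<Psi> k (mode \<Psi> (z s) k) (u s)) has_integral
        mode \<Psi> (z t) k - mode \<Psi> z0 k) {0..t}"
    proof (cases "t = 0")
      \<comment> \<open>Integration by parts is stated for intervals of positive length, so the
        degenerate one is settled directly.\<close>
      case True
      then show ?thesis using y[of 0 k] T by (simp add: y_def has_integral_refl(2))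
    next
      case False
      with t have t0: "t > 0" by simp
      have d: "((\<lambda>t. exp (lam k * t)) has_real_derivative lam k * exp (lam k * t)) (at t)" for t
        by (auto intro!: derivative_eq_intros)
      have dc: "continuous_on UNIV (\<lambda>t. lam k * exp (lam k * t))" by (intro continuous_intros)
      have wm': "w k \<in> borel_measurable (lebesgue_on {0..t})"
        using borel_measurable_lebesgue_on_subinterval[OF wm] t by auto
      note parts = integral_by_parts_indefinite[OF d dc t0 wm', of "C k" "y k" "mode \<Psi> z0 k"]
      have eq: "lam k * exp (lam k * s) * y k s + exp (lam k * s) * w k s =
          mode_field lam B \<Psi> k (mode \<Psi> (z s) k) (u s)" for s
        by (simp add: y_def w_def b_def mode_field_def mult.assoc[symmetric] exp_add[symmetric])
      have "integrable (lebesgue_on {0..t}) (\<lambda>s. mode_field lam B \<Psi> k (mode \<Psi> (z s) k) (u s))"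
        using parts(1) C y t by (simp add: eq)
      moreover have "(LINT s|lebesgue_on {0..t}. mode_field lam B \<Psi> k (mode \<Psi> (z s) k) (u s)) =
          mode \<Psi> (z t) k - mode \<Psi> z0 k"
      proof -
        have "(LINT s|lebesgue_on {0..t}. mode_field lam B \<Psi> k (mode \<Psi> (z s) k) (u s)) =
            exp (lam k * t) * y k t - exp (lam k * 0) * mode \<Psi> z0 k"
          unfolding eq[symmetric] by (rule parts(2)) (use C y t in auto)
        then show ?thesis by (simp add: y_def mult.assoc[symmetric] exp_add[symmetric])
      qed
      ultimately show ?thesis using has_integral_integral_lebesgue_on[of "{0..t}"] by fastforce
    qed
  qed
  moreover have "AE t in lebesgue_on {0..T}. (\<forall>k<N. mode \<Psi> (z t) k \<in> mode_set \<Psi> Zs k) \<and> u t \<in> U"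
    using AE by eventually_elim (auto simp: mode_set_def)
  moreover have "\<forall>k<N. mode \<Psi> (z T) k \<in> mode_set \<Psi> ZT k" using zT by (auto simp: mode_set_def)
  ultimately show ?thesis using uc by (auto simp: admissible_mode_controls_def)
qed

section \<open>Duality\<close>

context mode_problem
begin

abbreviation "start N \<equiv> (0::real, mode_point \<Psi> N z0)"
definition running :: "(real \<times> (nat \<Rightarrow> real)) \<times> (real^'m) \<Rightarrow> real" where
  "running p = (case p of ((t, z), u) \<Rightarrow> h t u)"

lemma running_simp [simp]: "running ((t, z), u) = h t u" by (simp add: running_def)

lemma continuous_on_running: "continuous_on (domain N) running"
  using continuous_on_cost_integrand[of N] by (simp add: running_def[abs_def])

lemma lp_cost_running: "lp_cost h \<mu> = (LINT p|\<mu>. running p)"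
  by (simp add: lp_cost_def running_def[abs_def])

lemma primalD:
  assumes "(\<mu>, \<mu>T) \<in> primal N"
  shows "\<mu> \<in> borel_measures_on (domain N)" "\<mu>T \<in> borel_measures_on (target N)"
    and "g \<in> C1_functions N \<Longrightarrow>
      (LINT z|\<mu>T. g (T, z)) - g (start N) = (LINT p|\<mu>. \<L> N g p)"
  using assms by (auto simp: lp_feasible_def)

lemma S_N_mode_space: "((t, z), u) \<in> domain N \<Longrightarrow> z \<in> mode_space N"
  using S_N_subset by blast

lemma primal_time_test:
  assumes "(\<mu>, \<mu>T) \<in> primal N"
    and \<phi>: "\<And>t. (\<phi> has_real_derivative \<phi>' t) (at t)" and \<phi>': "continuous_on UNIV \<phi>'"
  shows "\<phi> T * measure \<mu>T (target N) - \<phi> 0 = (LINT p|\<mu>. \<phi>' (fst (fst p)))"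
proof -
  note C = C1_functions_time[OF \<phi> \<phi>', of N]
  have "(LINT z|\<mu>T. (case (T, z) of (t, z) \<Rightarrow> \<phi> t)) - (case start N of (t, z) \<Rightarrow> \<phi> t) =
      (LINT p|\<mu>. \<L> N (\<lambda>(t, z). \<phi> t) p)"
    by (rule primalD(3)[OF assms(1) C])
  also have "\<dots> = (LINT p|\<mu>. \<phi>' (fst (fst p)))"
    using S_N_mode_space liouville_time[OF \<phi> \<phi>', where lam = lam and B = B and \<Psi> = \<Psi> and N = N]
    by (intro Bochner_Integration.integral_cong refl)
      (auto simp: space_borel_measures_on[OF primalD(1)[OF assms(1)]])
  finally show ?thesis
    by (simp add: space_borel_measures_on[OF primalD(2)[OF assms(1)]] mult.commute)
qed

text \<open>Test functions 1 and t. These forced masses allow a feasible pair to be normalised to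
  one probability measure.\<close>

lemma primal_mass:
  assumes "(\<mu>, \<mu>T) \<in> primal N"
  shows "measure \<mu>T (target N) = 1" "measure \<mu> (domain N) = T"
proof -
  show 1: "measure \<mu>T (target N) = 1"
    using primal_time_test[OF assms, of "\<lambda>t. 1" "\<lambda>t. 0"] by simp
  show "measure \<mu> (domain N) = T"
    using primal_time_test[OF assms, of "\<lambda>t. t" "\<lambda>t. 1"] 1
    by (simp add: space_borel_measures_on[OF primalD(1)[OF assms(1)]])
qed

lemma weak_duality: "dual_optimum N \<le> primal_value N"
  unfolding dual_value_def lp_value_def
proof (rule SUP_least, rule INF_greatest, clarify)
  fix g \<mu> \<mu>T assume g: "g \<in> dual N" and p: "(\<mu>, \<mu>T) \<in> primal N"
  note pD = primalD[OF p]
  have gC: "g \<in> C1_functions N" using g by (simp add: dual_feasible_def)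
  have i1: "integrable \<mu> (\<L> N g)" "integrable \<mu> running"
    by (intro borel_measure_integrable[OF pD(1) compact_S_N] continuous_on_liouville_S_N
        continuous_on_running gC)+
  have i2: "integrable \<mu>T (\<lambda>z. g (T, z))"
    by (intro borel_measure_integrable[OF pD(2) compact_mode_box(2)] continuous_on_terminal gC)
  have "0 \<le> (LINT p|\<mu>. \<L> N g p + running p)"
    using g by (intro integral_nonneg_AE AE_I2)
      (auto simp: space_borel_measures_on[OF pD(1)] dual_feasible_def)
  also have "\<dots> = (LINT p|\<mu>. \<L> N g p) + lp_cost h \<mu>"
    unfolding lp_cost_running by (rule Bochner_Integration.integral_add[OF i1])
  finally have "g (start N) \<le> lp_cost h \<mu> + (LINT z|\<mu>T. g (T, z))"
    using pD(3)[OF gC] by simp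
  moreover have "(LINT z|\<mu>T. g (T, z)) \<le> 0"
  proof -
    have "(LINT z|\<mu>T. g (T, z)) \<le> (LINT z|\<mu>T. 0)"
      using g i2 by (intro integral_mono)
        (auto simp: space_borel_measures_on[OF pD(2)] dual_feasible_def)
    then show ?thesis by simp
  qed
  ultimately show "ereal (g (start N)) \<le> ereal (lp_cost h \<mu>)" by simp
qed

lemma dual_value_finite:
  assumes "primal N \<noteq> {}"
  obtains d where "dual_optimum N = ereal d"
proof -
  obtain \<mu> \<mu>T where p: "(\<mu>, \<mu>T) \<in> primal N" using assms by auto
  have "primal_value N \<le> ereal (lp_cost h \<mu>)"
    unfolding lp_value_def by (rule INF_lower2[OF p]) simp
  then have "dual_optimum N \<noteq> \<infinity>"
    using weak_duality[of N] by (metis ereal_infty_less_eq(1) ereal_less_eq(1) order_trans PInfty_neq_ereal(1))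
  moreover have "dual_optimum N \<noteq> - \<infinity>"
  proof -
    obtain b where b: "\<forall>p\<in>domain N. \<bar>running p\<bar> \<le> b"
      using compact_continuous_bounded[OF continuous_on_running compact_S_N] by blast
    have d: "((\<lambda>t. b * (t - T)) has_real_derivative b) (at t)" for t
      by (auto intro!: derivative_eq_intros)
    have c: "continuous_on UNIV (\<lambda>t::real. b)" by simp
    \<comment> \<open>This function vanishes at time T and its \<open>liouville\<close> image is b,
      which dominates -h.\<close>
    have "(\<lambda>(t, z). b * (t - T)) \<in> dual N"
      unfolding dual_feasible_def
    proof (safe)
      show "(\<lambda>(t, z). b * (t - T)) \<in> C1_functions N" by (rule C1_functions_time[OF d c])
      fix t z u assume p: "((t, z), u) \<in> domain N"
      have "\<L> N (\<lambda>(t, z). b * (t - T)) ((t, z), u) = b"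
        by (rule liouville_time[OF d c S_N_mode_space[OF p]])
      then show "0 \<le> \<L> N (\<lambda>(t, z). b * (t - T)) ((t, z), u) + h t u"
        using bspec[OF b p] by simp
    qed simp
    then have "ereal (case start N of (t, z) \<Rightarrow> b * (t - T)) \<le> dual_optimum N"
      unfolding dual_value_def by (rule SUP_upper2) simp
    then show ?thesis by auto
  qed
  ultimately show thesis using that by (cases "dual_optimum N") auto
qed

text \<open>Correcting \<open>g\<close> by an affine function of time turns arbitrary bounds \<open>r\<close>, \<open>s\<close> into dual
  feasibility.\<close>

lemma dual_value_bound:
  assumes d: "dual_optimum N = ereal d" and g: "g \<in> C1_functions N"
    and r: "\<And>p. p \<in> domain N \<Longrightarrow> r \<le> \<L> N g p + running p"
    and s: "\<And>z. z \<in> target N \<Longrightarrow> g (T, z) \<le> s"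
  shows "g (start N) + T * r - s \<le> d"
proof -
  have d': "((\<lambda>t. r * (T - t) - s) has_real_derivative - r) (at t)" for t
    by (auto intro!: derivative_eq_intros)
  have c: "continuous_on UNIV (\<lambda>t::real. - r)" by simp
  define f where "f = (\<lambda>p. 1 * g p + 1 * (\<lambda>(t, z). r * (T - t) - s) p)"
  have "f \<in> dual N"
    unfolding dual_feasible_def
  proof safe
    show "f \<in> C1_functions N" unfolding f_def by (rule C1_functions_lincomb[OF g C1_functions_time[OF d' c]])
    show "f (T, z) \<le> 0" if "z \<in> target N" for z using s[OF that] by (simp add: f_def)
    fix t z u assume p: "((t, z), u) \<in> domain N"
    have "\<L> N f ((t, z), u) = \<L> N g ((t, z), u) - r"
      unfolding f_def
      using liouville_lincomb[OF g C1_functions_time[OF d' c] S_N_mode_space[OF p], where a = 1 and b = 1 and lam = lam and B = B and \<Psi> = \<Psi>]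
        liouville_time[OF d' c S_N_mode_space[OF p], where lam = lam and B = B and \<Psi> = \<Psi>] by simp
    then show "0 \<le> \<L> N f ((t, z), u) + h t u" using r[OF p] by simp
  qed
  then have "ereal (f (start N)) \<le> ereal d"
    unfolding d[symmetric] dual_value_def by (rule SUP_upper)
  then show ?thesis by (simp add: f_def algebra_simps)
qed

lemma C1_functions_scale:
  assumes "g \<in> C1_functions N"
  shows "(\<lambda>p. a * g p) \<in> C1_functions N"
    and "z \<in> mode_space N \<Longrightarrow> \<L> N (\<lambda>p. a * g p) ((t, z), u) = a * \<L> N g ((t, z), u)"
  using C1_functions_lincomb[OF assms assms, of a 0] liouville_lincomb[OF assms assms, where a = a and b = 0]
  by simp_all

text \<open>A pair of measures with the masses forced by the constraints is encoded as a single
  probability measure on the product of the two compact sets.\<close>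

definition pair_cone :: "nat \<Rightarrow> real \<Rightarrow> (((real \<times> (nat \<Rightarrow> real)) \<times> (real^'m)) \<times> (nat \<Rightarrow> real) \<Rightarrow> real) set" where
  "pair_cone N d = {f. \<exists>a\<ge>0. \<exists>g\<in>C1_functions N. \<forall>p\<in>domain N. \<forall>q\<in>target N.
     f (p, q) = a * (T * running p - d) + (g (T, q) - T * \<L> N g p - g (start N))}"

lemma pair_coneI:
  assumes "a \<ge> 0" "g \<in> C1_functions N"
    and "\<And>p q. p \<in> domain N \<Longrightarrow> q \<in> target N \<Longrightarrow>
      f (p, q) = a * (T * running p - d) + (g (T, q) - T * \<L> N g p - g (start N))"
  shows "f \<in> pair_cone N d"
  unfolding pair_cone_def mem_Collect_eq
  by (intro exI[of _ a] conjI bexI[of _ g] ballI assms)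

lemma pair_coneE:
  assumes "f \<in> pair_cone N d"
  obtains a g where "a \<ge> 0" "g \<in> C1_functions N"
    "\<forall>p\<in>domain N. \<forall>q\<in>target N.
      f (p, q) = a * (T * running p - d) + (g (T, q) - T * \<L> N g p - g (start N))"
  using assms[unfolded pair_cone_def mem_Collect_eq] by (elim exE conjE bexE)

lemma continuous_on_pair_cone:
  assumes "f \<in> pair_cone N d"
  shows "continuous_on (domain N \<times> target N) f"
proof -
  obtain a g where "a \<ge> 0" and g: "g \<in> C1_functions N" and f': "\<forall>p\<in>domain N. \<forall>q\<in>target N.
     f (p, q) = a * (T * running p - d) + (g (T, q) - T * \<L> N g p - g (start N))"
    using assms by (rule pair_coneE)
  note f = bspec[OF bspec[OF f']]
  let ?X = "domain N \<times> target N"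
  have 1: "continuous_on ?X (\<lambda>x. k (fst x))" if "continuous_on (domain N) k" for k :: "_ \<Rightarrow> real"
    by (rule continuous_on_compose2[OF that]) (auto intro: continuous_intros)
  have 2: "continuous_on ?X (\<lambda>x. k (snd x))" if "continuous_on (target N) k" for k :: "_ \<Rightarrow> real"
    by (rule continuous_on_compose2[OF that]) (auto intro: continuous_intros)
  have "continuous_on ?X (\<lambda>x. a * (T * running (fst x) - d) +
      (g (T, snd x) - T * \<L> N g (fst x) - g (start N)))"
    by (intro continuous_on_add continuous_on_diff continuous_on_mult continuous_on_const
        1[OF continuous_on_running] 1[OF continuous_on_liouville_S_N[OF g]]
        2[OF continuous_on_terminal[OF g]])
  then show ?thesis by (rule continuous_on_eq) (auto simp: f)
qed

text \<open>On the product, f splits into a function of p and a function of q, so its minimum is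
  found in each variable separately. Were it positive, then for a > 0 the function -g/a, corrected
  by \<open>dual_value_bound\<close>, would have a dual value above d; for a = 0, large multiples of
  -g would make the dual value unbounded.\<close>

lemma pair_cone_nonpos:
  assumes d: "dual_optimum N = ereal d"
    and ne: "domain N \<noteq> {}" "target N \<noteq> {}"
    and f: "f \<in> pair_cone N d"
  shows "\<exists>x\<in>domain N \<times> target N. f x \<le> 0"
proof (rule ccontr)
  assume "\<not> ?thesis"
  then have pos: "f (p, q) > 0" if "p \<in> domain N" "q \<in> target N" for p q
    using that by force
  obtain a g where a: "a \<ge> 0" and g: "g \<in> C1_functions N" and feq': "\<forall>p\<in>domain N. \<forall>q\<in>target N.
     f (p, q) = a * (T * running p - d) + (g (T, q) - T * \<L> N g p - g (start N))"
    using f by (rule pair_coneE)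
  note feq = bspec[OF bspec[OF feq']]
  have scale: "\<L> N (\<lambda>p. c * g p) p = c * \<L> N g p"
    if "p \<in> domain N" for p c
    using that C1_functions_scale(2)[OF g] S_N_mode_space by (cases p) auto
  have attains: "\<exists>p\<in>domain N. \<forall>p'\<in>domain N. k p \<le> k p'"
    if "continuous_on (domain N) k" for k :: "_ \<Rightarrow> real"
    using continuous_attains_inf[OF compact_S_N ne(1) that] by blast
  have "\<exists>q\<in>target N. \<forall>q'\<in>target N. g (T, q) \<le> g (T, q')"
    using continuous_attains_inf[OF compact_mode_box(2) ne(2) continuous_on_terminal[OF g]] by blast
  then obtain q where q: "q \<in> target N" "\<And>q'. q' \<in> target N \<Longrightarrow> g (T, q) \<le> g (T, q')"
    by blast
  show False
  proof (cases "a = 0")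
    case False
    with a have a: "a > 0" by simp
    define c where "c = - 1 / a"
    define g1 where "g1 = (\<lambda>p. c * g p)"
    have g1: "g1 \<in> C1_functions N" unfolding g1_def by (rule C1_functions_scale(1)[OF g])
    have "continuous_on (domain N) (\<lambda>p. \<L> N g1 p + running p)"
      by (intro continuous_on_add continuous_on_liouville_S_N continuous_on_running g1)
    then obtain p where p: "p \<in> domain N" "\<And>p'. p' \<in> domain N \<Longrightarrow>
      \<L> N g1 p + running p \<le> \<L> N g1 p' + running p'"
      using attains by blast
    have "g1 (start N) + T * (\<L> N g1 p + running p) - g1 (T, q) \<le> d"
      using p q a by (intro dual_value_bound[OF d g1]) (auto simp: g1_def c_def divide_right_mono)
    then have *: "a * (g1 (start N) + T * (\<L> N g1 p + running p) - g1 (T, q)) \<le> a * d"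
      using a by (intro mult_left_mono) auto
    have "- g (start N) - T * \<L> N g p + a * T * running p + g (T, q) \<le> a * d"
    proof -
      have "a * c = - 1" using a by (simp add: c_def)
      then show ?thesis
        using * unfolding g1_def scale[OF p(1)] by (simp add: algebra_simps) (simp add: mult.assoc[symmetric])
    qed
    moreover have "0 < a * (T * running p - d) + (g (T, q) - T * \<L> N g p - g (start N))"
      using pos[OF p(1) q(1)] feq[OF p(1) q(1)] by simp
    ultimately show False by (simp add: algebra_simps)
  next
    case True
    have "continuous_on (domain N) (\<lambda>p. - \<L> N g p)"
      by (intro continuous_on_minus continuous_on_liouville_S_N g)
    then obtain p where p: "p \<in> domain N" "\<And>p'. p' \<in> domain N \<Longrightarrow>
      - \<L> N g p \<le> - \<L> N g p'"
      using attains by blast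
    obtain p0 where p0: "p0 \<in> domain N" "\<And>p'. p' \<in> domain N \<Longrightarrow> running p0 \<le> running p'"
      using attains[OF continuous_on_running] by blast
    define \<delta> where "\<delta> = g (T, q) - T * \<L> N g p - g (start N)"
    have \<delta>: "\<delta> > 0" using pos[OF p(1) q(1)] feq[OF p(1) q(1)] True by (simp add: \<delta>_def)
    have bound: "n * \<delta> + T * running p0 \<le> d" if n: "n \<ge> 0" for n
    proof -
      define g1 where "g1 = (\<lambda>p. (- n) * g p)"
      have g1: "g1 \<in> C1_functions N" unfolding g1_def by (rule C1_functions_scale(1)[OF g])
      have "g1 (start N) + T * (n * (- \<L> N g p) + running p0) - (- n) * g (T, q) \<le> d"
      proof (rule dual_value_bound[OF d g1])
        fix p' assume p': "p' \<in> domain N"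
        have "n * (- \<L> N g p) \<le> n * (- \<L> N g p')"
          using n p(2)[OF p'] by (intro mult_left_mono)
        then show "n * (- \<L> N g p) + running p0 \<le> \<L> N g1 p' + running p'"
          using p0(2)[OF p'] by (simp add: g1_def scale[OF p', of "- n", simplified])
      next
        fix z assume "z \<in> target N"
        then show "g1 (T, z) \<le> (- n) * g (T, q)" using q(2) n by (simp add: g1_def mult_left_mono)
      qed
      then show ?thesis by (simp add: g1_def \<delta>_def algebra_simps)
    qed
    \<comment> \<open>Chosen so that n \<delta> exceeds d - T * running p0, contradicting
      \<open>bound\<close>.\<close>
    define n where "n = \<bar>d - T * running p0\<bar> / \<delta> + 1"
    have "n * \<delta> = \<bar>d - T * running p0\<bar> + \<delta>" using \<delta> by (simp add: n_def field_simps)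
    moreover have "n \<ge> 0" using \<delta> by (simp add: n_def)
    ultimately show False using bound[of n] \<delta> by linarith
  qed
qed

text \<open>The candidates are the two marginals of the probability measure M, the first scaled by
  its forced mass T. Nonpositivity on the cone with a = 0, for g and for -g, is the equality
  constraint; with a = 1 and g = 0 it bounds the cost by d.\<close>

theorem primal_attains_dual_value:
  assumes ne: "primal N \<noteq> {}"
  shows "\<exists>(\<mu>, \<mu>T)\<in>primal N. ereal (lp_cost h \<mu>) \<le> dual_optimum N"
proof -
  obtain d where d: "dual_optimum N = ereal d" using dual_value_finite[OF ne] .
  let ?K = "domain N" and ?L = "target N"
  obtain \<mu>0 \<mu>T0 where "(\<mu>0, \<mu>T0) \<in> primal N" using ne by auto
  from primal_mass[OF this] have ne': "?K \<noteq> {}" "?L \<noteq> {}" using T by auto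
  have one: "(\<lambda>p. 0) \<in> C1_functions N"
    using C1_functions_time[of "\<lambda>t. 0" "\<lambda>t. 0" N] by (simp add: split_def)
  have lone: "\<L> N (\<lambda>p. 0) p = 0" if "p \<in> ?K" for p
    using liouville_time[of "\<lambda>t. 0" "\<lambda>t. 0" _ N lam B \<Psi>] S_N_mode_space that
    by (cases p) (auto simp: split_def)
  have "\<exists>M. sets M = sets (restrict_space borel (?K \<times> ?L)) \<and> finite_measure M \<and>
      measure M (?K \<times> ?L) = 1 \<and> (\<forall>f\<in>pair_cone N d. (LINT x|M. f x) \<le> 0)"
  proof (rule probability_nonpositive_on_cone)
    show "compact (?K \<times> ?L)" by (intro compact_Times compact_S_N compact_mode_box)
    show "?K \<times> ?L \<noteq> {}" using ne' by auto
    have "(\<lambda>(p, q). 0 * (T * running p - d) + (0 - T * \<L> N (\<lambda>p. 0) p - 0)) \<in> pair_cone N d"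
      by (rule pair_coneI[OF order_refl one]) simp
    then show "pair_cone N d \<noteq> {}" by blast
    show "continuous_on (?K \<times> ?L) f" if "f \<in> pair_cone N d" for f by (rule continuous_on_pair_cone[OF that])
    show "\<exists>x\<in>?K \<times> ?L. f x \<le> 0" if "f \<in> pair_cone N d" for f by (rule pair_cone_nonpos[OF d ne' that])
    show "(\<lambda>x. f1 x + f2 x) \<in> pair_cone N d" if f12: "f1 \<in> pair_cone N d" "f2 \<in> pair_cone N d" for f1 f2
    proof -
      obtain a1 g1 where 1: "a1 \<ge> 0" "g1 \<in> C1_functions N" "\<forall>p\<in>?K. \<forall>q\<in>?L.
        f1 (p, q) = a1 * (T * running p - d) + (g1 (T, q) - T * \<L> N g1 p - g1 (start N))"
        using f12(1) by (rule pair_coneE)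
      obtain a2 g2 where 2: "a2 \<ge> 0" "g2 \<in> C1_functions N" "\<forall>p\<in>?K. \<forall>q\<in>?L.
        f2 (p, q) = a2 * (T * running p - d) + (g2 (T, q) - T * \<L> N g2 p - g2 (start N))"
        using f12(2) by (rule pair_coneE)
      define g where "g = (\<lambda>p. 1 * g1 p + 1 * g2 p)"
      have "g \<in> C1_functions N" unfolding g_def by (rule C1_functions_lincomb[OF 1(2) 2(2)])
      moreover have "\<L> N g p = \<L> N g1 p + \<L> N g2 p"
        if "p \<in> ?K" for p
        unfolding g_def using that S_N_mode_space
          liouville_lincomb[OF 1(2) 2(2), where a = 1 and b = 1 and lam = lam and B = B and \<Psi> = \<Psi>] by (cases p) auto
      ultimately have gC: "g \<in> C1_functions N" and gl: "\<And>p. p \<in> ?K \<Longrightarrow>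
          \<L> N g p = \<L> N g1 p + \<L> N g2 p" .
      show ?thesis
      proof (rule pair_coneI[OF _ gC, of "a1 + a2"])
        fix p q assume pq: "p \<in> ?K" "q \<in> ?L"
        show "f1 (p, q) + f2 (p, q) = (a1 + a2) * (T * running p - d) +
            (g (T, q) - T * \<L> N g p - g (start N))"
          unfolding bspec[OF bspec[OF 1(3) pq(1)] pq(2)] bspec[OF bspec[OF 2(3) pq(1)] pq(2)] gl[OF pq(1)]
          by (simp add: g_def algebra_simps)
      qed (use 1(1) 2(1) in simp)
    qed
    show "(\<lambda>x. c * f x) \<in> pair_cone N d" if c: "c \<ge> 0" and f: "f \<in> pair_cone N d" for c f
    proof -
      obtain a g where g: "a \<ge> 0" "g \<in> C1_functions N" "\<forall>p\<in>?K. \<forall>q\<in>?L.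
        f (p, q) = a * (T * running p - d) + (g (T, q) - T * \<L> N g p - g (start N))"
        using f by (rule pair_coneE)
      have gl: "\<L> N (\<lambda>p. c * g p) p = c * \<L> N g p" if "p \<in> ?K" for p
        using that C1_functions_scale(2)[OF g(2)] S_N_mode_space by (cases p) auto
      show ?thesis
      proof (rule pair_coneI[OF _ C1_functions_scale(1)[OF g(2), of c], of "c * a"])
        fix p q assume pq: "p \<in> ?K" "q \<in> ?L"
        show "c * f (p, q) = c * a * (T * running p - d) +
            (c * g (T, q) - T * \<L> N (\<lambda>p. c * g p) p - c * g (start N))"
          unfolding bspec[OF bspec[OF g(3) pq(1)] pq(2)] gl[OF pq(1)] by (simp add: algebra_simps)
      qed (use g(1) c in simp)
    qed
  qed
  then obtain M where M: "sets M = sets (restrict_space borel (?K \<times> ?L))" "finite_measure M"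
    "measure M (?K \<times> ?L) = 1" and Mle: "\<And>f. f \<in> pair_cone N d \<Longrightarrow> (LINT x|M. f x) \<le> 0"
    by blast
  interpret finite_measure M by (rule M(2))
  have sp: "space M = ?K \<times> ?L" using sets_eq_imp_space_eq[OF M(1)] by (simp add: space_restrict_space)
  have Mb: "M \<in> borel_measures_on (?K \<times> ?L)" using M by (simp add: borel_measures_on_def)
  have fm: "fst \<in> M \<rightarrow>\<^sub>M restrict_space borel ?K" and sm: "snd \<in> M \<rightarrow>\<^sub>M restrict_space borel ?L"
    unfolding measurable_cong_sets[OF M(1) refl]
    by (intro measurable_restrict_space3 borel_measurable_continuous_onI continuous_intros; auto)+
  define \<mu> where "\<mu> = distr (density M (\<lambda>_. ennreal T)) (restrict_space borel ?K) fst"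
  define \<mu>T where "\<mu>T = distr M (restrict_space borel ?L) snd"
  have fm': "fst \<in> density M (\<lambda>_. ennreal T) \<rightarrow>\<^sub>M restrict_space borel ?K" using fm by simp
  have "finite_measure (density M (\<lambda>_. ennreal T))"
    by (rule finite_measureI) (simp add: emeasure_density ennreal_mult_eq_top_iff emeasure_eq_measure)
  then have \<mu>: "\<mu> \<in> borel_measures_on ?K"
    unfolding \<mu>_def borel_measures_on_def using finite_measure.finite_measure_distr[OF _ fm'] by simp
  have \<mu>T: "\<mu>T \<in> borel_measures_on ?L"
    unfolding \<mu>T_def borel_measures_on_def using finite_measure_distr[OF sm] by simp
  have \<mu>_int: "(LINT p|\<mu>. k p) = T * (LINT x|M. k (fst x))" "integrable M (\<lambda>x. k (fst x))"
    if k: "continuous_on ?K k" for k :: "_ \<Rightarrow> real"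
  proof -
    note km = borel_measurable_continuous_on_restrict[OF k]
    have "(LINT p|\<mu>. k p) = (LINT x|density M (\<lambda>_. ennreal T). k (fst x))"
      unfolding \<mu>_def by (rule integral_distr[OF fm' km])
    also have "\<dots> = (LINT x|M. T *\<^sub>R k (fst x))"
      using T measurable_compose[OF fm km] by (intro integral_density) auto
    finally show "(LINT p|\<mu>. k p) = T * (LINT x|M. k (fst x))" by simp
    have "continuous_on (?K \<times> ?L) (\<lambda>x. k (fst x))"
      by (rule continuous_on_compose2[OF k]) (auto intro: continuous_intros)
    then show "integrable M (\<lambda>x. k (fst x))"
      by (intro borel_measure_integrable[OF Mb] compact_Times compact_S_N compact_mode_box)
  qed
  have \<mu>T_int: "(LINT p|\<mu>T. k p) = (LINT x|M. k (snd x))" "integrable M (\<lambda>x. k (snd x))"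
    if k: "continuous_on ?L k" for k :: "_ \<Rightarrow> real"
  proof -
    show "(LINT p|\<mu>T. k p) = (LINT x|M. k (snd x))"
      unfolding \<mu>T_def by (rule integral_distr[OF sm borel_measurable_continuous_on_restrict[OF k]])
    have "continuous_on (?K \<times> ?L) (\<lambda>x. k (snd x))"
      by (rule continuous_on_compose2[OF k]) (auto intro: continuous_intros)
    then show "integrable M (\<lambda>x. k (snd x))"
      by (intro borel_measure_integrable[OF Mb] compact_Times compact_S_N compact_mode_box)
  qed
  have le: "a * (lp_cost h \<mu> - d) + ((LINT z|\<mu>T. g (T, z)) - (LINT p|\<mu>. \<L> N g p) - g (start N)) \<le> 0"
    if a: "a \<ge> 0" and g: "g \<in> C1_functions N" for a g
  proof -
    note r = \<mu>_int[OF continuous_on_running]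
    note l = \<mu>_int[OF continuous_on_liouville_S_N[OF g]]
    note t = \<mu>T_int[OF continuous_on_terminal[OF g]]
    have "(\<lambda>x. a * (T * running (fst x) - d) + (g (T, snd x) - T * \<L> N g (fst x) - g (start N)))
        \<in> pair_cone N d"
      by (rule pair_coneI[OF a g]) simp
    from Mle[OF this] have "(LINT x|M. a * (T * running (fst x) - d) +
        (g (T, snd x) - T * \<L> N g (fst x) - g (start N))) \<le> 0" .
    then show ?thesis
      using r l t M(3) by (simp add: lp_cost_running sp)
  qed
  have "(\<mu>, \<mu>T) \<in> primal N"
    unfolding lp_feasible_def
  proof (clarsimp simp: \<mu> \<mu>T)
    fix g assume g: "g \<in> C1_functions N"
    note l = \<mu>_int[OF continuous_on_liouville_S_N[OF g]]
    have "(LINT p|\<mu>. \<L> N (\<lambda>p. (-1) * g p) p) = (LINT p|\<mu>. (-1) * \<L> N g p)"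
      using C1_functions_scale(2)[OF g, of _ "-1"] S_N_mode_space
      by (intro Bochner_Integration.integral_cong refl) (auto simp: space_borel_measures_on[OF \<mu>])
    then show "(LINT z|\<mu>T. g (T, z)) - g (start N) = (LINT p|\<mu>. \<L> N g p)"
      using le[of 0, OF _ g] le[of 0, OF _ C1_functions_scale(1)[OF g, of "-1"]] by simp
  qed
  moreover have "(LINT p|\<mu>. \<L> N (\<lambda>p. 0) p) = (LINT p|\<mu>. 0)"
    by (intro Bochner_Integration.integral_cong refl) (auto simp: space_borel_measures_on[OF \<mu>] lone)
  then have "lp_cost h \<mu> \<le> d" using le[of 1, OF _ one] by simp
  ultimately show ?thesis unfolding d by auto
qed

corollary
  assumes ne: "primal N \<noteq> {}"
  shows lp_value_attained: "\<exists>(\<mu>, \<mu>T)\<in>primal N. ereal (lp_cost h \<mu>) = primal_value N"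
    and strong_duality: "primal_value N = dual_optimum N"
proof -
  obtain \<mu> \<mu>T where p: "(\<mu>, \<mu>T) \<in> primal N" "ereal (lp_cost h \<mu>) \<le> dual_optimum N"
    using primal_attains_dual_value[OF ne] by blast
  have le: "primal_value N \<le> ereal (lp_cost h \<mu>)"
    unfolding lp_value_def by (rule INF_lower2[OF p(1)]) simp
  show "primal_value N = dual_optimum N"
    using le p(2) weak_duality[of N] by order
  then have "ereal (lp_cost h \<mu>) = primal_value N"
    using le p(2) by order
  then show "\<exists>(\<mu>, \<mu>T)\<in>primal N. ereal (lp_cost h \<mu>) = primal_value N"
    using p(1) by blast
qed

end

section \<open>Measurable selection\<close>

text \<open>Minimising one coordinate after the other shrinks the compact values to points; each step
  preserves measurability because comparing two minima only involves rational thresholds.\<close>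

theorem compact_measurable_selection:
  fixes F :: "'t \<Rightarrow> 'b::euclidean_space set"
  assumes compact: "\<And>t. t \<in> space M \<Longrightarrow> compact (F t)" and ne: "\<And>t. t \<in> space M \<Longrightarrow> F t \<noteq> {}"
    and meas: "\<And>C. closed C \<Longrightarrow> {t \<in> space M. F t \<inter> C \<noteq> {}} \<in> sets M"
  shows "\<exists>f \<in> borel_measurable M. \<forall>t\<in>space M. f t \<in> F t"
proof -
  have "\<exists>G. (\<forall>t\<in>space M. compact (G t) \<and> G t \<noteq> {} \<and> G t \<subseteq> F t \<and>
        (\<forall>x\<in>G t. \<forall>y\<in>G t. \<forall>i\<in>J. x \<bullet> i = y \<bullet> i)) \<and>
      (\<forall>C. closed C \<longrightarrow> {t \<in> space M. G t \<inter> C \<noteq> {}} \<in> sets M)"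
    if "finite J" for J :: "'b set"
    using that
  proof (induction J rule: finite_induct)
    case empty
    show ?case by (intro exI[of _ F] conjI ballI allI impI compact ne meas) simp_all
  next
    case (insert i J)
    from insert.IH obtain G where G0: "\<forall>t\<in>space M. compact (G t) \<and> G t \<noteq> {} \<and> G t \<subseteq> F t \<and>
        (\<forall>x\<in>G t. \<forall>y\<in>G t. \<forall>i\<in>J. x \<bullet> i = y \<bullet> i)"
      and Gm0: "\<forall>C. closed C \<longrightarrow> {t \<in> space M. G t \<inter> C \<noteq> {}} \<in> sets M"
      by (elim exE conjE)
    have G: "compact (G t)" "G t \<noteq> {}" "G t \<subseteq> F t" if "t \<in> space M" for t
      using bspec[OF G0 that] by - (elim conjE, assumption)+
    have G4: "x \<bullet> j = y \<bullet> j" if "t \<in> space M" "x \<in> G t" "y \<in> G t" "j \<in> J" for t x y j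
      using bspec[OF G0 that(1)] that(2-) by blast
    have Gm: "{t \<in> space M. G t \<inter> C \<noteq> {}} \<in> sets M" if "closed C" for C
      using Gm0 that by simp
    define H where "H = (\<lambda>t. {x \<in> G t. \<forall>y\<in>G t. x \<bullet> i \<le> y \<bullet> i})"
    have min: "\<exists>x\<in>K. \<forall>y\<in>K. x \<bullet> i \<le> y \<bullet> i" if "compact K" "K \<noteq> {}" for K :: "'b set"
      by (intro continuous_attains_inf[OF that] continuous_intros)
    have Heq: "H t = G t \<inter> (\<Inter>y\<in>G t. {x. x \<bullet> i \<le> y \<bullet> i})" for t by (auto simp: H_def)
    have Hc: "compact (H t)" if "t \<in> space M" for t
      unfolding Heq using G(1)[OF that]
      by (intro compact_Int_closed closed_INT ballI closed_halfspace_component_le)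
    have Hne: "H t \<noteq> {}" if "t \<in> space M" for t
      using min[OF G(1)[OF that] G(2)[OF that]] by (auto simp: H_def)
    \<comment> \<open>A minimiser over G t lies in C exactly if minimising over G t \<inter> C gives
      no larger value. Comparing sublevel sets at rational thresholds states this with countably
      many conditions, each about G t meeting a closed set.\<close>
    have hit: "H t \<inter> C \<noteq> {} \<longleftrightarrow>
        (\<forall>q::rat. G t \<inter> {x. x \<bullet> i \<le> of_rat q} \<noteq> {} \<longrightarrow> G t \<inter> (C \<inter> {x. x \<bullet> i \<le> of_rat q}) \<noteq> {})"
      if t: "t \<in> space M" and C: "closed C" for t C
    proof
      assume "H t \<inter> C \<noteq> {}"
      then show "\<forall>q::rat. G t \<inter> {x. x \<bullet> i \<le> of_rat q} \<noteq> {} \<longrightarrow> G t \<inter> (C \<inter> {x. x \<bullet> i \<le> of_rat q}) \<noteq> {}"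
        by (fastforce simp: H_def)
    next
      assume R: "\<forall>q::rat. G t \<inter> {x. x \<bullet> i \<le> of_rat q} \<noteq> {} \<longrightarrow> G t \<inter> (C \<inter> {x. x \<bullet> i \<le> of_rat q}) \<noteq> {}"
      obtain m where m: "m \<in> G t" "\<And>y. y \<in> G t \<Longrightarrow> m \<bullet> i \<le> y \<bullet> i"
        using min[OF G(1)[OF t] G(2)[OF t]] by blast
      have above: "G t \<inter> (C \<inter> {x. x \<bullet> i \<le> of_rat q}) \<noteq> {}" if "m \<bullet> i < of_rat q" for q
        using R m(1) that by force
      \<comment> \<open>Any threshold above the minimum shows that G t \<inter> C is nonempty, which
        has to be known before its own minimum can be taken.\<close>
      obtain q0 where "m \<bullet> i < of_rat q0" using of_rat_dense[of "m \<bullet> i" "m \<bullet> i + 1"] by auto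
      then have "G t \<inter> C \<noteq> {}" using above by blast
      then obtain x where x: "x \<in> G t \<inter> C" "\<And>y. y \<in> G t \<inter> C \<Longrightarrow> x \<bullet> i \<le> y \<bullet> i"
        using min[of "G t \<inter> C"] G(1)[OF t] C compact_Int_closed by metis
      have "x \<bullet> i \<le> m \<bullet> i"
      proof (rule ccontr)
        assume "\<not> ?thesis"
        then obtain q where q: "m \<bullet> i < of_rat q" "of_rat q < x \<bullet> i"
          using of_rat_dense[of "m \<bullet> i" "x \<bullet> i"] by auto
        then obtain y where "y \<in> G t \<inter> C" "y \<bullet> i \<le> of_rat q" using above by blast
        then show False using x(2)[of y] q(2) by linarith
      qed
      then have "x \<in> H t" using x(1) m(2) by (force simp: H_def)
      then show "H t \<inter> C \<noteq> {}" using x(1) by blast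
    qed
    have Hm: "{t \<in> space M. H t \<inter> C \<noteq> {}} \<in> sets M" if C: "closed C" for C
    proof -
      have "{t \<in> space M. H t \<inter> C \<noteq> {}} = {t \<in> space M. \<forall>q::rat.
          G t \<inter> {x. x \<bullet> i \<le> of_rat q} \<noteq> {} \<longrightarrow> G t \<inter> (C \<inter> {x. x \<bullet> i \<le> of_rat q}) \<noteq> {}}"
        using hit[OF _ C] by (intro Collect_cong) auto
      also have "\<dots> \<in> sets M"
        by (intro sets.sets_Collect_countable_All sets.sets_Collect_imp Gm closed_Int C
            closed_halfspace_component_le)
      finally show ?thesis .
    qed
    have HJ: "x \<bullet> j = y \<bullet> j" if "t \<in> space M" "x \<in> H t" "y \<in> H t" "j \<in> insert i J" for t x y j
      using that G4[of t x y j] by (auto simp: H_def intro: antisym)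
    have HF: "H t \<subseteq> F t" if "t \<in> space M" for t using G(3)[OF that] by (auto simp: H_def)
    show ?case by (intro exI[of _ H] conjI ballI allI impI Hc Hne Hm HF) (assumption | rule HJ)+
  qed
  from this[OF finite_Basis] obtain G where G0: "\<forall>t\<in>space M. compact (G t) \<and> G t \<noteq> {} \<and> G t \<subseteq> F t \<and>
      (\<forall>x\<in>G t. \<forall>y\<in>G t. \<forall>i\<in>Basis. x \<bullet> i = y \<bullet> i)"
    and Gm0: "\<forall>C. closed C \<longrightarrow> {t \<in> space M. G t \<inter> C \<noteq> {}} \<in> sets M"
    by (elim exE conjE)
  have G: "G t \<noteq> {}" "G t \<subseteq> F t" if "t \<in> space M" for t
    using bspec[OF G0 that] by - (elim conjE, assumption)+
  have G3: "x = y" if "t \<in> space M" "x \<in> G t" "y \<in> G t" for t x y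
  proof (rule euclidean_eqI)
    have "\<forall>x\<in>G t. \<forall>y\<in>G t. \<forall>i\<in>Basis. x \<bullet> i = y \<bullet> i" using bspec[OF G0 that(1)] by (elim conjE)
    from this[THEN bspec, OF that(2), THEN bspec, OF that(3)]
    show "x \<bullet> i = y \<bullet> i" if "i \<in> Basis" for i using that by (rule bspec)
  qed
  define f where "f = (\<lambda>t. SOME x. x \<in> G t)"
  have f: "f t \<in> G t" if "t \<in> space M" for t
    unfolding f_def using G(1)[OF that] by (simp add: some_in_eq)
  have "f \<in> borel_measurable M"
  proof (rule borel_measurableI)
    fix S :: "'b set" assume "open S"
    then have "{t \<in> space M. G t \<inter> - S \<noteq> {}} \<in> sets M" using Gm0 by (simp add: closed_Compl)
    moreover have "f -` S \<inter> space M = space M - {t \<in> space M. G t \<inter> - S \<noteq> {}}"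
      using f G3 by blast
    ultimately show "f -` S \<inter> space M \<in> sets M" by simp
  qed
  then show ?thesis using f G by blast
qed

section \<open>Averages at fixed time\<close>

text \<open>Replaces a disintegration of \<mu> along time by conditional expectations of individual
  functions: the input coordinates, the cost and the state coordinates.\<close>

locale timed_measure = finite_measure \<mu> for \<mu> :: "'x measure" +
  fixes \<tau> :: "'x \<Rightarrow> real"
  assumes \<tau> [measurable]: "\<tau> \<in> borel_measurable \<mu>"
begin

definition time_law :: "real measure" where "time_law = distr \<mu> borel \<tau>"

lemma sets_time_law [simp, measurable_cong]: "sets time_law = sets borel"
  and space_time_law [simp]: "space time_law = UNIV"
  by (simp_all add: time_law_def)

lemma finite_time_law: "finite_measure time_law"
  unfolding time_law_def by (rule finite_measure_distr[OF \<tau>])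

lemma integral_time_law: "\<psi> \<in> borel_measurable borel \<Longrightarrow> (LINT t|time_law. \<psi> t) = (LINT x|\<mu>. \<psi> (\<tau> x))"
  for \<psi> :: "real \<Rightarrow> real"
  unfolding time_law_def by (rule integral_distr[OF \<tau>])

lemma AE_time_law_bound:
  assumes "\<psi> \<in> borel_measurable borel" "\<And>x. x \<in> space \<mu> \<Longrightarrow> \<bar>\<psi> (\<tau> x)\<bar> \<le> (b::real)"
  shows "AE t in time_law. \<bar>\<psi> t\<bar> \<le> b"
  unfolding time_law_def using assms by (subst AE_distr_iff) auto

lemma integrable_bounded:
  fixes F :: "'x \<Rightarrow> real"
  assumes "F \<in> borel_measurable \<mu>" "\<And>x. x \<in> space \<mu> \<Longrightarrow> \<bar>F x\<bar> \<le> b"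
  shows "integrable \<mu> F"
  using assms by (intro integrable_const_bound[of _ b]) (auto intro: AE_I2)

text \<open>\<open>f\<close> is the conditional expectation of \<open>F\<close> given the time \<open>\<tau>\<close>, as a function of time.\<close>

definition averages_to :: "('x \<Rightarrow> real) \<Rightarrow> (real \<Rightarrow> real) \<Rightarrow> bool" where
  "averages_to F f \<longleftrightarrow>
     F \<in> borel_measurable \<mu> \<and> (\<exists>c. \<forall>x\<in>space \<mu>. \<bar>F x\<bar> \<le> c) \<and>
     f \<in> borel_measurable borel \<and> integrable time_law f \<and>
     (\<forall>\<psi> b. \<psi> \<in> borel_measurable borel \<longrightarrow> (\<forall>x\<in>space \<mu>. \<bar>\<psi> (\<tau> x)\<bar> \<le> b) \<longrightarrow>
        (LINT x|\<mu>. \<psi> (\<tau> x) * F x) = (LINT t|time_law. \<psi> t * f t))"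

lemma averages_toD:
  assumes "averages_to F f"
  shows "F \<in> borel_measurable \<mu>" "\<exists>c. \<forall>x\<in>space \<mu>. \<bar>F x\<bar> \<le> c"
    "f \<in> borel_measurable borel" "integrable time_law f"
    "\<psi> \<in> borel_measurable borel \<Longrightarrow> (\<And>x. x \<in> space \<mu> \<Longrightarrow> \<bar>\<psi> (\<tau> x)\<bar> \<le> b) \<Longrightarrow>
        (LINT x|\<mu>. \<psi> (\<tau> x) * F x) = (LINT t|time_law. \<psi> t * f t)"
proof -
  note F = assms[unfolded averages_to_def]
  show "F \<in> borel_measurable \<mu>" "\<exists>c. \<forall>x\<in>space \<mu>. \<bar>F x\<bar> \<le> c"
    "f \<in> borel_measurable borel" "integrable time_law f"
    using F by simp_all
  show "(LINT x|\<mu>. \<psi> (\<tau> x) * F x) = (LINT t|time_law. \<psi> t * f t)"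
    if "\<psi> \<in> borel_measurable borel" "\<And>x. x \<in> space \<mu> \<Longrightarrow> \<bar>\<psi> (\<tau> x)\<bar> \<le> b"
    using F[THEN conjunct2, THEN conjunct2, THEN conjunct2, THEN conjunct2, rule_format, OF that(1)] that(2)
    by blast
qed

lemma averages_to_integrable:
  assumes "averages_to F f" and \<psi>: "\<psi> \<in> borel_measurable borel" "\<And>x. x \<in> space \<mu> \<Longrightarrow> \<bar>\<psi> (\<tau> x)\<bar> \<le> b"
  shows "integrable \<mu> (\<lambda>x. \<psi> (\<tau> x) * F x)" "integrable time_law (\<lambda>t. \<psi> t * f t)"
proof -
  note F = averages_toD[OF assms(1)]
  obtain c where c: "\<And>x. x \<in> space \<mu> \<Longrightarrow> \<bar>F x\<bar> \<le> c" using F(2) by blast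
  show "integrable \<mu> (\<lambda>x. \<psi> (\<tau> x) * F x)"
  proof (rule integrable_bounded)
    show "(\<lambda>x. \<psi> (\<tau> x) * F x) \<in> borel_measurable \<mu>"
      using F(1) measurable_compose[OF \<tau> \<psi>(1)] by simp
    show "\<bar>\<psi> (\<tau> x) * F x\<bar> \<le> \<bar>b\<bar> * \<bar>c\<bar>" if "x \<in> space \<mu>" for x
      unfolding abs_mult using \<psi>(2)[OF that] c[OF that] by (intro mult_mono) auto
  qed
  show "integrable time_law (\<lambda>t. \<psi> t * f t)"
  proof (rule Bochner_Integration.integrable_bound)
    show "integrable time_law (\<lambda>t. b * f t)" using F(4) by simp
    show "(\<lambda>t. \<psi> t * f t) \<in> borel_measurable time_law" using \<psi>(1) F(3) by simp
    show "AE t in time_law. norm (\<psi> t * f t) \<le> norm (b * f t)"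
    proof -
      have "AE t in time_law. \<bar>\<psi> t\<bar> \<le> b" by (rule AE_time_law_bound[OF \<psi>(1)]) (rule \<psi>(2))
      then show ?thesis
      proof eventually_elim
        case (elim t)
        then show ?case by (simp add: abs_mult mult_right_mono)
      qed
    qed
  qed
qed

lemma averages_to_lincomb:
  assumes F: "averages_to F f" and G: "averages_to G g"
  shows "averages_to (\<lambda>x. a * F x + b * G x) (\<lambda>t. a * f t + b * g t)"
  unfolding averages_to_def
proof (intro conjI allI impI)
  note FD = averages_toD[OF F] and GD = averages_toD[OF G]
  show "(\<lambda>x. a * F x + b * G x) \<in> borel_measurable \<mu>" using FD GD by simp
  show "(\<lambda>t. a * f t + b * g t) \<in> borel_measurable borel" using FD GD by simp
  show "integrable time_law (\<lambda>t. a * f t + b * g t)" using FD GD by simp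
  obtain c1 c2 where c: "\<And>x. x \<in> space \<mu> \<Longrightarrow> \<bar>F x\<bar> \<le> c1" "\<And>x. x \<in> space \<mu> \<Longrightarrow> \<bar>G x\<bar> \<le> c2"
    using FD(2) GD(2) by blast
  have "\<bar>a * F x + b * G x\<bar> \<le> \<bar>a\<bar> * c1 + \<bar>b\<bar> * c2" if x: "x \<in> space \<mu>" for x
  proof -
    have "\<bar>a * F x\<bar> \<le> \<bar>a\<bar> * c1" "\<bar>b * G x\<bar> \<le> \<bar>b\<bar> * c2"
      unfolding abs_mult using c x by (intro mult_left_mono; simp)+
    then show ?thesis by linarith
  qed
  then show "\<exists>c. \<forall>x\<in>space \<mu>. \<bar>a * F x + b * G x\<bar> \<le> c" by blast
  fix \<psi> d assume \<psi>: "\<psi> \<in> borel_measurable borel" "\<forall>x\<in>space \<mu>. \<bar>\<psi> (\<tau> x)\<bar> \<le> (d::real)"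
  note * = averages_to_integrable[OF F \<psi>(1) bspec[OF \<psi>(2)]] averages_to_integrable[OF G \<psi>(1) bspec[OF \<psi>(2)]]
    FD(5)[OF \<psi>(1) bspec[OF \<psi>(2)]] GD(5)[OF \<psi>(1) bspec[OF \<psi>(2)]]
  have "(LINT x|\<mu>. \<psi> (\<tau> x) * (a * F x + b * G x)) = (LINT x|\<mu>. a * (\<psi> (\<tau> x) * F x) + b * (\<psi> (\<tau> x) * G x))"
    by (simp add: algebra_simps)
  also have "\<dots> = a * (LINT t|time_law. \<psi> t * f t) + b * (LINT t|time_law. \<psi> t * g t)"
    using * by simp
  also have "\<dots> = (LINT t|time_law. a * (\<psi> t * f t) + b * (\<psi> t * g t))"
    using * by simp
  finally show "(LINT x|\<mu>. \<psi> (\<tau> x) * (a * F x + b * G x)) = (LINT t|time_law. \<psi> t * (a * f t + b * g t))"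
    by (simp add: algebra_simps)
qed

lemma averages_to_time:
  assumes f: "f \<in> borel_measurable borel" "\<And>x. x \<in> space \<mu> \<Longrightarrow> \<bar>f (\<tau> x)\<bar> \<le> c"
  shows "averages_to (\<lambda>x. f (\<tau> x)) f"
  unfolding averages_to_def
proof (intro conjI allI impI)
  show "(\<lambda>x. f (\<tau> x)) \<in> borel_measurable \<mu>" using measurable_compose[OF \<tau> f(1)] .
  show "\<exists>c. \<forall>x\<in>space \<mu>. \<bar>f (\<tau> x)\<bar> \<le> c" using f(2) by blast
  show "f \<in> borel_measurable borel" by fact
  show "integrable time_law f"
  proof (rule finite_measure.integrable_const_bound[OF finite_time_law])
    show "AE t in time_law. norm (f t) \<le> c"
      unfolding real_norm_def by (rule AE_time_law_bound[OF f(1)]) (rule f(2))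
  qed (use f(1) in simp)
  fix \<psi> d assume \<psi>: "\<psi> \<in> borel_measurable borel" "\<forall>x\<in>space \<mu>. \<bar>\<psi> (\<tau> x)\<bar> \<le> (d::real)"
  show "(LINT x|\<mu>. \<psi> (\<tau> x) * f (\<tau> x)) = (LINT t|time_law. \<psi> t * f t)"
    using f(1) \<psi>(1) by (subst integral_time_law) auto
qed

lemma averages_to_sum:
  assumes "finite I" "\<And>i. i \<in> I \<Longrightarrow> averages_to (F i) (f i)"
  shows "averages_to (\<lambda>x. \<Sum>i\<in>I. c i * F i x) (\<lambda>t. \<Sum>i\<in>I. c i * f i t)"
  using assms
proof (induction I rule: finite_induct)
  case empty
  show ?case using averages_to_time[of "\<lambda>t. 0" 0] by simp
next
  case (insert i I)
  have "averages_to (\<lambda>x. c i * F i x + 1 * (\<Sum>i\<in>I. c i * F i x)) (\<lambda>t. c i * f i t + 1 * (\<Sum>i\<in>I. c i * f i t))"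
    by (intro averages_to_lincomb insert) auto
  then show ?case using insert.hyps by simp
qed

text \<open>Testing with the indicator of {f < 0} gives an integral that is nonnegative on the side
  of F and nonpositive on the side of f. In this way inequalities valid on the support of \<mu> pass
  to averages.\<close>

lemma averages_to_nonneg:
  assumes F: "averages_to F f" and nonneg: "\<And>x. x \<in> space \<mu> \<Longrightarrow> 0 \<le> F x"
  shows "AE t in time_law. 0 \<le> f t"
proof -
  note FD = averages_toD[OF F]
  define \<psi> :: "real \<Rightarrow> real" where "\<psi> = indicator {t. f t < 0}"
  have \<psi>: "\<psi> \<in> borel_measurable borel" unfolding \<psi>_def using FD(3) by simp
  have \<psi>1: "\<bar>\<psi> t\<bar> \<le> 1" "0 \<le> \<psi> t" for t by (auto simp: \<psi>_def indicator_def)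
  have "0 \<le> (LINT x|\<mu>. \<psi> (\<tau> x) * F x)"
    using nonneg \<psi>1 by (intro integral_nonneg_AE AE_I2) auto
  then have "(LINT t|time_law. - (\<psi> t * f t)) \<le> 0"
    using FD(5)[OF \<psi> \<psi>1(1)] by simp
  moreover have nn: "AE t in time_law. 0 \<le> - (\<psi> t * f t)"
    by (intro AE_I2) (auto simp: \<psi>_def indicator_def)
  ultimately have "(LINT t|time_law. - (\<psi> t * f t)) = 0"
    using integral_nonneg_AE[OF nn] by simp
  then have "AE t in time_law. - (\<psi> t * f t) = 0"
    using averages_to_integrable(2)[OF F \<psi> \<psi>1(1)] nn by (subst (asm) integral_nonneg_eq_0_iff_AE) auto
  then show ?thesis by eventually_elim (auto simp: \<psi>_def indicator_def split: if_splits)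
qed

text \<open>The image under \<tau> of the measure with density F + c is absolutely continuous with
  respect to the time law, and its Radon-Nikodym density is the average of F + c. The shift by c
  makes the density nonnegative and is undone at the end.\<close>

theorem averages_to_exists:
  assumes F: "F \<in> borel_measurable \<mu>" "\<And>x. x \<in> space \<mu> \<Longrightarrow> \<bar>F x\<bar> \<le> c"
  shows "\<exists>f. averages_to F f"
proof -
  interpret time: finite_measure time_law by (rule finite_time_law)
  define G where "G = (\<lambda>x. F x + c)"
  have G[measurable]: "G \<in> borel_measurable \<mu>" unfolding G_def using F(1) by simp
  have G0: "0 \<le> G x" "G x \<le> 2 * c" if "x \<in> space \<mu>" for x
    using F(2)[OF that] by (auto simp: G_def abs_le_iff)
  define N where "N = distr (density \<mu> G) borel \<tau>"
  have ac: "absolutely_continuous time_law N"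
    unfolding absolutely_continuous_def
  proof
    fix A assume A: "A \<in> null_sets time_law"
    then have [measurable]: "A \<in> sets borel" by auto
    have "\<tau> -` A \<inter> space \<mu> \<in> null_sets \<mu>"
      using A by (simp add: null_sets_def time_law_def emeasure_distr)
    then have "AE x in \<mu>. x \<notin> \<tau> -` A \<inter> space \<mu>" by (rule AE_not_in)
    then have "AE x in \<mu>. ennreal (G x) * indicator (\<tau> -` A \<inter> space \<mu>) x = 0"
      by eventually_elim simp
    then have "emeasure N A = 0"
      unfolding N_def by (simp add: emeasure_distr emeasure_density nn_integral_0_iff_AE)
    then show "A \<in> null_sets N" by (simp add: null_sets_def N_def)
  qed
  obtain f0 where f0: "f0 \<in> borel_measurable time_law" "density time_law f0 = N"
    using time.Radon_Nikodym[OF ac] by (auto simp: N_def)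
  have "(\<integral>\<^sup>+ t. f0 t \<partial>time_law) = emeasure N UNIV"
    using f0 by (simp flip: f0(2) add: emeasure_density)
  also have "\<dots> = (\<integral>\<^sup>+ x. ennreal (G x) \<partial>\<mu>)"
    unfolding N_def by (simp add: emeasure_distr emeasure_density cong: nn_integral_cong)
  also have "\<dots> < \<infinity>"
    using integrable_bounded[OF G, of "2 * c"] G0 by (simp add: integrable_iff_bounded cong: nn_integral_cong)
  finally have f0_fin: "(\<integral>\<^sup>+ t. f0 t \<partial>time_law) < \<infinity>" .
  then have f0_AE: "AE t in time_law. f0 t \<noteq> \<infinity>" using f0(1) by (intro nn_integral_PInf_AE) auto
  define g where "g = (\<lambda>t. enn2real (f0 t))"
  have gm: "g \<in> borel_measurable borel" unfolding g_def using f0(1) by simp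
  have g_f0: "AE t in time_law. ennreal (g t) = f0 t"
    using f0_AE by eventually_elim (simp add: g_def less_top)
  have N: "N = density time_law g"
    using f0 gm g_f0 by (subst f0(2)[symmetric], intro density_cong) auto
  have gint: "integrable time_law g"
  proof (rule integrableI_nonneg)
    show "(\<integral>\<^sup>+ t. ennreal (g t) \<partial>time_law) < \<infinity>"
      using f0_fin nn_integral_cong_AE[OF g_f0] by simp
  qed (use gm in \<open>auto simp: g_def\<close>)
  have "averages_to G g"
    unfolding averages_to_def
  proof (intro conjI allI impI)
    show "\<exists>c. \<forall>x\<in>space \<mu>. \<bar>G x\<bar> \<le> c" using G0 by (intro exI[of _ "2 * c"]) auto
    fix \<psi> d assume \<psi>: "\<psi> \<in> borel_measurable borel" "\<forall>x\<in>space \<mu>. \<bar>\<psi> (\<tau> x)\<bar> \<le> (d::real)"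
    have \<psi>\<tau>: "(\<lambda>x. \<psi> (\<tau> x)) \<in> borel_measurable \<mu>" using measurable_compose[OF \<tau> \<psi>(1)] .
    have "(LINT x|\<mu>. \<psi> (\<tau> x) * G x) = (LINT x|\<mu>. G x *\<^sub>R \<psi> (\<tau> x))" by (simp add: mult.commute)
    also have "\<dots> = (LINT x|density \<mu> G. \<psi> (\<tau> x))"
      using G0 \<psi>\<tau> by (intro integral_density[symmetric]) auto
    also have "\<dots> = (LINT t|N. \<psi> t)"
      unfolding N_def using \<psi>(1) by (intro integral_distr[symmetric]) auto
    also have "\<dots> = (LINT t|time_law. g t *\<^sub>R \<psi> t)"
      unfolding N using \<psi>(1) gm by (intro integral_density) (auto simp: g_def)
    finally show "(LINT x|\<mu>. \<psi> (\<tau> x) * G x) = (LINT t|time_law. \<psi> t * g t)" by (simp add: mult.commute)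
  qed (use G gm gint in auto)
  moreover have "averages_to (\<lambda>x. c) (\<lambda>t. c)" using averages_to_time[of "\<lambda>t. c" "\<bar>c\<bar>"] by simp
  ultimately have "averages_to (\<lambda>x. 1 * G x + (-1) * c) (\<lambda>t. 1 * g t + (-1) * c)"
    by (rule averages_to_lincomb)
  then show ?thesis by (auto simp: G_def)
qed

text \<open>Continuous ramps increase to the indicator functions of half-lines, so a law that integrates
  all continuous functions like Lebesgue measure is Lebesgue measure.\<close>

theorem time_law_lebesgue:
  assumes T: "T > 0"
    and test: "\<And>\<phi> \<phi>'. (\<And>t. (\<phi> has_real_derivative \<phi>' t) (at t)) \<Longrightarrow> continuous_on UNIV \<phi>' \<Longrightarrow>
      \<phi> T - \<phi> 0 = (LINT x|\<mu>. \<phi>' (\<tau> x))"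
  shows "time_law = distr (lebesgue_on {0..T}) borel (\<lambda>t. t)"
proof -
  interpret leb: finite_measure "lebesgue_on {0..T}" by (rule finite_measure_lebesgue_on_interval)
  let ?L = "distr (lebesgue_on {0..T}) borel (\<lambda>t. t)"
  have idm: "(\<lambda>t. t) \<in> lebesgue_on {0..T} \<rightarrow>\<^sub>M borel"
    by (intro continuous_imp_measurable_on_sets_lebesgue continuous_intros) simp
  have finL: "finite_measure ?L" by (rule leb.finite_measure_distr[OF idm])
  have cont: "(LINT t|time_law. \<psi> t) = (LINT t|?L. \<psi> t)"
    if \<psi>: "continuous_on UNIV \<psi>" for \<psi> :: "real \<Rightarrow> real"
  proof -
    \<comment> \<open>The hypothesis speaks of derivatives, so a continuous \<psi> is tested through
      a primitive on the whole line.\<close>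
    have "\<exists>\<phi>. \<forall>t::real. - \<infinity> < ereal t \<longrightarrow> ereal t < \<infinity> \<longrightarrow> (\<phi> has_vector_derivative \<psi> t) (at t)"
      using \<psi> by (intro einterval_antiderivative) (auto simp: continuous_on_eq_continuous_at)
    then obtain \<phi> where \<phi>: "\<And>t. (\<phi> has_real_derivative \<psi> t) (at t)"
      by (auto simp: has_real_derivative_iff_has_vector_derivative)
    have bm: "\<psi> \<in> borel_measurable borel" using \<psi> by (rule borel_measurable_continuous_onI)
    have "(LINT t|time_law. \<psi> t) = \<phi> T - \<phi> 0"
      using test[OF \<phi> \<psi>] by (simp add: integral_time_law[OF bm])
    also have "\<dots> = integral {0..T} \<psi>"
      using T \<phi> by (intro integral_unique[symmetric] fundamental_theorem_of_calculus)
        (auto simp: has_real_derivative_iff_has_vector_derivative[symmetric] intro: has_field_derivative_at_within)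
    also have "\<dots> = (LINT t|lebesgue_on {0..T}. \<psi> t)"
      by (intro lebesgue_integral_eq_integral[symmetric] continuous_imp_integrable_real
          continuous_on_subset[OF \<psi>]) auto
    also have "\<dots> = (LINT t|?L. \<psi> t)" by (rule integral_distr[OF idm bm, symmetric])
    finally show ?thesis .
  qed
  show ?thesis
  proof (rule measure_eqI_lessThan)
    fix x :: real
    define \<psi> where "\<psi> = (\<lambda>n::nat. \<lambda>t. min 1 (max 0 (real n * (t - x))))"
    have \<psi>c: "continuous_on UNIV (\<psi> n)" for n unfolding \<psi>_def by (intro continuous_intros)
    have lim: "(\<lambda>n. \<psi> n t) \<longlonglongrightarrow> indicator {x<..} t" for t
    proof (cases "t > x")
      case True
      then obtain m where "1 < real m * (t - x)" using reals_Archimedean3[of "t - x"] by auto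
      then have "\<psi> n t = 1" if "n \<ge> m" for n
      proof -
        have "real m * (t - x) \<le> real n * (t - x)" using that True by (intro mult_right_mono) auto
        then have "1 < real n * (t - x)" using \<open>1 < real m * (t - x)\<close> by linarith
        then show ?thesis by (simp add: \<psi>_def)
      qed
      then have "\<forall>\<^sub>F n in sequentially. \<psi> n t = 1" by (auto simp: eventually_sequentially)
      then show ?thesis using True by (simp add: tendsto_eventually)
    next
      case False
      then have "real n * (t - x) \<le> 0" for n by (intro mult_nonneg_nonpos) auto
      then have "\<psi> n t = 0" for n by (simp add: \<psi>_def max_absorb1)
      then show ?thesis using False by simp
    qed
    have half: "(\<lambda>n. LINT t|M. \<psi> n t) \<longlonglongrightarrow> measure M {x<..}"
      if "finite_measure M" "sets M = sets borel" for M
    proof -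
      interpret M: finite_measure M by fact
      have sp: "space M = UNIV" using sets_eq_imp_space_eq[OF that(2)] by simp
      have "(\<lambda>n. LINT t|M. \<psi> n t) \<longlonglongrightarrow> (LINT t|M. indicator {x<..} t)"
      proof (rule integral_dominated_convergence[where w = "\<lambda>_. 1"])
        show "\<psi> n \<in> borel_measurable M" for n
          using borel_measurable_continuous_onI[OF \<psi>c] measurable_cong_sets[OF that(2) refl] by blast
        show "(indicator {x<..} :: real \<Rightarrow> real) \<in> borel_measurable M" using that(2) by simp
        show "AE t in M. norm (\<psi> n t) \<le> 1" for n by (auto simp: \<psi>_def)
      qed (use lim in auto)
      then show ?thesis using that(2) by (simp add: sp)
    qed
    have "measure time_law {x<..} = measure ?L {x<..}"
      using half[OF finite_time_law] half[OF finL] cont[OF \<psi>c] by (intro LIMSEQ_unique) auto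
    then show "emeasure time_law {x<..} = emeasure ?L {x<..}"
      using finite_measure.emeasure_eq_measure[OF finite_time_law] finite_measure.emeasure_eq_measure[OF finL]
      by simp
    show "emeasure time_law {x<..} < \<infinity>"
      using finite_measure.emeasure_eq_measure[OF finite_time_law] by simp
  qed simp_all
qed

end

text \<open>Uniformly bounded continuous functions converge almost everywhere to the sign of d; in
  the limit the tests give the integral of the absolute value of d.\<close>

lemma continuous_test_AE_zero:
  fixes d :: "real \<Rightarrow> real"
  assumes T: "T > 0" and dm: "d \<in> borel_measurable (lebesgue_on {0..T})"
    and C: "\<And>t. t \<in> {0..T} \<Longrightarrow> \<bar>d t\<bar> \<le> C"
    and test: "\<And>\<psi>. continuous_on UNIV \<psi> \<Longrightarrow> (LINT t|lebesgue_on {0..T}. \<psi> t * d t) = 0"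
  shows "AE t in lebesgue_on {0..T}. d t = 0"
proof -
  interpret finite_measure "lebesgue_on {0..T}" by (rule finite_measure_lebesgue_on_interval)
  have sm: "(\<lambda>t. sgn (d t)) \<in> borel_measurable (lebesgue_on {0..T})"
    using dm by simp
  have s1: "\<bar>sgn (d t)\<bar> \<le> 1" for t by (simp add: abs_sgn_eq)
  obtain v where v: "\<And>n. continuous_on UNIV (v n)" "\<And>n t. \<bar>v n t\<bar> \<le> 1"
    "AE t in lebesgue_on {0..T}. (\<lambda>n. v n t) \<longlonglongrightarrow> sgn (d t)"
    using bounded_measurable_approx[OF sm s1] T by (meson less_imp_le)
  have vm: "v n \<in> borel_measurable (lebesgue_on {0..T})" for n
    using continuous_on_subset[OF v(1)] by (intro continuous_imp_measurable_on_sets_lebesgue) auto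
  have "(\<lambda>n. LINT t|lebesgue_on {0..T}. v n t * d t) \<longlonglongrightarrow> (LINT t|lebesgue_on {0..T}. sgn (d t) * d t)"
  proof (rule integral_dominated_convergence[where w = "\<lambda>_. C"])
    show "(\<lambda>t. sgn (d t) * d t) \<in> borel_measurable (lebesgue_on {0..T})"
      "(\<lambda>t. v n t * d t) \<in> borel_measurable (lebesgue_on {0..T})" for n
      using sm dm vm by (intro borel_measurable_times; simp)+
    show "AE t in lebesgue_on {0..T}. (\<lambda>n. v n t * d t) \<longlonglongrightarrow> sgn (d t) * d t"
      using v(3) by eventually_elim (intro tendsto_intros)
    show "AE t in lebesgue_on {0..T}. norm (v n t * d t) \<le> C" for n
    proof (rule AE_I2)
      fix t assume "t \<in> space (lebesgue_on {0..T})"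
      then have "\<bar>d t\<bar> \<le> C" using C by simp
      then show "norm (v n t * d t) \<le> C"
        using mult_mono[OF v(2)[of n t] \<open>\<bar>d t\<bar> \<le> C\<close>] by (simp add: abs_mult)
    qed
  qed simp
  then have "(LINT t|lebesgue_on {0..T}. sgn (d t) * d t) = 0"
    using test[OF v(1)] by (simp add: LIMSEQ_const_iff)
  then have "(LINT t|lebesgue_on {0..T}. \<bar>d t\<bar>) = 0" by (simp add: abs_sgn mult.commute)
  moreover have "integrable (lebesgue_on {0..T}) (\<lambda>t. \<bar>d t\<bar>)"
    using bounded_measurable_integrable(1)[OF dm C] by simp
  ultimately have "AE t in lebesgue_on {0..T}. \<bar>d t\<bar> = 0"
    by (subst (asm) integral_nonneg_eq_0_iff_AE) auto
  then show ?thesis by simp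
qed

section \<open>Recovering a control from a feasible measure\<close>

context mode_problem
begin

lemma B_continuous: "continuous_on S B"
  using B by (rule linear_continuous_on)

lemma continuous_on_h_section: "t \<in> {0..T} \<Longrightarrow> continuous_on U (h t)"
proof -
  assume t: "t \<in> {0..T}"
  have "continuous_on U (\<lambda>u. case (t, u) of (t, u) \<Rightarrow> h t u)"
    by (rule continuous_on_compose2[OF h]) (use t in \<open>auto intro!: continuous_intros\<close>)
  then show ?thesis by simp
qed

text \<open>A joint epigraph: an actual control in C has the same effect as v at cost at most r.
  Inputs are compared through B because the convexity hypothesis concerns their images; v itself
  need not lie in U. The parameter C serves the measurable selection, which tests against closed
  sets.\<close>

definition reach :: "(real^'m) set \<Rightarrow> (real \<times> (real^'m) \<times> real) set" where
  "reach C = {(t, v, r). t \<in> {0..T} \<and> (\<exists>u\<in>U \<inter> C. B u = B v \<and> h t u \<le> r)}"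

text \<open>It is the projection of a closed set along the compact factor U \<inter> C.\<close>

lemma closed_reach:
  assumes C: "closed C"
  shows "closed (reach C)"
proof -
  define A where "A = U \<times> {0..T} \<times> (UNIV :: ((real^'m) \<times> real) set)"
  have A: "closed A" unfolding A_def using U by (intro closed_Times) (auto intro: compact_imp_closed)
  have "continuous_on A (\<lambda>x. case (fst (snd x), fst x) of (t, u) \<Rightarrow> h t u)"
    by (rule continuous_on_compose2[OF h]) (auto simp: A_def intro!: continuous_intros)
  then have "closed {x \<in> A. h (fst (snd x)) (fst x) \<le> snd (snd (snd x))}"
    by (intro continuous_on_closed_Collect_le A continuous_intros) simp
  moreover have "closed {x :: (real^'m) \<times> real \<times> (real^'m) \<times> real. B (fst x) = B (fst (snd (snd x)))}"
    by (intro closed_Collect_eq continuous_on_compose2[OF B_continuous[of UNIV]] continuous_intros) auto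
  ultimately have "closed ({x \<in> A. h (fst (snd x)) (fst x) \<le> snd (snd (snd x))} \<inter>
      {x. B (fst x) = B (fst (snd (snd x)))})"
    by (rule closed_Int)
  from closed_compact_projection[OF compact_Int_closed[OF U C] this]
  have "closed {y. \<exists>u. u \<in> U \<inter> C \<and> (u, y) \<in> {x \<in> A. h (fst (snd x)) (fst x) \<le> snd (snd (snd x))} \<inter>
      {x. B (fst x) = B (fst (snd (snd x)))}}" .
  moreover have "{y. \<exists>u. u \<in> U \<inter> C \<and> (u, y) \<in> {x \<in> A. h (fst (snd x)) (fst x) \<le> snd (snd (snd x))} \<inter>
      {x. B (fst x) = B (fst (snd (snd x)))}} = reach C"
    by (auto simp: reach_def A_def)
  ultimately show ?thesis by simp
qed

text \<open>What remains of the hypothesis of (iii) after the summand A z has cancelled. It makes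
  the sections of \<open>reach UNIV\<close> at fixed times convex.\<close>

definition input_convex :: bool where
  "input_convex \<longleftrightarrow> (\<forall>t\<in>{0..T}. \<forall>u\<in>U. \<forall>v\<in>U. \<forall>a\<in>{0..1}. \<exists>w\<in>U.
     B w = (1 - a) *\<^sub>R B u + a *\<^sub>R B v \<and> h t w \<le> (1 - a) * h t u + a * h t v)"

text \<open>At a fixed time \<open>reach UNIV\<close> has a closed convex section containing all
  pairs (u, h t u). A point outside would be strictly separated from this section by some x,
  contrary to \<open>sep\<close>.\<close>

lemma mem_reach_by_separation:
  assumes conv: input_convex and t: "t \<in> {0..T}"
    and sep: "\<And>x :: (real^'m) \<times> real. \<exists>u\<in>U. inner x (u, h t u) \<le> inner x y"
  shows "(t, y) \<in> reach UNIV"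
proof (rule ccontr)
  assume not: "(t, y) \<notin> reach UNIV"
  define S where "S = Pair t -` reach UNIV"
  have clS: "closed S"
    unfolding S_def by (intro closed_vimage closed_reach continuous_intros)
  have cvS: "convex S"
    unfolding convex_alt
  proof (intro ballI allI impI)
    fix p q and a :: real assume p: "p \<in> S" and q: "q \<in> S" and a: "0 \<le> a \<and> a \<le> 1"
    obtain v1 r1 where p': "p = (v1, r1)" by fastforce
    obtain v2 r2 where q': "q = (v2, r2)" by fastforce
    obtain u1 where u1: "u1 \<in> U" "B u1 = B v1" "h t u1 \<le> r1" using p by (auto simp: S_def reach_def p')
    obtain u2 where u2: "u2 \<in> U" "B u2 = B v2" "h t u2 \<le> r2" using q by (auto simp: S_def reach_def q')
    obtain w where w: "w \<in> U" "B w = (1 - a) *\<^sub>R B u1 + a *\<^sub>R B u2"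
      "h t w \<le> (1 - a) * h t u1 + a * h t u2"
      using conv t u1(1) u2(1) a unfolding input_convex_def by (meson atLeastAtMost_iff)
    have "h t w \<le> (1 - a) * r1 + a * r2"
      using w(3) u1(3) u2(3) a mult_left_mono[OF u1(3), of "1 - a"] mult_left_mono[OF u2(3), of a] by linarith
    moreover have "B w = B ((1 - a) *\<^sub>R v1 + a *\<^sub>R v2)"
      using w(2) u1(2) u2(2) B by (simp add: linear_simps)
    ultimately show "(1 - a) *\<^sub>R p + a *\<^sub>R q \<in> S" using w(1) t by (auto simp: S_def reach_def p' q')
  qed
  have "y \<notin> S" using not by (simp add: S_def)
  then obtain x b where x: "inner x y < b" "\<forall>s\<in>S. b < inner x s"
    using separating_hyperplane_closed_point[OF cvS clS] by blast
  obtain u where u: "u \<in> U" "inner x (u, h t u) \<le> inner x y" using sep by blast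
  have "(u, h t u) \<in> S" using u(1) t by (auto simp: S_def reach_def)
  then show False using x u(2) by fastforce
qed

text \<open>Each inequality is obtained for almost every time, with an exceptional set depending on
  x, so only countably many x can be treated at once. A dense set suffices, because compactness of U
  makes the set of good x closed.\<close>

lemma separation_countable:
  fixes y :: "(real^'m) \<times> real"
  assumes t: "t \<in> {0..T}"
    and D: "\<And>X. open X \<Longrightarrow> X \<noteq> {} \<Longrightarrow> \<exists>d\<in>D. d \<in> X"
    and sep: "\<And>x. x \<in> D \<Longrightarrow> \<exists>u\<in>U. inner x (u, h t u) \<le> inner x y"
  shows "\<exists>u\<in>U. inner x (u, h t u) \<le> inner x y"
proof -
  define K where "K = (\<lambda>u. (u, h t u)) ` U"
  have K: "compact K"
    unfolding K_def by (intro compact_continuous_image continuous_intros continuous_on_h_section t U)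
  define X where "X = {x. \<exists>k. k \<in> K \<and> (k, x) \<in> {z :: ((real^'m) \<times> real) \<times> _. inner (snd z) (fst z) \<le> inner (snd z) y}}"
  have "closed X"
    unfolding X_def by (intro closed_compact_projection[OF K] closed_Collect_le continuous_intros)
  then have "open (- X)" by (simp add: open_Compl)
  moreover have "D \<inter> - X = {}" using sep by (auto simp: X_def K_def)
  ultimately have "- X = {}" using D by blast
  then show ?thesis by (auto simp: X_def K_def)
qed

end

context mode_problem
begin

lemma measurable_lebesgue_on_id: "(\<lambda>t. t) \<in> lebesgue_on {a..b::real} \<rightarrow>\<^sub>M borel"
  by (intro continuous_imp_measurable_on_sets_lebesgue continuous_intros) simp

text \<open>By linearity of the dynamics it suffices to average the measure over each instant of time.
  The averaged input and cost lie in the convex set \<open>reach UNIV\<close>, hence are dominated by an actual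
  control, and the averaged state solves the state equation of that control.\<close>

theorem control_from_measure:
  assumes p: "(\<mu>, \<mu>T) \<in> primal N" and conv: input_convex
  shows "\<exists>u\<in>mode_controls N. cost h T u \<le> lp_cost h \<mu>"
proof -
  let ?K = "domain N" and ?L = "lebesgue_on {0..T}"
  interpret leb: finite_measure ?L by (rule finite_measure_lebesgue_on_interval)
  note pD = primalD[OF p]
  have s\<mu>: "sets \<mu> = sets (restrict_space borel ?K)" and fin: "finite_measure \<mu>"
    using pD(1) by (auto simp: borel_measures_on_def)
  have sp: "space \<mu> = ?K" by (rule space_borel_measures_on[OF pD(1)])
  have meas: "F \<in> borel_measurable \<mu>" if "continuous_on ?K F" for F :: "_ \<Rightarrow> real"
    using borel_measurable_continuous_on_restrict[OF that] measurable_cong_sets[OF s\<mu> refl] by blast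
  have bnd: "\<exists>c. \<forall>x\<in>?K. \<bar>F x\<bar> \<le> c" if "continuous_on ?K F" for F :: "_ \<Rightarrow> real"
    using that compact_S_N by (rule compact_continuous_bounded)
  define \<tau> :: "(real \<times> (nat \<Rightarrow> real)) \<times> (real^'m) \<Rightarrow> real" where "\<tau> = (\<lambda>p. fst (fst p))"
  have \<tau>c: "continuous_on ?K \<tau>" unfolding \<tau>_def by (intro continuous_intros)
  have \<tau>T: "\<tau> x \<in> {0..T}" if "x \<in> ?K" for x using that by (auto simp: \<tau>_def S_N_def Sigma_N_def)
  interpret timed_measure \<mu> \<tau>
    using fin meas[OF \<tau>c] by (simp add: timed_measure_def timed_measure_axioms_def)
  \<comment> \<open>As the terminal measure has mass 1, the constraints for functions of time say
    that the time marginal integrates derivatives like Lebesgue measure.\<close>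
  have law: "time_law = distr ?L borel (\<lambda>t. t)"
    using primal_time_test[OF p] primal_mass[OF p] by (intro time_law_lebesgue[OF T]) (simp add: \<tau>_def)
  have law_int: "(LINT t|time_law. f t) = (LINT t|?L. f t)" if "f \<in> borel_measurable borel" for f :: "real \<Rightarrow> real"
    unfolding law by (rule integral_distr[OF measurable_lebesgue_on_id that])
  have law_AE: "AE t in ?L. P t" if "AE t in time_law. P t" for P
    using AE_distrD[OF measurable_lebesgue_on_id] that unfolding law by blast
  have borel_L: "f \<in> borel_measurable ?L" if "f \<in> borel_measurable borel" for f :: "real \<Rightarrow> 'b::topological_space"
    using measurable_compose[OF measurable_lebesgue_on_id that] by simp
  have ex: "\<exists>f. averages_to F f" if "continuous_on ?K F" for F
    using averages_to_exists[OF meas[OF that]] bnd[OF that] by (auto simp: sp)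

  have "\<forall>i. \<exists>f. averages_to (\<lambda>p. snd p $ i) f"
    by (intro allI ex continuous_intros)
  then obtain ub where ub: "\<And>i. averages_to (\<lambda>p. snd p $ i) (ub i)" by metis
  obtain hb where hb: "averages_to running hb" using ex[OF continuous_on_running] by blast
  have coordc: "continuous_on ?K (\<lambda>p. snd (fst p) k)" for k
    by (rule continuous_on_product_then_coordinatewise) (intro continuous_intros)
  have "\<forall>k. \<exists>f. averages_to (\<lambda>p. snd (fst p) k) f"
    by (intro allI ex coordc)
  then obtain zb where zb: "\<And>k. averages_to (\<lambda>p. snd (fst p) k) (zb k)" by metis
  define ubar where "ubar = (\<lambda>t. \<chi> i. ub i t)"
  have ubm: "ub i \<in> borel_measurable borel" for i using averages_toD(3)[OF ub] .
  have ubarm: "ubar \<in> borel_measurable borel"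
    unfolding ubar_def
    by (subst borel_measurable_euclidean_space) (auto simp: Basis_vec_def inner_axis intro: ubm)
  have hbm: "hb \<in> borel_measurable borel" using averages_toD(3)[OF hb] .
  have Kne: "?K \<noteq> {}" using primal_mass(2)[OF p] T by auto
  then obtain u0 where u0: "u0 \<in> U" by (auto simp: S_N_def)

  \<comment> \<open>For fixed x = (a, b), \<sigma> t is the minimum over U of the functional u
    \<mapsto> inner x (u, h t u). On the support of \<mu> the functional is never below \<sigma>,
    and this survives averaging at fixed time; a minimiser is the required u.\<close>
  have half: "AE t in time_law. t \<in> {0..T} \<longrightarrow> (\<exists>u\<in>U. inner x (u, h t u) \<le> inner x (ubar t, hb t))"
    for x :: "(real^'m) \<times> real"
  proof -
    obtain a b where x: "x = (a, b)" by fastforce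
    define f where "f = (\<lambda>t u. inner a u + b * h t u)"
    have fc: "continuous_on ({0..T} \<times> U) (\<lambda>(t, u). f t u)"
      using h unfolding f_def split_def by (intro continuous_intros)
    have fct: "continuous_on U (f t)" if "t \<in> {0..T}" for t
      unfolding f_def by (intro continuous_intros continuous_on_h_section that)
    define \<sigma> where "\<sigma> = (\<lambda>t. if t \<in> {0..T} then Inf (f t ` U) else 0)"
    have attain: "\<exists>u\<in>U. \<sigma> t = f t u \<and> (\<forall>v\<in>U. f t u \<le> f t v)" if t: "t \<in> {0..T}" for t
    proof -
      obtain u where u: "u \<in> U" "\<forall>v\<in>U. f t u \<le> f t v"
        using continuous_attains_inf[OF U _ fct[OF t]] u0 by blast
      then have "Inf (f t ` U) = f t u" by (intro cInf_eq_minimum) auto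
      then show ?thesis using u t by (auto simp: \<sigma>_def)
    qed
    obtain c where "\<forall>x\<in>{0..T} \<times> U. \<bar>(\<lambda>(t, u). f t u) x\<bar> \<le> c"
      using compact_continuous_bounded[OF fc compact_Times[OF compact_Icc U]] by blast
    then have c: "\<bar>f t u\<bar> \<le> c" if "t \<in> {0..T}" "u \<in> U" for t u using that by fastforce
    \<comment> \<open>Within [0, T] the sublevel sets of \<sigma> are projections of compact sets,
      because the minimum is attained.\<close>
    have \<sigma>m: "\<sigma> \<in> borel_measurable borel"
      unfolding borel_measurable_iff_le
    proof
      fix r
      define Kr where "Kr = {x \<in> {0..T} \<times> U. (\<lambda>(t, u). f t u) x \<le> r}"
      have "closed Kr"
        unfolding Kr_def using U
        by (intro continuous_on_closed_Collect_le fc closed_Times continuous_intros) (auto intro: compact_imp_closed)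
      then have "compact (({0..T} \<times> U) \<inter> Kr)" using U by (intro compact_Int_closed compact_Times) auto
      then have "compact (fst ` (({0..T} \<times> U) \<inter> Kr))"
        by (intro compact_continuous_image continuous_intros)
      moreover have "fst ` (({0..T} \<times> U) \<inter> Kr) = {t \<in> {0..T}. \<sigma> t \<le> r}"
      proof (intro set_eqI iffI)
        fix t assume "t \<in> fst ` (({0..T} \<times> U) \<inter> Kr)"
        then obtain u where tu: "t \<in> {0..T}" "u \<in> U" "f t u \<le> r" by (auto simp: Kr_def)
        obtain u' where "\<sigma> t = f t u'" "\<forall>v\<in>U. f t u' \<le> f t v" using attain[OF tu(1)] by blast
        then have "\<sigma> t \<le> f t u" using tu(2) by simp
        then show "t \<in> {t \<in> {0..T}. \<sigma> t \<le> r}" using tu by simp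
      next
        fix t assume t: "t \<in> {t \<in> {0..T}. \<sigma> t \<le> r}"
        then obtain u where "u \<in> U" "\<sigma> t = f t u" using attain[of t] by blast
        then have "(t, u) \<in> ({0..T} \<times> U) \<inter> Kr" using t by (simp add: Kr_def)
        then show "t \<in> fst ` (({0..T} \<times> U) \<inter> Kr)" by (metis fst_conv image_eqI)
      qed
      ultimately have "{t \<in> {0..T}. \<sigma> t \<le> r} \<in> sets borel" by (simp add: borel_closed compact_imp_closed)
      moreover have "{t \<in> - {0..T}. \<sigma> t \<le> r} = (if 0 \<le> r then - {0..T} else {})"
        by (auto simp: \<sigma>_def)
      then have "{t \<in> - {0..T}. \<sigma> t \<le> r} \<in> sets borel" by simp
      moreover have "{w \<in> space borel. \<sigma> w \<le> r} = {t \<in> {0..T}. \<sigma> t \<le> r} \<union> {t \<in> - {0..T}. \<sigma> t \<le> r}"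
        by auto
      ultimately show "{w \<in> space borel. \<sigma> w \<le> r} \<in> sets borel" by simp
    qed
    have \<sigma>c: "\<bar>\<sigma> (\<tau> x)\<bar> \<le> c" if "x \<in> space \<mu>" for x
    proof -
      have t: "\<tau> x \<in> {0..T}" using \<tau>T that by (simp add: sp)
      obtain u where "u \<in> U" "\<sigma> (\<tau> x) = f (\<tau> x) u" using attain[OF t] by blast
      then show ?thesis using c[OF t] by simp
    qed
    have "averages_to (\<lambda>p. 1 * (1 * (\<Sum>i\<in>UNIV. a $ i * (snd p $ i)) + b * running p) + (-1) * \<sigma> (\<tau> p))
        (\<lambda>t. 1 * (1 * (\<Sum>i\<in>UNIV. a $ i * ub i t) + b * hb t) + (-1) * \<sigma> t)"
      by (intro averages_to_lincomb averages_to_sum ub hb averages_to_time[OF \<sigma>m \<sigma>c]) auto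
    then have "AE t in time_law. 0 \<le> 1 * (1 * (\<Sum>i\<in>UNIV. a $ i * ub i t) + b * hb t) + (-1) * \<sigma> t"
    proof (rule averages_to_nonneg)
      fix q assume "q \<in> space \<mu>"
      then obtain t z u where q: "q = ((t, z), u)" "((t, z), u) \<in> ?K" by (cases q) (auto simp: sp)
      then have tu: "t \<in> {0..T}" "u \<in> U" by (auto simp: S_N_def Sigma_N_def)
      obtain u' where "\<sigma> t = f t u'" "\<forall>v\<in>U. f t u' \<le> f t v" using attain[OF tu(1)] by blast
      then have "\<sigma> t \<le> f t u" using tu(2) by simp
      then show "0 \<le> 1 * (1 * (\<Sum>i\<in>UNIV. a $ i * (snd q $ i)) + b * running q) + (-1) * \<sigma> (\<tau> q)"
        by (simp add: q(1) \<tau>_def f_def inner_vec_def)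
    qed
    then show ?thesis
    proof eventually_elim
      case (elim t)
      show ?case
      proof
        assume "t \<in> {0..T}"
        then obtain u where u: "u \<in> U" "\<sigma> t = f t u" using attain by blast
        show "\<exists>u\<in>U. inner x (u, h t u) \<le> inner x (ubar t, hb t)"
          using u elim by (intro bexI[OF _ u(1)]) (simp add: x f_def inner_vec_def ubar_def)
      qed
    qed
  qed
  define G where "G = {t. (t, ubar t, hb t) \<in> reach UNIV}"
  have pair_m: "(\<lambda>t. (t, ubar t, hb t)) \<in> borel_measurable borel"
    by (intro borel_measurable_Pair ubarm hbm) simp
  have reach_m: "{t. (t, ubar t, hb t) \<in> reach C} \<in> sets borel" if "closed C" for C
  proof -
    have "reach C \<in> sets borel" using closed_reach[OF that] by (rule borel_closed)
    from measurable_sets[OF pair_m this] show ?thesis by (simp add: vimage_def)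
  qed
  have G_AE: "AE t in ?L. t \<in> G"
  proof -
    obtain D :: "((real^'m) \<times> real) set" where D: "countable D" "\<And>X. open X \<Longrightarrow> X \<noteq> {} \<Longrightarrow> \<exists>d\<in>D. d \<in> X"
      using countable_dense_exists by blast
    have "AE t in time_law. \<forall>x\<in>D. t \<in> {0..T} \<longrightarrow> (\<exists>u\<in>U. inner x (u, h t u) \<le> inner x (ubar t, hb t))"
      unfolding AE_ball_countable[OF D(1)] by (intro ballI half)
    then have "AE t in ?L. \<forall>x\<in>D. t \<in> {0..T} \<longrightarrow> (\<exists>u\<in>U. inner x (u, h t u) \<le> inner x (ubar t, hb t))"
      by (rule law_AE)
    then show ?thesis
    proof (rule AE_mp, intro AE_I2 impI)
      fix t assume "t \<in> space ?L" and *: "\<forall>x\<in>D. t \<in> {0..T} \<longrightarrow> (\<exists>u\<in>U. inner x (u, h t u) \<le> inner x (ubar t, hb t))"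
      then have t: "t \<in> {0..T}" by simp
      show "t \<in> G"
        unfolding G_def mem_Collect_eq
        by (rule mem_reach_by_separation[OF conv t separation_countable[OF t D(2)]]) (use * t in auto)
    qed
  qed

  \<comment> \<open>On G the admissible values are those with the averaged effect and at most the
    averaged cost. Off G, which includes all times outside [0, T], the constant u0 keeps the values
    nonempty.\<close>
  define F where "F = (\<lambda>t. if t \<in> G then {u \<in> U. h t u \<le> hb t} \<inter> {u. B u = B (ubar t)} else {u0})"
  have "\<exists>f \<in> borel_measurable borel. \<forall>t\<in>space (borel :: real measure). f t \<in> F t"
  proof (rule compact_measurable_selection)
    fix t
    show "compact (F t)"
    proof (cases "t \<in> G")
      case True
      then have t: "t \<in> {0..T}" by (auto simp: G_def reach_def)
      have "closed {u \<in> U. h t u \<le> hb t}"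
        using U by (intro continuous_on_closed_Collect_le continuous_on_h_section t continuous_intros)
          (auto intro: compact_imp_closed)
      moreover have "closed {u. B u = B (ubar t)}"
        by (intro closed_Collect_eq B_continuous continuous_intros)
      ultimately have "compact (U \<inter> ({u \<in> U. h t u \<le> hb t} \<inter> {u. B u = B (ubar t)}))"
        by (intro compact_Int_closed U closed_Int)
      moreover have "U \<inter> ({u \<in> U. h t u \<le> hb t} \<inter> {u. B u = B (ubar t)}) = F t" using True by (auto simp: F_def)
      ultimately show ?thesis by simp
    qed (simp add: F_def)
    show "F t \<noteq> {}" by (auto simp: F_def G_def reach_def)
  next
    fix C :: "(real^'m) set" assume C: "closed C"
    have "{t \<in> space borel. F t \<inter> C \<noteq> {}} =
        {t. (t, ubar t, hb t) \<in> reach C} \<union> (if u0 \<in> C then - G else {})"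
      by (auto simp: F_def G_def reach_def)
    moreover have "G \<in> sets borel" unfolding G_def by (rule reach_m) simp
    ultimately show "{t \<in> space borel. F t \<inter> C \<noteq> {}} \<in> sets borel" using reach_m[OF C] by auto
  qed
  then obtain u where um: "u \<in> borel_measurable borel" and u: "\<And>t. u t \<in> F t" by auto
  have uU: "u t \<in> U" for t using u[of t] u0 by (auto simp: F_def split: if_splits)
  have uG: "h t (u t) \<le> hb t" "B (u t) = B (ubar t)" if "t \<in> G" for t
    using u[of t] that by (auto simp: F_def)
  have controls: "u \<in> controls U T"
    unfolding controls_def using borel_L[OF um] uU compact_imp_bounded[OF U] by (auto intro: bounded_subset)

  have cost: "cost h T u \<le> lp_cost h \<mu>"
  proof -
    have "(\<lambda>t. (t, u t)) \<in> ?L \<rightarrow>\<^sub>M restrict_space borel ({0..T} \<times> U)"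
      using borel_L[OF borel_measurable_Pair[OF _ um, of "\<lambda>t. t"]] uU
      by (intro measurable_restrict_space2) auto
    from measurable_compose[OF this borel_measurable_continuous_on_restrict[OF h]]
    have hm: "(\<lambda>t. h t (u t)) \<in> borel_measurable ?L" by simp
    obtain c where "\<forall>x\<in>{0..T} \<times> U. \<bar>(\<lambda>(t, u). h t u) x\<bar> \<le> c"
      using compact_continuous_bounded[OF h compact_Times[OF compact_Icc U]] by blast
    then have "\<bar>h t v\<bar> \<le> c" if "t \<in> {0..T}" "v \<in> U" for t v using that by fastforce
    then have hi: "integrable ?L (\<lambda>t. h t (u t))"
      using uU by (intro bounded_measurable_integrable(1)[OF hm]) auto
    have hbi: "integrable ?L hb"
      using averages_toD(4)[OF hb] integrable_distr_eq[OF measurable_lebesgue_on_id hbm] by (simp add: law)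
    have "cost h T u \<le> (LINT t|?L. hb t)"
      unfolding cost_def
    proof (rule integral_mono_AE[OF hi hbi])
      show "AE t in ?L. h t (u t) \<le> hb t" using G_AE by eventually_elim (rule uG(1))
    qed
    also have "\<dots> = (LINT t|time_law. 1 * hb t)" using law_int[OF hbm] by simp
    also have "\<dots> = (LINT x|\<mu>. 1 * running x)"
      by (rule averages_toD(5)[OF hb, of "\<lambda>t. 1" 1, symmetric]) auto
    finally show ?thesis by (simp add: lp_cost_running)
  qed

  have "\<forall>k. \<exists>a b. mode_set \<Psi> Zs k = {a..b}" using Zs by blast
  then obtain a b where ab: "\<And>k. mode_set \<Psi> Zs k = {a k..b k}" by metis
  obtain t1 z1 u1 where z1: "((t1, z1), u1) \<in> ?K" using Kne by (metis ex_in_conv surj_pair)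
  have ab_le: "a k \<le> b k" if "k < N" for k
  proof -
    have "z1 k \<in> {a k..b k}" using z1 that by (auto simp: S_N_def Sigma_N_def mode_box_def ab PiE_iff)
    then show ?thesis by simp
  qed
  \<comment> \<open>The average \<open>zb k\<close> is known to lie in the state interval only
    almost everywhere. Clamping changes it on a null set and makes the field w k bounded at every
    time.\<close>
  define zc where "zc = (\<lambda>k t. max (a k) (min (b k) (zb k t)))"
  have zbm: "zb k \<in> borel_measurable borel" for k using averages_toD(3)[OF zb] .
  have zcm: "zc k \<in> borel_measurable borel" for k unfolding zc_def using zbm by simp
  have zc_mem: "zc k t \<in> mode_set \<Psi> Zs k" if "k < N" for k t
    using ab_le[OF that] unfolding ab zc_def by simp
  have zc_AE: "AE t in ?L. zc k t = zb k t" if k: "k < N" for k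
  proof -
    have zk: "a k \<le> snd (fst q) k" "snd (fst q) k \<le> b k" if "q \<in> space \<mu>" for q
    proof -
      obtain t y v where q: "q = ((t, y), v)" by (metis surj_pair)
      then have "y \<in> mode_box \<Psi> Zs N" using that by (simp add: sp S_N_def Sigma_N_def)
      then have "y k \<in> {a k..b k}" using k by (simp add: mode_box_def PiE_iff ab)
      then show "a k \<le> snd (fst q) k" "snd (fst q) k \<le> b k" by (simp_all add: q)
    qed
    have const: "averages_to (\<lambda>p. c) (\<lambda>t. c)" for c
      using averages_to_time[of "\<lambda>t. c" "\<bar>c\<bar>"] by simp
    have "AE t in time_law. 0 \<le> 1 * zb k t + (-1) * a k"
      by (rule averages_to_nonneg[OF averages_to_lincomb[OF zb const]]) (use zk in simp)
    moreover have "AE t in time_law. 0 \<le> (-1) * zb k t + 1 * b k"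
      by (rule averages_to_nonneg[OF averages_to_lincomb[OF zb const]]) (use zk in simp)
    ultimately have "AE t in time_law. zc k t = zb k t"
      by eventually_elim (auto simp: zc_def)
    then show ?thesis by (rule law_AE)
  qed

  define w where "w = (\<lambda>k t. mode_field lam B \<Psi> k (zc k t) (u t))"
  have wm: "w k \<in> borel_measurable ?L" for k
  proof -
    have "(\<lambda>t. mode_input B \<Psi> k (u t)) \<in> borel_measurable borel"
      using um continuous_on_mode_input[OF B] by (rule borel_measurable_continuous_on[rotated])
    then show ?thesis unfolding w_def mode_field_def using zcm by (intro borel_L) simp
  qed
  have "\<exists>c. \<forall>t. \<bar>w k t\<bar> \<le> c" if k: "k < N" for k
  proof -
    have "\<bar>zc k t\<bar> \<le> \<bar>a k\<bar> + \<bar>b k\<bar>" for t using zc_mem[OF k, of t] by (auto simp: ab)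
    then show ?thesis
      using mode_field_bounded[of "\<bar>a k\<bar> + \<bar>b k\<bar>" k] uU unfolding w_def by meson
  qed
  then obtain c where c: "\<And>k t. k < N \<Longrightarrow> \<bar>w k t\<bar> \<le> c k" by metis
  define z where "z = (\<lambda>k t. mode \<Psi> z0 k + integral {0..t} (w k))"
  have wint: "w k integrable_on {0..T}" if "k < N" for k
    by (rule bounded_measurable_integrable(2)[OF wm c[OF that]])
  have zcont: "continuous_on {0..T} (z k)" if "k < N" for k
    unfolding z_def by (intro continuous_intros indefinite_integral_continuous_1 wint that)
  \<comment> \<open>The mean terminal state: it stays in the terminal interval because \<mu>T has
    mass 1, and it will be the end point of z k.\<close>
  define e where "e = (\<lambda>k. LINT z|\<mu>T. z k)"

  text \<open>The linear test functions \<open>\<phi>(t) z\<^sub>k\<close> compare the averaged state \<open>zc k\<close> with the solution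
    \<open>z k\<close> of the state equation.\<close>
  have compare: "(LINT t|?L. \<phi>' t * (zc k t - z k t)) = \<phi> T * (e k - z k T)"
    if k: "k < N" and \<phi>: "\<And>t. (\<phi> has_real_derivative \<phi>' t) (at t)" and \<phi>': "continuous_on UNIV \<phi>'"
    for k \<phi> \<phi>'
  proof -
    have \<phi>c: "continuous_on UNIV \<phi>"
      using \<phi> DERIV_continuous_on[of UNIV \<phi> \<phi>'] by simp
    have \<phi>m: "\<phi> \<in> borel_measurable borel" "\<phi>' \<in> borel_measurable borel"
      using \<phi>c \<phi>' by (auto intro: borel_measurable_continuous_onI)
    have bd: "\<exists>b. \<forall>x\<in>space \<mu>. \<bar>f (\<tau> x)\<bar> \<le> b" if f: "continuous_on UNIV f" for f :: "real \<Rightarrow> real"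
    proof -
      obtain b where b: "\<forall>t\<in>{0..T}. \<bar>f t\<bar> \<le> b"
        using compact_continuous_bounded[OF continuous_on_subset[OF f subset_UNIV] compact_Icc] by blast
      have "\<bar>f (\<tau> x)\<bar> \<le> b" if "x \<in> ?K" for x using b \<tau>T[OF that] by (rule bspec)
      then show ?thesis unfolding sp by blast
    qed
    obtain b1 where b1: "\<And>x. x \<in> space \<mu> \<Longrightarrow> \<bar>\<phi> (\<tau> x)\<bar> \<le> b1" using bd[OF \<phi>c] by blast
    obtain b2 where b2: "\<And>x. x \<in> space \<mu> \<Longrightarrow> \<bar>\<phi>' (\<tau> x)\<bar> \<le> b2" using bd[OF \<phi>'] by blast
    define \<beta> where "\<beta> = (\<lambda>i. inner (B (axis i 1)) (\<Psi> k))"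
    have inp: "mode_input B \<Psi> k v = (\<Sum>i\<in>UNIV. \<beta> i * v $ i)" for v
    proof -
      have "B (axis i (v $ i)) = v $ i *\<^sub>R B (axis i 1)" for i
      proof -
        have "axis i (v $ i) = v $ i *\<^sub>R axis i (1::real)" by (simp add: vec_eq_iff axis_def)
        then show ?thesis using B by (simp add: linear_simps)
      qed
      then show ?thesis by (simp add: mode_input_def component_def \<beta>_def mult.commute)
    qed
    have fld: "averages_to (\<lambda>q. lam k * snd (fst q) k + 1 * (\<Sum>i\<in>UNIV. \<beta> i * (snd q $ i)))
        (\<lambda>t. lam k * zb k t + 1 * (\<Sum>i\<in>UNIV. \<beta> i * ub i t))"
      by (intro averages_to_lincomb averages_to_sum zb ub) auto
    have fldm: "(\<lambda>t. lam k * zb k t + 1 * (\<Sum>i\<in>UNIV. \<beta> i * ub i t)) \<in> borel_measurable borel"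
      by (rule averages_toD(3)[OF fld])
    \<comment> \<open>The equality B (u t) = B (ubar t) allows the selected control to replace the
      averaged input, so the averaged field becomes w k.\<close>
    have w_AE: "AE t in ?L. lam k * zb k t + 1 * (\<Sum>i\<in>UNIV. \<beta> i * ub i t) = w k t"
      using G_AE zc_AE[OF k]
    proof eventually_elim
      case (elim t)
      have "mode_input B \<Psi> k (u t) = mode_input B \<Psi> k (ubar t)"
        using uG(2)[OF elim(1)] by (simp add: mode_input_eq[OF B])
      also have "\<dots> = (\<Sum>i\<in>UNIV. \<beta> i * ub i t)" by (simp add: inp ubar_def)
      finally show ?case using elim(2) by (simp add: w_def mode_field_def)
    qed
    note g = C1_functions_time_coord[OF \<phi> \<phi>' k] and lg = liouville_time_coord[OF \<phi> \<phi>' S_N_mode_space k,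
        where lam = lam and B = B and \<Psi> = \<Psi>]
    note i1 = averages_to_integrable[OF zb \<phi>m(2) b2, of k] averages_to_integrable[OF fld \<phi>m(1) b1]
    have "\<phi> T * e k - \<phi> 0 * mode \<Psi> z0 k =
        (LINT z|\<mu>T. (case (T, z) of (t, z) \<Rightarrow> \<phi> t * z k)) - (case start N of (t, z) \<Rightarrow> \<phi> t * z k)"
      using k by (simp add: e_def mode_point_def)
    also have "\<dots> = (LINT q|\<mu>. \<L> N (\<lambda>(t, z). \<phi> t * z k) q)"
      by (rule pD(3)[OF g])
    also have "\<dots> = (LINT q|\<mu>. \<phi>' (\<tau> q) * snd (fst q) k +
        \<phi> (\<tau> q) * (lam k * snd (fst q) k + 1 * (\<Sum>i\<in>UNIV. \<beta> i * (snd q $ i))))"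
      by (intro Bochner_Integration.integral_cong refl)
        (auto simp: sp lg \<tau>_def mode_field_def inp)
    also have "\<dots> = (LINT t|time_law. \<phi>' t * zb k t) +
        (LINT t|time_law. \<phi> t * (lam k * zb k t + 1 * (\<Sum>i\<in>UNIV. \<beta> i * ub i t)))"
      using i1 averages_toD(5)[OF zb \<phi>m(2) b2, of k] averages_toD(5)[OF fld \<phi>m(1) b1] by simp
    also have "(LINT t|time_law. \<phi>' t * zb k t) = (LINT t|?L. \<phi>' t * zb k t)"
      by (rule law_int) (use \<phi>m zbm in simp)
    also have "\<dots> = (LINT t|?L. \<phi>' t * zc k t)"
      by (intro integral_cong_AE borel_L borel_measurable_times \<phi>m zbm zcm)
        (use zc_AE[OF k] in eventually_elim, simp)
    also have "(LINT t|time_law. \<phi> t * (lam k * zb k t + 1 * (\<Sum>i\<in>UNIV. \<beta> i * ub i t))) =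
        (LINT t|?L. \<phi> t * (lam k * zb k t + 1 * (\<Sum>i\<in>UNIV. \<beta> i * ub i t)))"
      by (rule law_int) (use borel_measurable_times[OF \<phi>m(1) fldm] in simp)
    also have "\<dots> = (LINT t|?L. \<phi> t * w k t)"
      by (intro integral_cong_AE borel_measurable_times borel_L[OF \<phi>m(1)] borel_L[OF fldm] wm)
        (use w_AE in eventually_elim, simp)
    finally have lhs: "\<phi> T * e k - \<phi> 0 * mode \<Psi> z0 k =
        (LINT t|?L. \<phi>' t * zc k t) + (LINT t|?L. \<phi> t * w k t)" .
    have parts: "(LINT t|?L. \<phi>' t * z k t + \<phi> t * w k t) = \<phi> T * z k T - \<phi> 0 * mode \<Psi> z0 k"
      by (rule integral_by_parts_indefinite(2)[OF \<phi> \<phi>' T wm c[OF k]]) (simp add: z_def)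
    have J1: "integrable ?L (\<lambda>t. \<phi>' t * zc k t)"
    proof -
      obtain m where m: "\<forall>t\<in>{0..T}. \<bar>\<phi>' t\<bar> \<le> m"
        using compact_continuous_bounded[OF continuous_on_subset[OF \<phi>' subset_UNIV] compact_Icc] by blast
      have "\<bar>\<phi>' t * zc k t\<bar> \<le> m * (\<bar>a k\<bar> + \<bar>b k\<bar>)" if "t \<in> {0..T}" for t
      proof -
        have "\<bar>zc k t\<bar> \<le> \<bar>a k\<bar> + \<bar>b k\<bar>" using zc_mem[OF k, of t] by (auto simp: ab)
        then show ?thesis unfolding abs_mult using bspec[OF m that] by (intro mult_mono) auto
      qed
      then show ?thesis
        by (rule bounded_measurable_integrable(1)[OF borel_L[OF borel_measurable_times[OF \<phi>m(2) zcm]]])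
    qed
    have J2: "integrable ?L (\<lambda>t. \<phi>' t * z k t)"
      by (intro continuous_imp_integrable_real continuous_intros zcont k continuous_on_subset[OF \<phi>']) auto
    have "integrable ?L (\<lambda>t. \<phi>' t * z k t + \<phi> t * w k t)"
      by (rule integral_by_parts_indefinite(1)[OF \<phi> \<phi>' T wm c[OF k]]) (simp add: z_def)
    from Bochner_Integration.integrable_diff[OF this J2]
    have J3: "integrable ?L (\<lambda>t. \<phi> t * w k t)" by simp
    show ?thesis
      using lhs parts J1 J2 J3 by (simp add: right_diff_distrib)
  qed
  \<comment> \<open>The test function \<phi> = 1 removes the left-hand side of
    \<open>compare\<close>.\<close>
  have end_eq: "z k T = e k" if "k < N" for k
    using compare[OF that, of "\<lambda>t. 1" "\<lambda>t. 0"] by simp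
  have z_AE: "AE t in ?L. zc k t - z k t = 0" if k: "k < N" for k
  proof -
    obtain m where m: "\<forall>t\<in>{0..T}. \<bar>z k t\<bar> \<le> m"
      using compact_continuous_bounded[OF zcont[OF k] compact_Icc] by blast
    show ?thesis
    proof (rule continuous_test_AE_zero[OF T])
      show "(\<lambda>t. zc k t - z k t) \<in> borel_measurable ?L"
        by (intro borel_measurable_diff borel_L[OF zcm]
            continuous_imp_measurable_on_sets_lebesgue[OF zcont[OF k]]) simp
      fix t assume t: "t \<in> {0..T}"
      show "\<bar>zc k t - z k t\<bar> \<le> \<bar>a k\<bar> + \<bar>b k\<bar> + m"
        using bspec[OF m t] zc_mem[OF k, of t] by (auto simp: ab)
    next
      fix \<psi> :: "real \<Rightarrow> real" assume \<psi>: "continuous_on UNIV \<psi>"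
      \<comment> \<open>With the end points equal, the right-hand side of \<open>compare\<close>
        vanishes for every \<phi>, and every continuous \<psi> is the derivative of some
        \<phi>.\<close>
      have "\<exists>\<phi>. \<forall>t::real. - \<infinity> < ereal t \<longrightarrow> ereal t < \<infinity> \<longrightarrow> (\<phi> has_vector_derivative \<psi> t) (at t)"
        using \<psi> by (intro einterval_antiderivative) (auto simp: continuous_on_eq_continuous_at)
      then obtain \<phi> where \<phi>: "\<And>t. (\<phi> has_real_derivative \<psi> t) (at t)"
        by (auto simp: has_real_derivative_iff_has_vector_derivative)
      show "(LINT t|?L. \<psi> t * (zc k t - z k t)) = 0"
        using compare[OF k \<phi> \<psi>] end_eq[OF k] by simp
    qed
  qed

  have traj: "mode_trajectory lam B \<Psi> N T z0 u z"
    unfolding mode_trajectory_def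
  proof (intro allI impI ballI)
    fix k t assume k: "k < N" and t: "t \<in> {0..T}"
    have "w k integrable_on {0..t}"
      by (rule integrable_on_subinterval[OF wint[OF k]]) (use t in auto)
    then have wt: "(w k has_integral (z k t - mode \<Psi> z0 k)) {0..t}"
      unfolding z_def by (simp add: integrable_integral)
    have "AE s in lebesgue. s \<in> {0..T} \<longrightarrow> zc k s - z k s = 0"
      using z_AE[OF k] by (simp add: AE_restrict_space_iff)
    \<comment> \<open>So far z k integrates the field evaluated at zc k; the two states differ on a
      null set, which leaves the integral unchanged.\<close>
    then obtain E where E: "{s \<in> space lebesgue. \<not> (s \<in> {0..T} \<longrightarrow> zc k s - z k s = 0)} \<subseteq> E" "E \<in> null_sets lebesgue"
      unfolding eventually_ae_filter by blast
    show "((\<lambda>s. mode_field lam B \<Psi> k (z k s) (u s)) has_integral z k t - mode \<Psi> z0 k) {0..t}"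
    proof (rule has_integral_spike[OF _ _ wt])
      show "negligible E" using E(2) by (simp add: negligible_iff_null_sets)
      fix s assume "s \<in> {0..t} - E"
      then have "zc k s = z k s" using E(1) t by auto
      then show "mode_field lam B \<Psi> k (z k s) (u s) = w k s" by (simp add: w_def)
    qed
  qed
  have inZ: "AE t in ?L. (\<forall>k<N. z k t \<in> mode_set \<Psi> Zs k) \<and> u t \<in> U"
  proof -
    have "AE t in ?L. \<forall>k\<in>{..<N}. zc k t - z k t = 0"
      using z_AE by (intro AE_finite_allI) auto
    then show ?thesis
    proof eventually_elim
      case (elim t)
      then show ?case using zc_mem uU by (metis eq_iff_diff_eq_0 lessThan_iff)
    qed
  qed
  have inZT: "z k T \<in> mode_set \<Psi> ZT k" if k: "k < N" for k
  proof -
    obtain a' b' where ab': "mode_set \<Psi> ZT k = {a'..b'}" using ZT by blast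
    interpret mT: finite_measure \<mu>T using pD(2) by (simp add: borel_measures_on_def)
    have spT: "space \<mu>T = target N" by (rule space_borel_measures_on[OF pD(2)])
    have "continuous_on (target N) (\<lambda>z. z k)"
      by (rule continuous_on_product_then_coordinatewise) (rule continuous_on_id)
    then have int: "integrable \<mu>T (\<lambda>z. z k)"
      by (rule borel_measure_integrable[OF pD(2) compact_mode_box(2)])
    have zT: "a' \<le> y k \<and> y k \<le> b'" if "y \<in> space \<mu>T" for y
    proof -
      have "y k \<in> mode_set \<Psi> ZT k" using that k by (simp add: spT mode_box_def PiE_iff)
      then show ?thesis by (simp add: ab')
    qed
    have "(LINT y|\<mu>T. a') \<le> e k" "e k \<le> (LINT y|\<mu>T. b')"
      unfolding e_def using zT int by (intro integral_mono; simp)+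
    then show ?thesis using primal_mass(1)[OF p] by (simp add: end_eq[OF k] ab' spT)
  qed
  have "u \<in> mode_controls N"
    unfolding admissible_mode_controls_def using controls traj inZ inZT by blast
  then show ?thesis using cost by blast
qed

end

section \<open>From the hypotheses of the theorem to the finite-dimensional setting\<close>

lemma smooth_on_imp_continuous_on: "smooth_on f X \<Longrightarrow> continuous_on X f"
proof -
  assume "smooth_on f X"
  then obtain W F where "X \<subseteq> W" and F: "\<forall>k. Ck_on k F W" "\<forall>x\<in>X. F x = f x"
    unfolding smooth_on_def by blast
  have "continuous_on W F" using spec[OF F(1), of 0] by simp
  then have "continuous_on X F" using \<open>X \<subseteq> W\<close> by (rule continuous_on_subset)
  then show ?thesis by (rule continuous_on_eq) (use F(2) in auto)
qed

text \<open>The infimum defining the relaxed cost runs over a compact fibre of B in U and is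
  attained, so the convexity inequality for infima becomes one for an actual control w. The shift c,
  later A z, cancels because the weights 1 - a and a sum to 1.\<close>

lemma (in mode_problem) input_convexI:
  fixes c :: 'a
  assumes "\<forall>t\<in>{0..T}. convex {c + B u |u. u \<in> U} \<and>
      convex_on {c + B u |u. u \<in> U} (\<lambda>v. Inf {h t u |u. u \<in> U \<and> v = c + B u})"
  shows input_convex
  unfolding input_convex_def
proof (intro ballI)
  fix t u v and a :: real assume t: "t \<in> {0..T}" and u: "u \<in> U" and v: "v \<in> U" and a: "a \<in> {0..1}"
  let ?V = "{c + B u |u. u \<in> U}" and ?g = "\<lambda>v. Inf {h t u |u. u \<in> U \<and> v = c + B u}"
  have cV: "convex ?V" and cg: "convex_on ?V ?g" using assms t by blast+
  have bdd: "bdd_below (h t ` U)"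
    using continuous_on_h_section[OF t] U
    by (intro bounded_imp_bdd_below compact_imp_bounded compact_continuous_image)
  have g_le: "?g (c + B x) \<le> h t x" if "x \<in> U" for x
    by (rule cInf_lower) (use that in \<open>auto intro: bdd_below_mono[OF bdd]\<close>)
  have "(1 - a) *\<^sub>R (c + B u) + a *\<^sub>R (c + B v) \<in> ?V"
    by (rule convexD_alt[OF cV]) (use u v a in auto)
  then obtain x where x: "x \<in> U" "(1 - a) *\<^sub>R (c + B u) + a *\<^sub>R (c + B v) = c + B x" by blast
  let ?S = "U \<inter> {w. B w = B x}"
  have "compact ?S"
    by (intro compact_Int_closed U closed_Collect_eq B_continuous continuous_intros)
  moreover have "continuous_on ?S (h t)" using continuous_on_h_section[OF t] by (rule continuous_on_subset) auto
  ultimately obtain w where w: "w \<in> ?S" "\<And>y. y \<in> ?S \<Longrightarrow> h t w \<le> h t y"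
    using continuous_attains_inf[of ?S "h t"] x(1) by blast
  have "h t w \<le> ?g (c + B x)"
    by (rule cInf_greatest) (use w x(1) in auto)
  also have "\<dots> \<le> (1 - a) * ?g (c + B u) + a * ?g (c + B v)"
    unfolding x(2)[symmetric] by (rule convex_onD[OF cg]) (use a u v in auto)
  also have "\<dots> \<le> (1 - a) * h t u + a * h t v"
    using g_le[OF u] g_le[OF v] a by (intro add_mono mult_left_mono) auto
  finally have "h t w \<le> (1 - a) * h t u + a * h t v" .
  moreover have "B w = (1 - a) *\<^sub>R B u + a *\<^sub>R B v"
  proof -
    have "B w = B x" using w(1) by simp
    also have "\<dots> = (1 - a) *\<^sub>R (c + B u) + a *\<^sub>R (c + B v) - c" using x(2) by simp
    also have "\<dots> = (1 - a) *\<^sub>R B u + a *\<^sub>R B v" by (simp add: algebra_simps)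
    finally show ?thesis .
  qed
  ultimately show "\<exists>w\<in>U. B w = (1 - a) *\<^sub>R B u + a *\<^sub>R B v \<and> h t w \<le> (1 - a) * h t u + a * h t v"
    using w(1) by blast
qed

theorem theorem3p3:
  fixes D :: "'a::{real_inner, banach} set"
    and A :: "'a \<Rightarrow> 'a"
    and lam :: "nat \<Rightarrow> real"
    and \<Phi> \<Psi> :: "nat \<Rightarrow> 'a"
    and S :: "real \<Rightarrow> 'a \<Rightarrow> 'a"
    and B :: "real^'m \<Rightarrow> 'a"
    and U :: "(real^'m) set"
    and Zs ZT :: "'a set"
    and T :: real
    and z0 :: 'a
    and h :: "real \<Rightarrow> real^'m \<Rightarrow> real"
  assumes A: "riesz_spectral D A lam \<Phi>"
    and Psi: "dual_eigenvectors D A \<Phi> \<Psi>"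
    and S: "C0_semigroup S" "infinitesimal_generator S D A"
    and U: "compact U"
    and B: "bounded_linear B"
    and ZT: "ZT \<subseteq> Zs \<inter> D"
    and T: "T > 0"
    and z0: "z0 \<in> D"
    and h: "smooth_on (\<lambda>(t, u). h t u) ({0..} \<times> U)"
    and Z_intervals: "\<forall>k. \<exists>a b. mode_set \<Psi> Zs k = {a..b}"
    and ZT_intervals: "\<forall>k. \<exists>a b. mode_set \<Psi> ZT k = {a..b}"
    and admissible: "admissible_controls S B U Zs ZT T z0 \<noteq> {}"
  shows
    "(\<forall>N>0.
        (\<exists>(\<mu>, \<mu>T)\<in>lp_feasible lam B \<Psi> U Zs ZT N T z0.
           ereal (lp_cost h \<mu>) = lp_value h lam B \<Psi> U Zs ZT N T z0) \<and>
        lp_value h lam B \<Psi> U Zs ZT N T z0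
          \<le> optimal_cost h T (admissible_mode_controls lam B \<Psi> U Zs ZT N T z0) \<and>
        optimal_cost h T (admissible_mode_controls lam B \<Psi> U Zs ZT N T z0)
          \<le> optimal_cost h T (admissible_controls S B U Zs ZT T z0))
     \<and>
     (\<forall>N>0. lp_value h lam B \<Psi> U Zs ZT N T z0 = dual_value h lam B \<Psi> U Zs ZT N T z0)
     \<and>
     ((\<forall>t\<in>{0..T}. \<forall>z\<in>Zs \<inter> D.
          convex {A z + B u |u. u \<in> U} \<and>
          convex_on {A z + B u |u. u \<in> U} (\<lambda>v. Inf {h t u |u. u \<in> U \<and> v = A z + B u}))
      \<longrightarrow>
      (\<forall>N>0.
         (\<exists>u\<in>admissible_mode_controls lam B \<Psi> U Zs ZT N T z0.
            ereal (cost h T u)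
              = optimal_cost h T (admissible_mode_controls lam B \<Psi> U Zs ZT N T z0)) \<and>
         lp_value h lam B \<Psi> U Zs ZT N T z0
           = optimal_cost h T (admissible_mode_controls lam B \<Psi> U Zs ZT N T z0)))"
proof -
  have "continuous_on ({0..} \<times> U) (\<lambda>(t, u). h t u)" using h by (rule smooth_on_imp_continuous_on)
  then have hc: "continuous_on ({0..T} \<times> U) (\<lambda>(t, u). h t u)" by (rule continuous_on_subset) auto
  \<comment> \<open>The end state of an admissible trajectory lies in ZT; it provides one state at
    which the hypothesis of (iii) can be evaluated.\<close>
  obtain z where z: "z \<in> Zs \<inter> D" using admissible ZT by (auto simp: admissible_controls_def)
  interpret mode_problem lam B \<Psi> U Zs ZT T z0 h
    by (rule mode_problem.intro[OF B U T hc Z_intervals[rule_format] ZT_intervals[rule_format]])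
  have sub: "admissible_controls S B U Zs ZT T z0 \<subseteq> mode_controls N" for N
    using admissible_imp_mode_admissible[OF A Psi S B U T] by blast
  have ne: "primal N \<noteq> {}" for N
    using admissible sub[of N] occupation_measure_feasible by blast
  have i3: "optimal_cost h T (mode_controls N)
      \<le> optimal_cost h T (admissible_controls S B U Zs ZT T z0)" for N
    unfolding optimal_cost_def using sub by (rule INF_superset_mono) simp
  have iii: "(\<exists>u\<in>mode_controls N.
        ereal (cost h T u) = optimal_cost h T (mode_controls N)) \<and>
      primal_value N
        = optimal_cost h T (mode_controls N)"
    if conv: "\<forall>t\<in>{0..T}. \<forall>z\<in>Zs \<inter> D.
        convex {A z + B u |u. u \<in> U} \<and>
        convex_on {A z + B u |u. u \<in> U} (\<lambda>v. Inf {h t u |u. u \<in> U \<and> v = A z + B u})" for N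
  proof -
    let ?C = "mode_controls N"
    have input_convex by (rule input_convexI[of "A z"]) (use conv z in blast)
    moreover obtain \<mu> \<mu>T where \<mu>: "(\<mu>, \<mu>T) \<in> primal N" "ereal (lp_cost h \<mu>) = primal_value N"
      using lp_value_attained[OF ne] by blast
    ultimately obtain u where u: "u \<in> ?C" "cost h T u \<le> lp_cost h \<mu>"
      using control_from_measure by blast
    \<comment> \<open>The cost of u lies between the mode optimum and the value of the linear
      program, which is itself at most the mode optimum; so all three agree.\<close>
    have "optimal_cost h T ?C \<le> ereal (cost h T u)"
      unfolding optimal_cost_def by (rule INF_lower[OF u(1)])
    moreover have "ereal (cost h T u) \<le> primal_value N"
      using u(2) by (simp add: \<mu>(2)[symmetric])
    moreover note lp_value_le_optimal_cost[of N]
    ultimately have "ereal (cost h T u) = optimal_cost h T ?C" "primal_value N = optimal_cost h T ?C"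
      by order+
    then show ?thesis using u(1) by blast
  qed
  show ?thesis
    using lp_value_attained[OF ne] lp_value_le_optimal_cost i3 strong_duality[OF ne] iii by blast
qed

end
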